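(* For any $\mu\in\mathcal M^o$, $\widetilde{\mathrm P}^{(t)}_\mu$ converges to $\widetilde{\mathrm P}^{(\infty)}_\mu$ locally strongly as $t\to\infty$.
   Context: Setting. $E$ is a Polish space. For a metric space $F$, $b\mathcal B(F)$, $p\mathcal B(F)$, $bp\mathcal B(F)$ denote the bounded, the non-negative, and the bounded non-negative Borel functions on $F$. $\mathbb R_+=[0,\infty)$. $(\xi_t)_{t\in[0,\zeta)}$ is an $E$-valued Borel right process with (possibly sub-Markovian) transition semigroup $(P_t)_{t\ge0}$ and lifetime $\zeta$; $\Pi_x$ is its law started from $x\in E$. The branching mechanism is $$\psi(x,z)=-\beta(x)z+\sigma(x)^2z^2+\int_{(0,\infty)}(e^{-zu}-1+zu)\,\pi(x,du),\quad x\in E,\ z\ge0,$$ with $\beta,\sigma\in b\mathcal B(E)$ and $\pi$ a kernel from $E$ to $(0,\infty)$ with $\sup_{x\in E}\int_{(0,\infty)}(u\wedge u^2)\pi(x,du)<\infty$. For $f\in bp\mathcal B(E)$, $(t,x)\mapsto V_tf(x)$ is the unique non-negative Borel function on $\mathbb R_+\times E$ that is bounded on $[0,t_0]\times E$ for every $t_0\ge 0$ and satisfies $V_tf(x)+\int_0^t ds\int_E\psi(y,V_{t-s}f(y))P_s(x,dy)=P_tf(x)$ for all $t\ge0,x\in E$. $\mathcal M$ is the Polish space of finite Borel measures on $E$ with the topology of weak convergence, $\mathbf 0$ is the null measure, $\mathcal M^o=\mathcal M\setminus\{\mathbf 0\}$, and $\gamma(f)=\int f\,d\gamma$. The $(\xi,\psi)$-superprocess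 $X=(X_t)_{t\ge0}$ is the $\mathcal M$-valued conservative right process with transition semigroup $(Q_t)_{t\ge0}$ determined by $\int_{\mathcal M}e^{-\eta(f)}Q_t(\mu,d\eta)=e^{-\mu(V_tf)}$ for $\mu\in\mathcal M$, $t\ge0$, $f\in bp\mathcal B(E)$. It is realized as the coordinate process on the space $\Omega$ of $\mathcal M$-valued right-continuous functions on $\mathbb R_+$; $\mathcal F_t=\sigma(X_s:s\le t)$, $\mathcal F=\sigma(X_s:s\ge0)$; $\mathrm P_\mu$ is the law (and expectation) of $X$ with $X_0=\mu$. The mean semigroup is $T_tf(x)=\Pi_x[e^{\int_0^t\beta(\xi_s)ds}f(\xi_t)\mathbf 1_{\{t<\zeta\}}]$, and $L_1^+(\nu)$ is the set of $f\in p\mathcal B(E)$ with $\nu(f)<\infty$. Standing assumptions: (i) There are $\lambda\in\mathbb R$, a bounded strictly positive Borel function $\phi$ on $E$ and a probability measure $\nu$ with full support on $E$ such that $\nu(\phi)=1$ and, for all $t\ge0$, $T_t\phi=e^{\lambda t}\phi$ and $\nu T_t=e^{\lambda t}\nu$. (ii) There is a map $(t,x,f)\mapsto H_tf(x)$ from $(0,\infty)\times E\times L_1^+(\nu)$ to $\mathbb R$ with $T_tf(x)=e^{\lambda t}\phi(x)\nu(f)(1+H_tf(x))$ for all $t>0$, $x\in E$, $f\in L_1^+(\nu)$; $\sup_{x\in E,f\in L_1^+(\nu)}|H_tf(x)|<\infty$ for every $t>0$; and $\lim_{t\to\infty}\sup_{x\in E,f\in L_1^+(\nu)}|H_tf(x)|=0$.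 (iii) $\lambda<0$ (subcriticality). (iv) $\mathrm P_\nu(X_t=\mathbf 0)>0$ for all $t>0$. For $t\ge0$ and $\mu\in\mathcal M^o$, $\widetilde{\mathrm P}^{(t)}_\mu$ is the probability measure on $(\Omega,\mathcal F)$ with $\widetilde{\mathrm P}^{(t)}_\mu[H]=\mathrm P_\mu[H\mid X_t\ne\mathbf 0]$ for bounded non-negative $\mathcal F$-measurable $H$. $\widetilde{\mathrm P}^{(\infty)}_\mu$ is the unique probability measure on $(\Omega,\mathcal F)$ such that for every $s\ge0$ and every non-negative $\mathcal F_s$-measurable $H$, $\widetilde{\mathrm P}^{(\infty)}_\mu[H]=\mathrm P_\mu\big[\frac{X_s(\phi)}{e^{\lambda s}\mu(\phi)}H\big]$ (it exists). A family $(\mathrm R^{(t)})_{t\ge0}$ of probability measures on $\Omega$ converges locally strongly, as $t\to\infty$, to a probability measure $\mathrm R$ on $\Omega$ if for every $s\ge0$ and every bounded non-negative $\mathcal F_s$-measurable $H$, $\lim_{t\to\infty}\mathrm R^{(t)}(H)=\mathrm R(H)$. *)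

theory Defs
  imports "HOL-Probability.Probability"
begin

section \<open>Borel structures and the weak topology\<close>

definition borel_of :: "'a topology \<Rightarrow> 'a measure" where
  "borel_of T = sigma (topspace T) {U. openin T U}"

lemma borel_of_euclidean: "borel_of euclidean = borel"
  by (simp add: borel_of_def borel_def)

definition finite_borel_measures :: "'e::topological_space measure set" where
  "finite_borel_measures = {m. sets m = sets borel \<and> finite_measure m}"

definition weak_topology :: "'e::topological_space measure topology" where
  "weak_topology = topology_generated_by
     {{m \<in> finite_borel_measures. (LINT x|m. f x) \<in> U} | (f :: 'e \<Rightarrow> real) U.
        continuous_on UNIV f \<and> bounded (range f) \<and> open U}"

lemma topspace_weak_topology: "topspace weak_topology = finite_borel_measures"
proof -
  have "continuous_on UNIV (\<lambda>x::'a. 0::real) \<and> bounded (range (\<lambda>x::'a. 0::real)) \<and> open (UNIV :: real set)"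
    by simp
  then have "{m \<in> finite_borel_measures. (LINT x|m. 0) \<in> (UNIV :: real set)} \<in>
     {{m \<in> finite_borel_measures. (LINT x|m. f x) \<in> U} | (f :: 'a \<Rightarrow> real) U.
        continuous_on UNIV f \<and> bounded (range f) \<and> open U}"
    by blast
  then show ?thesis
    unfolding weak_topology_def topology_generated_by_topspace by blast
qed

definition universally_measurable :: "'s measure \<Rightarrow> ('s \<Rightarrow> ennreal) \<Rightarrow> bool" where
  "universally_measurable M f \<longleftrightarrow>
     (\<forall>m. sets m = sets M \<and> finite_measure m \<longrightarrow> f \<in> borel_measurable (completion m))"

section \<open>Borel right processes\<close>

text \<open>A process with state space \<open>E\<close> and finite or infinite lifetime is a family of maps into
  \<open>E \<union> {\<partial>}\<close>, the cemetery \<open>\<partial>\<close> being \<^term>\<open>None\<close>; the lifetime is the hitting time of \<open>\<partial>\<close>, so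
  \<open>t < \<zeta>\<close> means that the process is not at \<^term>\<open>None\<close> at time \<open>t\<close>. A conservative process
  takes only values \<open>Some y\<close>. Times are reals, and only times \<open>t \<ge> 0\<close> matter.\<close>

definition transition_semigroup :: "'s measure \<Rightarrow> (real \<Rightarrow> 's \<Rightarrow> 's measure) \<Rightarrow> bool" where
  "transition_semigroup M P \<longleftrightarrow>
     (\<forall>t\<ge>0. P t \<in> M \<rightarrow>\<^sub>M subprob_algebra M) \<and>
     (\<forall>s\<ge>0. \<forall>t\<ge>0. \<forall>x\<in>space M. P (s + t) x = P s x \<bind> P t)"

text \<open>Functions on \<open>E\<close> are extended to \<open>\<partial>\<close> by \<open>0\<close>. The integral of a universally measurable
  function is the one with respect to the completed measure.\<close>

definition excessive ::
  "'s measure \<Rightarrow> (real \<Rightarrow> 's \<Rightarrow> 's measure) \<Rightarrow> real \<Rightarrow> ('s \<Rightarrow> ennreal) \<Rightarrow> bool" where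
  "excessive M P \<alpha> f \<longleftrightarrow> universally_measurable M f \<and>
     (\<forall>x\<in>space M.
        (\<forall>t\<ge>0. ennreal (exp (- \<alpha> * t)) * (\<integral>\<^sup>+ y. f y \<partial>completion (P t x)) \<le> f x) \<and>
        ((\<lambda>t. ennreal (exp (- \<alpha> * t)) * (\<integral>\<^sup>+ y. f y \<partial>completion (P t x))) \<longlongrightarrow> f x) (at_right 0))"

definition process_sigma ::
  "'s measure \<Rightarrow> 'w set \<Rightarrow> (real \<Rightarrow> 'w \<Rightarrow> 's option) \<Rightarrow> real set \<Rightarrow> 'w measure" where
  "process_sigma M \<Omega> \<xi> I =
     sigma \<Omega> {{w \<in> \<Omega>. \<xi> t w \<in> Some ` B} | t B. t \<in> I \<and> B \<in> sets M}"

text \<open>\<open>Pr x\<close> is the law \<open>\<Pi>\<^sub>x\<close> of the process started from \<open>x\<close>, and \<open>m \<bind> Pr\<close> the law with initial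
  distribution \<open>m\<close>. The last clause is the second of the usual \<open>hypotheses droites\<close>; "almost
  surely" refers to every initial distribution.\<close>

definition borel_right_process ::
  "'s topology \<Rightarrow> (real \<Rightarrow> 's \<Rightarrow> 's measure) \<Rightarrow> 'w measure \<Rightarrow> (real \<Rightarrow> 'w \<Rightarrow> 's option) \<Rightarrow>
   ('s \<Rightarrow> 'w measure) \<Rightarrow> bool" where
  "borel_right_process T P W \<xi> Pr \<longleftrightarrow>
     transition_semigroup (borel_of T) P \<and>
     Pr \<in> borel_of T \<rightarrow>\<^sub>M prob_algebra W \<and>
     (\<forall>t\<ge>0. \<forall>w\<in>space W. \<xi> t w \<in> insert None (Some ` topspace T)) \<and>
     (\<forall>t\<ge>0. \<forall>B\<in>sets (borel_of T). {w \<in> space W. \<xi> t w \<in> Some ` B} \<in> sets W) \<and>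
     (\<forall>x\<in>topspace T. AE w in Pr x. \<xi> 0 w = Some x) \<and>
     (\<forall>w\<in>space W. \<forall>s t. 0 \<le> s \<and> s \<le> t \<and> \<xi> s w = None \<longrightarrow> \<xi> t w = None) \<and>
     (\<forall>w\<in>space W. \<forall>t\<ge>0. \<forall>y. \<xi> t w = Some y \<longrightarrow>
        (\<forall>\<^sub>F s in at_right t. \<xi> s w \<noteq> None) \<and> limitin T (\<lambda>s. the (\<xi> s w)) y (at_right t)) \<and>
     (\<forall>x\<in>topspace T. \<forall>s\<ge>0. \<forall>t\<ge>0.
        \<forall>A\<in>sets (process_sigma (borel_of T) (space W) \<xi> {0..s}). \<forall>B\<in>sets (borel_of T).
          emeasure (Pr x) {w \<in> A. \<xi> (s + t) w \<in> Some ` B} =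
          (\<integral>\<^sup>+ w. (case \<xi> s w of None \<Rightarrow> 0 | Some y \<Rightarrow> emeasure (P t y) B) * indicator A w \<partial>Pr x)) \<and>
     (\<forall>\<alpha>>0. \<forall>f. excessive (borel_of T) P \<alpha> f \<longrightarrow>
        (\<forall>m\<in>space (prob_algebra (borel_of T)). AE w in m \<bind> Pr. \<forall>t\<ge>0.
           ((\<lambda>s. case \<xi> s w of None \<Rightarrow> 0 | Some y \<Rightarrow> f y) \<longlongrightarrow>
             (case \<xi> t w of None \<Rightarrow> 0 | Some y \<Rightarrow> f y)) (at_right t)))"

text \<open>The mean semigroup \<open>T\<^sub>t f(x) = \<Pi>\<^sub>x[exp(\<integral>\<^sub>0\<^sup>t \<beta>(\<xi>\<^sub>s) ds) f(\<xi>\<^sub>t) 1\<^bsub>{t < \<zeta>}\<^esub>]\<close>, with values in \<open>[0,\<infty>]\<close>.\<close>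

definition mean_semigroup ::
  "('e \<Rightarrow> real) \<Rightarrow> (real \<Rightarrow> 'w \<Rightarrow> 'e option) \<Rightarrow> ('e \<Rightarrow> 'w measure) \<Rightarrow>
   real \<Rightarrow> ('e \<Rightarrow> ennreal) \<Rightarrow> 'e \<Rightarrow> ennreal" where
  "mean_semigroup \<beta> \<xi> Pr t f x =
     (\<integral>\<^sup>+ w. (case \<xi> t w of None \<Rightarrow> 0
        | Some y \<Rightarrow> ennreal (exp (LINT s:{0..t}|lborel. \<beta> (the (\<xi> s w)))) * f y) \<partial>Pr x)"

section \<open>Branching mechanism and cumulant equation\<close>

definition bounded_borel :: "('e::topological_space \<Rightarrow> real) \<Rightarrow> bool" where
  "bounded_borel f \<longleftrightarrow> f \<in> borel_measurable borel \<and> bounded (range f)"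

definition L1_plus :: "'e::topological_space measure \<Rightarrow> ('e \<Rightarrow> real) set" where
  "L1_plus \<nu> = {f \<in> borel_measurable borel. (\<forall>x. 0 \<le> f x) \<and> (\<integral>\<^sup>+ x. ennreal (f x) \<partial>\<nu>) < \<infinity>}"

definition levy_kernel :: "('e::topological_space \<Rightarrow> real measure) \<Rightarrow> bool" where
  "levy_kernel \<pi> \<longleftrightarrow>
     (\<forall>x. sets (\<pi> x) = sets (restrict_space borel {0<..})) \<and>
     (\<forall>B\<in>sets (restrict_space borel {0<..}). (\<lambda>x. emeasure (\<pi> x) B) \<in> borel_measurable borel) \<and>
     (SUP x. \<integral>\<^sup>+ u. ennreal (min u (u\<^sup>2)) \<partial>\<pi> x) < \<infinity>"

definition branching_mechanism ::
  "('e \<Rightarrow> real) \<Rightarrow> ('e \<Rightarrow> real) \<Rightarrow> ('e \<Rightarrow> real measure) \<Rightarrow> 'e \<Rightarrow> real \<Rightarrow> real" where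
  "branching_mechanism \<beta> \<sigma> \<pi> x z =
     - \<beta> x * z + (\<sigma> x)\<^sup>2 * z\<^sup>2 + (LINT u|\<pi> x. exp (- z * u) - 1 + z * u)"

text \<open>\<open>v t x\<close> plays the role of \<open>V\<^sub>t f(x)\<close>. A solution in this class is unique on
  \<open>\<real>\<^sub>+ \<times> E\<close>, so the predicate determines \<open>v t\<close> for \<open>t \<ge> 0\<close>.\<close>

definition cumulant_solution ::
  "('e::polish_space \<Rightarrow> real \<Rightarrow> real) \<Rightarrow> (real \<Rightarrow> 'e \<Rightarrow> 'e measure) \<Rightarrow> ('e \<Rightarrow> real) \<Rightarrow>
   (real \<Rightarrow> 'e \<Rightarrow> real) \<Rightarrow> bool" where
  "cumulant_solution \<psi> P f v \<longleftrightarrow>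
     (\<lambda>(t, x). v t x) \<in> borel_measurable (restrict_space borel ({0..} \<times> UNIV)) \<and>
     (\<forall>t\<ge>0. \<forall>x. 0 \<le> v t x) \<and>
     (\<forall>t0\<ge>0. \<exists>C. \<forall>t\<in>{0..t0}. \<forall>x. v t x \<le> C) \<and>
     (\<forall>t\<ge>0. \<forall>x. v t x + (LINT s:{0..t}|lborel. (LINT y|P s x. \<psi> y (v (t - s) y))) = (LINT y|P t x. f y))"

section \<open>Path space and superprocess\<close>

text \<open>Paths are functions on \<open>[0,\<infty>)\<close>, represented extensionally.\<close>

definition right_continuous_paths :: "(real \<Rightarrow> 'e::topological_space measure) set" where
  "right_continuous_paths =
     {w \<in> {0..} \<rightarrow>\<^sub>E finite_borel_measures. \<forall>t\<ge>0. limitin weak_topology w (w t) (at_right t)}"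

definition coordinate :: "real \<Rightarrow> (real \<Rightarrow> 's) \<Rightarrow> 's option" where
  "coordinate t w = Some (w t)"

text \<open>\<open>path_sigma {0..t}\<close> is \<open>\<F>\<^sub>t\<close> and \<open>path_sigma {0..}\<close> is \<open>\<F>\<close>.\<close>

definition path_sigma :: "real set \<Rightarrow> (real \<Rightarrow> 'e::topological_space measure) measure" where
  "path_sigma I = process_sigma (borel_of weak_topology) right_continuous_paths coordinate I"

text \<open>\<open>\<P> \<mu>\<close> is the law of the superprocess started from \<open>\<mu>\<close>. Conservativeness is built in,
  since \<^term>\<open>coordinate\<close> never takes the value \<^term>\<open>None\<close>.\<close>

definition superprocess ::
  "(real \<Rightarrow> ('e::topological_space \<Rightarrow> real) \<Rightarrow> 'e \<Rightarrow> real) \<Rightarrow>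
   (real \<Rightarrow> 'e measure \<Rightarrow> 'e measure measure) \<Rightarrow>
   ('e measure \<Rightarrow> (real \<Rightarrow> 'e measure) measure) \<Rightarrow> bool" where
  "superprocess V Q \<P> \<longleftrightarrow>
     borel_right_process weak_topology Q (path_sigma {0..}) coordinate \<P> \<and>
     (\<forall>\<mu>\<in>finite_borel_measures. \<forall>t\<ge>0. \<forall>f. bounded_borel f \<and> (\<forall>x. 0 \<le> f x) \<longrightarrow>
        (LINT \<eta>|Q t \<mu>. exp (- (LINT x|\<eta>. f x))) = exp (- (LINT x|\<mu>. V t f x)))"

definition survival :: "real \<Rightarrow> (real \<Rightarrow> 'e::topological_space measure) set" where
  "survival t = {w \<in> right_continuous_paths. w t \<noteq> null_measure borel}"

text \<open>The law \<open>\<P>\<^sub>\<mu>( \<cdot> | X\<^sub>t \<noteq> 0)\<close>.\<close>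

definition conditioned_law ::
  "('e::topological_space measure \<Rightarrow> (real \<Rightarrow> 'e measure) measure) \<Rightarrow> real \<Rightarrow> 'e measure \<Rightarrow>
   (real \<Rightarrow> 'e measure) measure" where
  "conditioned_law \<P> t \<mu> = uniform_measure (\<P> \<mu>) (survival t)"

definition path_law :: "(real \<Rightarrow> 'e::topological_space measure) measure \<Rightarrow> bool" where
  "path_law R \<longleftrightarrow> prob_space R \<and> sets R = sets (path_sigma {0..})"

text \<open>The defining property of the law \<open>\<P>\<^sub>\<mu>\<close> conditioned on never becoming extinct: the
  martingale change of measure with density \<open>X\<^sub>s(\<phi>) / (e\<^bsup>\<lambda>s\<^esup> \<mu>(\<phi>))\<close> on \<open>\<F>\<^sub>s\<close>. It determines
  \<open>R\<close> uniquely, the \<open>\<F>\<^sub>s\<close> generating \<open>\<F>\<close>.\<close>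

definition is_phi_transform ::
  "('e::topological_space measure \<Rightarrow> (real \<Rightarrow> 'e measure) measure) \<Rightarrow> real \<Rightarrow> ('e \<Rightarrow> real) \<Rightarrow>
   'e measure \<Rightarrow> (real \<Rightarrow> 'e measure) measure \<Rightarrow> bool" where
  "is_phi_transform \<P> lam \<phi> \<mu> R \<longleftrightarrow> path_law R \<and>
     (\<forall>s\<ge>0. \<forall>H :: (real \<Rightarrow> 'e measure) \<Rightarrow> ennreal. H \<in> borel_measurable (path_sigma {0..s}) \<longrightarrow>
        (\<integral>\<^sup>+ w. H w \<partial>R) =
        (\<integral>\<^sup>+ w. ennreal ((LINT x|w s. \<phi> x) / (exp (lam * s) * (LINT x|\<mu>. \<phi> x))) * H w \<partial>\<P> \<mu>))"

definition converges_locally_strongly ::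
  "(real \<Rightarrow> (real \<Rightarrow> 'e::topological_space measure) measure) \<Rightarrow> (real \<Rightarrow> 'e measure) measure \<Rightarrow> bool" where
  "converges_locally_strongly R R' \<longleftrightarrow>
     (\<forall>t\<ge>0. path_law (R t)) \<and> path_law R' \<and>
     (\<forall>s\<ge>0. \<forall>H :: (real \<Rightarrow> 'e measure) \<Rightarrow> real.
        H \<in> borel_measurable (path_sigma {0..s}) \<and>
        (\<exists>C. \<forall>w\<in>right_continuous_paths. 0 \<le> H w \<and> H w \<le> C) \<longrightarrow>
        ((\<lambda>t. LINT w|R t. H w) \<longlongrightarrow> (LINT w|R'. H w)) at_top)"

end

theory Submission
  imports Defs
begin

text \<open>
  The conditional law given survival up to time \<open>t\<close> is expressed through the extinction exponent
  \<open>v\<^sub>t(x) = - log P\<^sub>x(X\<^sub>t = 0)\<close> (\<open>P\<^sub>x\<close>: start from the Dirac mass at \<open>x\<close>). By the branching and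
  Markov properties, for \<open>H\<close> in \<open>\<F>\<^sub>s\<close> and \<open>t > s\<close>,
  \<open>P\<^sub>\<mu>[H; X\<^sub>t \<noteq> 0] = P\<^sub>\<mu>[H (1 - exp(- X\<^sub>s(v\<^bsub>t-s\<^esub>)))]\<close>. If \<open>v\<^sub>t(x) / v\<^sub>t(x0) \<rightarrow> \<phi>(x) / \<phi>(x0)\<close> for each \<open>x\<close>,
  with domination \<open>v\<^sub>t \<le> K \<phi> v\<^sub>t(x0)\<close> for large \<open>t\<close>, and \<open>v\<^sub>t \<rightarrow> 0\<close>, then dividing by \<open>v\<^bsub>t-s\<^esub>(x0)\<close> gives the
  limit \<open>P\<^sub>\<mu>[H X\<^sub>s(\<phi>)] / \<phi>(x0)\<close>; the quotient of this limit by the one for \<open>H = 1\<close> is the claim, since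
  \<open>P\<^sub>\<mu>[X\<^sub>s(\<phi>)] = exp(\<lambda>s) \<mu>(\<phi>)\<close>. In particular the decay rate of \<open>\<nu>(v\<^sub>t)\<close> never has to be identified.

  The asymptotics of \<open>v\<close> come from \<open>v\<^bsub>r+t\<^esub> = V\<^sub>r v\<^sub>t\<close> and a comparison of \<open>V\<^sub>r\<close> with the mean operator \<open>T\<^sub>r\<close>
  at a fixed time \<open>r\<close>:

  \<^item> \<open>V\<^sub>r f \<le> T\<^sub>r f\<close> (\<open>V_le_mean\<close>) and \<open>c T\<^sub>r f \<le> V\<^sub>r f\<close> for \<open>f \<le> 1\<close> with \<open>c > 0\<close> depending only on \<open>r\<close>
    (\<open>V_ge_mean\<close>). Both follow from one perturbation formula (\<open>perturbation_formula\<close>), which turns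
    the integral equation along the semigroup of the motion into one along a Feynman-Kac semigroup.
    With the uniform expansion \<open>T\<^sub>r f = exp(\<lambda>r) \<phi> \<nu>(f) (1 + o(1))\<close> they show that \<open>v\<^bsub>r+t\<^esub>\<close> is comparable to
    \<open>\<phi> \<nu>(v\<^sub>t)\<close> for a suitable \<open>r\<close>, and that \<open>v\<^sub>t\<close> tends to \<open>0\<close> uniformly because \<open>\<lambda> < 0\<close>
    (\<open>ext_rate_dominated\<close>, \<open>ext_rate_small\<close>).

  \<^item> For \<open>f \<le> c \<phi>\<close> one has \<open>T\<^sub>r f(x) - V\<^sub>r f(x) \<le> P\<^sub>x[q(c X\<^sub>r(\<phi>))]\<close>, where \<open>q(z) = exp(-z) - 1 + z\<close>
    (\<open>defect_le\<close>). As \<open>X\<^sub>r(\<phi>)\<close> is integrable and \<open>q(z) = o(z)\<close> at \<open>0\<close>, the defect is \<open>o(\<nu>(v\<^sub>t))\<close> for \<open>f = v\<^sub>t\<close>,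
    pointwise in \<open>x\<close> (\<open>linearization\<close>). Letting first \<open>t\<close> and then \<open>r\<close> tend to infinity yields the
    ratio limit (\<open>ext_rate_ratio\<close>).
\<close>

section \<open>Right processes and the Markov property\<close>

lemma space_borel_of [simp]: "space (borel_of T) = topspace T"
  unfolding borel_of_def by (rule space_measure_of) (auto dest: openin_subset)

lemma openin_in_borel_of: "openin T U \<Longrightarrow> U \<in> sets (borel_of T)"
  unfolding borel_of_def by (subst sets_measure_of) (auto dest: openin_subset)

lemma space_process_sigma [simp]: "space (process_sigma M \<Omega> \<xi> I) = \<Omega>"
  unfolding process_sigma_def by (rule space_measure_of) auto

lemma process_sigma_sets:
  "t \<in> I \<Longrightarrow> B \<in> sets M \<Longrightarrow> {w \<in> \<Omega>. \<xi> t w \<in> Some ` B} \<in> sets (process_sigma M \<Omega> \<xi> I)"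
  unfolding process_sigma_def by (subst sets_measure_of) auto

text \<open>A right process together with its transition semigroup \<open>P\<close> and its laws \<open>Pr x\<close>; the locale serves
  both the spatial motion and the superprocess.\<close>

locale right_process =
  fixes T :: "'s topology" and P :: "real \<Rightarrow> 's \<Rightarrow> 's measure"
    and W :: "'w measure" and \<xi> :: "real \<Rightarrow> 'w \<Rightarrow> 's option" and Pr :: "'s \<Rightarrow> 'w measure"
  assumes right_process: "borel_right_process T P W \<xi> Pr"
begin

text \<open>The natural filtration.\<close>

definition filt :: "real \<Rightarrow> 'w measure" where
  "filt s = process_sigma (borel_of T) (space W) \<xi> {0..s}"

lemma space_filt [simp]: "space (filt s) = space W"
  by (simp add: filt_def)

lemma kernel [measurable]: "0 \<le> t \<Longrightarrow> P t \<in> borel_of T \<rightarrow>\<^sub>M subprob_algebra (borel_of T)"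
  and chapman: "0 \<le> s \<Longrightarrow> 0 \<le> t \<Longrightarrow> x \<in> topspace T \<Longrightarrow> P (s + t) x = P s x \<bind> P t"
  using right_process by (auto simp: borel_right_process_def transition_semigroup_def)

lemma law_kernel [measurable]: "Pr \<in> borel_of T \<rightarrow>\<^sub>M prob_algebra W"
  using right_process by (auto simp: borel_right_process_def)

lemma law_prob: "x \<in> topspace T \<Longrightarrow> prob_space (Pr x)"
  and law_sets: "x \<in> topspace T \<Longrightarrow> sets (Pr x) = sets W"
  using measurable_space[OF law_kernel, of x] by (auto simp: space_prob_algebra)

lemma law_space: "x \<in> topspace T \<Longrightarrow> space (Pr x) = space W"
  by (rule sets_eq_imp_space_eq) (rule law_sets)

lemma sets_kernel: "0 \<le> t \<Longrightarrow> x \<in> topspace T \<Longrightarrow> sets (P t x) = sets (borel_of T)"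
  using measurable_space[OF kernel, of t x] by (auto simp: space_subprob_algebra)

lemma subprob_kernel: "0 \<le> t \<Longrightarrow> x \<in> topspace T \<Longrightarrow> subprob_space (P t x)"
  using measurable_space[OF kernel, of t x] by (auto simp: space_subprob_algebra)

lemmas right_process_conjuncts = right_process[unfolded borel_right_process_def]

lemma state_space: "0 \<le> t \<Longrightarrow> w \<in> space W \<Longrightarrow> \<xi> t w \<in> insert None (Some ` topspace T)"
  using right_process_conjuncts[THEN conjunct2, THEN conjunct2, THEN conjunct1] by blast

lemma position_in_space: "0 \<le> t \<Longrightarrow> w \<in> space W \<Longrightarrow> \<xi> t w = Some y \<Longrightarrow> y \<in> topspace T"
  using state_space[of t w] by auto

lemma events: "0 \<le> t \<Longrightarrow> B \<in> sets (borel_of T) \<Longrightarrow> {w \<in> space W. \<xi> t w \<in> Some ` B} \<in> sets W"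
  using right_process_conjuncts[THEN conjunct2, THEN conjunct2, THEN conjunct2, THEN conjunct1] by blast

lemma start: "x \<in> topspace T \<Longrightarrow> AE w in Pr x. \<xi> 0 w = Some x"
  using right_process_conjuncts[THEN conjunct2, THEN conjunct2, THEN conjunct2, THEN conjunct2,
    THEN conjunct1] by blast

lemma absorbed: "w \<in> space W \<Longrightarrow> 0 \<le> s \<Longrightarrow> s \<le> t \<Longrightarrow> \<xi> s w = None \<Longrightarrow> \<xi> t w = None"
  using right_process_conjuncts[THEN conjunct2, THEN conjunct2, THEN conjunct2, THEN conjunct2,
    THEN conjunct2, THEN conjunct1] by blast

lemma alive_right: "w \<in> space W \<Longrightarrow> 0 \<le> t \<Longrightarrow> \<xi> t w = Some y \<Longrightarrow> \<forall>\<^sub>F s in at_right t. \<xi> s w \<noteq> None"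
  and right_limit: "w \<in> space W \<Longrightarrow> 0 \<le> t \<Longrightarrow> \<xi> t w = Some y \<Longrightarrow> limitin T (\<lambda>s. the (\<xi> s w)) y (at_right t)"
  using right_process_conjuncts[THEN conjunct2, THEN conjunct2, THEN conjunct2, THEN conjunct2,
    THEN conjunct2, THEN conjunct2, THEN conjunct1] by blast+

lemma markov_sets: "x \<in> topspace T \<Longrightarrow> 0 \<le> s \<Longrightarrow> 0 \<le> t \<Longrightarrow> A \<in> sets (filt s) \<Longrightarrow> B \<in> sets (borel_of T) \<Longrightarrow>
    emeasure (Pr x) {w \<in> A. \<xi> (s + t) w \<in> Some ` B} =
    (\<integral>\<^sup>+ w. (case \<xi> s w of None \<Rightarrow> 0 | Some y \<Rightarrow> emeasure (P t y) B) * indicator A w \<partial>Pr x)"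
  using right_process_conjuncts[THEN conjunct2, THEN conjunct2, THEN conjunct2, THEN conjunct2,
    THEN conjunct2, THEN conjunct2, THEN conjunct2, THEN conjunct1] unfolding filt_def by blast

lemma measurable_kernel_iff:
  "0 \<le> t \<Longrightarrow> y \<in> topspace T \<Longrightarrow> measurable (P t y) N = measurable (borel_of T) N"
  by (rule measurable_cong_sets) (simp_all add: sets_kernel)

lemma filt_subset: "sets (filt s) \<subseteq> sets W"
  unfolding filt_def process_sigma_def
  by (subst sets_measure_of) (auto intro!: sets.sigma_sets_subset events)

lemma measurable_from_filt: "f \<in> measurable (filt s) N \<Longrightarrow> f \<in> measurable W N"
  using filt_subset[of s] by (auto simp: measurable_def)

lemma measurable_law_iff: "x \<in> topspace T \<Longrightarrow> measurable (Pr x) N = measurable W N"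
  by (rule measurable_cong_sets) (simp_all add: law_sets)

text \<open>Functions of the position at time \<open>t\<close>, with an arbitrary value \<open>c\<close> at the cemetery.\<close>

lemma position_measurable_filt:
  assumes g: "g \<in> measurable (borel_of T) N" and c: "c \<in> space N" and t: "0 \<le> t" "t \<le> s"
  shows "(\<lambda>w. case \<xi> t w of None \<Rightarrow> c | Some y \<Rightarrow> g y) \<in> measurable (filt s) N"
proof (rule measurableI)
  fix w assume w: "w \<in> space (filt s)"
  show "(case \<xi> t w of None \<Rightarrow> c | Some y \<Rightarrow> g y) \<in> space N"
    using state_space[OF t(1), of w] w c measurable_space[OF g] by (auto split: option.splits)
next
  fix A assume A: "A \<in> sets N"
  have B: "{w \<in> space W. \<xi> t w \<in> Some ` B} \<in> sets (filt s)" if "B \<in> sets (borel_of T)" for B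
    unfolding filt_def using that t by (intro process_sigma_sets) auto
  have 1: "{w \<in> space W. \<xi> t w \<in> Some ` (g -` A \<inter> topspace T)} \<in> sets (filt s)"
    using measurable_sets[OF g A] by (intro B) simp
  have 2: "space W - {w \<in> space W. \<xi> t w \<in> Some ` topspace T} \<in> sets (filt s)"
    using sets.compl_sets[OF B[OF sets.top]] by simp
  have eq: "(\<lambda>w. case \<xi> t w of None \<Rightarrow> c | Some y \<Rightarrow> g y) -` A \<inter> space (filt s) =
    {w \<in> space W. \<xi> t w \<in> Some ` (g -` A \<inter> topspace T)} \<union>
    (if c \<in> A then space W - {w \<in> space W. \<xi> t w \<in> Some ` topspace T} else {})"
    using position_in_space[OF t(1)] by (auto split: option.splits)
  show "(\<lambda>w. case \<xi> t w of None \<Rightarrow> c | Some y \<Rightarrow> g y) -` A \<inter> space (filt s) \<in> sets (filt s)"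
    unfolding eq using 1 2 by auto
qed

lemma position_measurable:
  assumes "g \<in> measurable (borel_of T) N" "c \<in> space N" "0 \<le> t"
  shows "(\<lambda>w. case \<xi> t w of None \<Rightarrow> c | Some y \<Rightarrow> g y) \<in> measurable W N"
  using position_measurable_filt[OF assms order_refl] by (rule measurable_from_filt)

text \<open>The Markov property for non-negative functions, from its version for events by a monotone class
  argument, first in the future function \<open>g\<close> and then in the past functional \<open>Z\<close>.\<close>

lemma markov:
  fixes Z :: "'w \<Rightarrow> ennreal" and g :: "'s \<Rightarrow> ennreal"
  assumes x: "x \<in> topspace T" and s: "0 \<le> s" and t: "0 \<le> t"
    and Z: "Z \<in> borel_measurable (filt s)" and g: "g \<in> borel_measurable (borel_of T)"
  shows "(\<integral>\<^sup>+ w. Z w * (case \<xi> (s + t) w of None \<Rightarrow> 0 | Some y \<Rightarrow> g y) \<partial>Pr x) =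
    (\<integral>\<^sup>+ w. Z w * (case \<xi> s w of None \<Rightarrow> 0 | Some y \<Rightarrow> (\<integral>\<^sup>+ z. g z \<partial>P t y)) \<partial>Pr x)"
proof -
  note [measurable_cong] = law_sets[OF x]
  have st: "0 \<le> s + t" using s t by simp
  have [measurable]: "(\<lambda>w. case \<xi> (s + t) w of None \<Rightarrow> 0 | Some y \<Rightarrow> f y) \<in> borel_measurable W"
    if "f \<in> borel_measurable (borel_of T)" for f :: "'s \<Rightarrow> ennreal"
    by (rule position_measurable[OF that _ st]) simp
  have integ: "(\<lambda>y. \<integral>\<^sup>+ z. f z \<partial>P t y) \<in> borel_measurable (borel_of T)"
    if [measurable]: "f \<in> borel_measurable (borel_of T)" for f :: "'s \<Rightarrow> ennreal"
    by (rule nn_integral_measurable_subprob_algebra2[OF _ kernel[OF t]]) simp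
  have [measurable]: "(\<lambda>w. case \<xi> s w of None \<Rightarrow> 0 | Some y \<Rightarrow> (\<integral>\<^sup>+ z. f z \<partial>P t y)) \<in> borel_measurable W"
    if "f \<in> borel_measurable (borel_of T)" for f :: "'s \<Rightarrow> ennreal"
    by (rule position_measurable[OF integ[OF that] _ s]) simp
  have ind: "(\<integral>\<^sup>+ w. indicator A w * (case \<xi> (s + t) w of None \<Rightarrow> 0 | Some y \<Rightarrow> g y) \<partial>Pr x) =
    (\<integral>\<^sup>+ w. indicator A w * (case \<xi> s w of None \<Rightarrow> 0 | Some y \<Rightarrow> (\<integral>\<^sup>+ z. g z \<partial>P t y)) \<partial>Pr x)"
    if A: "A \<in> sets (filt s)" for A
  proof -
    have [measurable]: "A \<in> sets W" using A filt_subset by auto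
    from g show ?thesis
    proof (induction rule: borel_measurable_induct)
      case (cong f g)
      have "(case \<xi> (s + t) w of None \<Rightarrow> 0 | Some y \<Rightarrow> f y) = (case \<xi> (s + t) w of None \<Rightarrow> 0 | Some y \<Rightarrow> g y)"
        if "w \<in> space W" for w
        using state_space[OF st that] cong by (auto split: option.splits)
      moreover have "(case \<xi> s w of None \<Rightarrow> 0 | Some y \<Rightarrow> (\<integral>\<^sup>+ z. f z \<partial>P t y)) =
         (case \<xi> s w of None \<Rightarrow> 0 | Some y \<Rightarrow> (\<integral>\<^sup>+ z. g z \<partial>P t y))" if "w \<in> space W" for w
        using state_space[OF s that] cong sets_eq_imp_space_eq[OF sets_kernel[OF t]]
        by (auto split: option.splits intro!: nn_integral_cong)
      ultimately show ?case using cong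
        by (simp add: law_space[OF x] cong: nn_integral_cong_simp)
    next
      case (set B)
      have "(\<integral>\<^sup>+ w. indicator A w * (case \<xi> (s + t) w of None \<Rightarrow> 0 | Some y \<Rightarrow> indicator B y) \<partial>Pr x) =
        (\<integral>\<^sup>+ w. indicator {w \<in> A. \<xi> (s + t) w \<in> Some ` B} w \<partial>Pr x)"
        by (intro nn_integral_cong) (auto split: option.splits simp: indicator_def)
      also have "\<dots> = emeasure (Pr x) {w \<in> A. \<xi> (s + t) w \<in> Some ` B}"
      proof (rule nn_integral_indicator)
        have "{w \<in> A. \<xi> (s + t) w \<in> Some ` B} = A \<inter> {w \<in> space W. \<xi> (s + t) w \<in> Some ` B}"
          using sets.sets_into_space[OF A] by auto
        then show "{w \<in> A. \<xi> (s + t) w \<in> Some ` B} \<in> sets (Pr x)"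
          using events[OF st set] by (simp add: law_sets[OF x])
      qed
      also have "\<dots> = (\<integral>\<^sup>+ w. (case \<xi> s w of None \<Rightarrow> 0 | Some y \<Rightarrow> emeasure (P t y) B) * indicator A w \<partial>Pr x)"
        by (rule markov_sets[OF x s t A set])
      also have "\<dots> = (\<integral>\<^sup>+ w. indicator A w *
          (case \<xi> s w of None \<Rightarrow> 0 | Some y \<Rightarrow> (\<integral>\<^sup>+ z. indicator B z \<partial>P t y)) \<partial>Pr x)"
      proof (rule nn_integral_cong)
        fix w assume "w \<in> space (Pr x)"
        then have "w \<in> space W" by (simp add: law_space[OF x])
        from state_space[OF s this] show "(case \<xi> s w of None \<Rightarrow> 0 | Some y \<Rightarrow> emeasure (P t y) B) * indicator A w =
          indicator A w * (case \<xi> s w of None \<Rightarrow> 0 | Some y \<Rightarrow> (\<integral>\<^sup>+ z. indicator B z \<partial>P t y))"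
          using set sets_kernel[OF t] by (auto split: option.splits simp: mult.commute)
      qed
      finally show ?case .
    next
      case (mult u c)
      have m: "(\<integral>\<^sup>+ z. c * u z \<partial>P t y) = c * (\<integral>\<^sup>+ z. u z \<partial>P t y)" if "y \<in> topspace T" for y
        using mult by (intro nn_integral_cmult) (simp add: measurable_kernel_iff[OF t that])
      have "(\<integral>\<^sup>+ w. indicator A w * (case \<xi> (s + t) w of None \<Rightarrow> 0 | Some y \<Rightarrow> c * u y) \<partial>Pr x) =
         (\<integral>\<^sup>+ w. c * (indicator A w * (case \<xi> (s + t) w of None \<Rightarrow> 0 | Some y \<Rightarrow> u y)) \<partial>Pr x)"
        by (intro nn_integral_cong) (auto split: option.splits simp: ac_simps)
      also have "\<dots> = c * (\<integral>\<^sup>+ w. indicator A w * (case \<xi> (s + t) w of None \<Rightarrow> 0 | Some y \<Rightarrow> u y) \<partial>Pr x)"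
        using mult by (intro nn_integral_cmult) (simp_all add: measurable_law_iff[OF x], measurable?)
      also have "\<dots> = c * (\<integral>\<^sup>+ w. indicator A w * (case \<xi> s w of None \<Rightarrow> 0 | Some y \<Rightarrow> (\<integral>\<^sup>+ z. u z \<partial>P t y)) \<partial>Pr x)"
        by (simp add: mult)
      also have "\<dots> = (\<integral>\<^sup>+ w. c * (indicator A w * (case \<xi> s w of None \<Rightarrow> 0 | Some y \<Rightarrow> (\<integral>\<^sup>+ z. u z \<partial>P t y))) \<partial>Pr x)"
        using mult by (intro nn_integral_cmult[symmetric]) (simp_all add: measurable_law_iff[OF x], measurable?)
      also have "\<dots> = (\<integral>\<^sup>+ w. indicator A w * (case \<xi> s w of None \<Rightarrow> 0 | Some y \<Rightarrow> (\<integral>\<^sup>+ z. c * u z \<partial>P t y)) \<partial>Pr x)"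
        using state_space[OF s] by (intro nn_integral_cong) (force split: option.splits simp: ac_simps m law_space[OF x])
      finally show ?case .
    next
      case (add u v)
      have m: "(\<integral>\<^sup>+ z. v z + u z \<partial>P t y) = (\<integral>\<^sup>+ z. v z \<partial>P t y) + (\<integral>\<^sup>+ z. u z \<partial>P t y)" if "y \<in> topspace T" for y
        using add by (intro nn_integral_add) (simp_all add: measurable_kernel_iff[OF t that])
      have "(\<integral>\<^sup>+ w. indicator A w * (case \<xi> (s + t) w of None \<Rightarrow> 0 | Some y \<Rightarrow> v y + u y) \<partial>Pr x) =
         (\<integral>\<^sup>+ w. indicator A w * (case \<xi> (s + t) w of None \<Rightarrow> 0 | Some y \<Rightarrow> v y) +
            indicator A w * (case \<xi> (s + t) w of None \<Rightarrow> 0 | Some y \<Rightarrow> u y) \<partial>Pr x)"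
        by (intro nn_integral_cong) (auto split: option.splits simp: distrib_left)
      also have "\<dots> = (\<integral>\<^sup>+ w. indicator A w * (case \<xi> (s + t) w of None \<Rightarrow> 0 | Some y \<Rightarrow> v y) \<partial>Pr x) +
            (\<integral>\<^sup>+ w. indicator A w * (case \<xi> (s + t) w of None \<Rightarrow> 0 | Some y \<Rightarrow> u y) \<partial>Pr x)"
        using add by (intro nn_integral_add) (simp_all add: measurable_law_iff[OF x], measurable?)
      also have "\<dots> = (\<integral>\<^sup>+ w. indicator A w * (case \<xi> s w of None \<Rightarrow> 0 | Some y \<Rightarrow> (\<integral>\<^sup>+ z. v z \<partial>P t y)) +
          indicator A w * (case \<xi> s w of None \<Rightarrow> 0 | Some y \<Rightarrow> (\<integral>\<^sup>+ z. u z \<partial>P t y)) \<partial>Pr x)"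
        unfolding add.IH using add.hyps by (intro nn_integral_add[symmetric]) (simp_all add: measurable_law_iff[OF x], measurable?)
      also have "\<dots> = (\<integral>\<^sup>+ w. indicator A w * (case \<xi> s w of None \<Rightarrow> 0 | Some y \<Rightarrow> (\<integral>\<^sup>+ z. v z + u z \<partial>P t y)) \<partial>Pr x)"
        using state_space[OF s] by (intro nn_integral_cong) (force split: option.splits simp: distrib_left m law_space[OF x])
      finally show ?case .
    next
      case (seq U)
      have inc: "incseq (\<lambda>i. U i y)" for y using seq(3) by (auto simp: incseq_def le_fun_def)
      have m: "(\<integral>\<^sup>+ z. (SUP i. U i z) \<partial>P t y) = (SUP i. \<integral>\<^sup>+ z. U i z \<partial>P t y)" if "y \<in> topspace T" for y
        using seq by (intro nn_integral_monotone_convergence_SUP) (simp_all add: measurable_kernel_iff[OF t that])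
      have "(\<integral>\<^sup>+ w. indicator A w * (case \<xi> (s + t) w of None \<Rightarrow> 0 | Some y \<Rightarrow> (SUP i. U i y)) \<partial>Pr x) =
         (\<integral>\<^sup>+ w. (SUP i. indicator A w * (case \<xi> (s + t) w of None \<Rightarrow> 0 | Some y \<Rightarrow> U i y)) \<partial>Pr x)"
        by (intro nn_integral_cong) (auto split: option.splits simp: SUP_mult_left_ennreal)
      also have "\<dots> = (SUP i. \<integral>\<^sup>+ w. indicator A w * (case \<xi> (s + t) w of None \<Rightarrow> 0 | Some y \<Rightarrow> U i y) \<partial>Pr x)"
        using seq(1) inc
        by (intro nn_integral_monotone_convergence_SUP)
           (auto simp: incseq_def le_fun_def split: option.splits intro!: mult_left_mono)
      also have "\<dots> = (SUP i. \<integral>\<^sup>+ w. indicator A w * (case \<xi> s w of None \<Rightarrow> 0 | Some y \<Rightarrow> (\<integral>\<^sup>+ z. U i z \<partial>P t y)) \<partial>Pr x)"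
        by (simp add: seq.IH)
      also have "\<dots> = (\<integral>\<^sup>+ w. (SUP i. indicator A w * (case \<xi> s w of None \<Rightarrow> 0 | Some y \<Rightarrow> (\<integral>\<^sup>+ z. U i z \<partial>P t y))) \<partial>Pr x)"
        using seq(1) inc
        by (intro nn_integral_monotone_convergence_SUP[symmetric])
           (auto simp: incseq_def le_fun_def split: option.splits intro!: mult_left_mono nn_integral_mono)
      also have "\<dots> = (\<integral>\<^sup>+ w. indicator A w * (case \<xi> s w of None \<Rightarrow> 0 | Some y \<Rightarrow> (\<integral>\<^sup>+ z. (SUP i. U i z) \<partial>P t y)) \<partial>Pr x)"
        using state_space[OF s]
        by (intro nn_integral_cong) (force split: option.splits simp: SUP_mult_left_ennreal m law_space[OF x])
      finally have "(\<integral>\<^sup>+ w. indicator A w * (case \<xi> (s + t) w of None \<Rightarrow> 0 | Some y \<Rightarrow> (SUP i. U i y)) \<partial>Pr x) =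
        (\<integral>\<^sup>+ w. indicator A w * (case \<xi> s w of None \<Rightarrow> 0 | Some y \<Rightarrow> (\<integral>\<^sup>+ z. (SUP i. U i z) \<partial>P t y)) \<partial>Pr x)" .
      moreover have "(SUP i. U i) = (\<lambda>y. SUP i. U i y)"
        by (simp add: fun_eq_iff image_comp)
      ultimately show ?case by (simp only:)
    qed
  qed
  define f where "f w = (case \<xi> (s + t) w of None \<Rightarrow> 0 | Some y \<Rightarrow> g y)" for w
  define h where "h w = (case \<xi> s w of None \<Rightarrow> 0 | Some y \<Rightarrow> (\<integral>\<^sup>+ z. g z \<partial>P t y))" for w
  have [measurable]: "f \<in> borel_measurable W" "h \<in> borel_measurable W"
    unfolding f_def h_def using g by measurable
  have filt_W: "u \<in> borel_measurable W" if "u \<in> borel_measurable (filt s)" for u :: "'w \<Rightarrow> ennreal"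
    using that by (rule measurable_from_filt)
  from Z have "(\<integral>\<^sup>+ w. Z w * f w \<partial>Pr x) = (\<integral>\<^sup>+ w. Z w * h w \<partial>Pr x)"
  proof (induction rule: borel_measurable_induct)
    case (cong u v)
    have "(\<integral>\<^sup>+ w. u w * k w \<partial>Pr x) = (\<integral>\<^sup>+ w. v w * k w \<partial>Pr x)" for k
      by (rule nn_integral_cong) (simp only: cong(3) law_space[OF x] space_filt)
    then show ?case using cong(4) by (simp only:)
  next
    case (set A)
    then show ?case unfolding f_def h_def by (rule ind)
  next
    case (mult u c)
    have [measurable]: "u \<in> borel_measurable W" using mult(2) by (rule filt_W)
    have "(\<integral>\<^sup>+ w. (c * u w) * k w \<partial>Pr x) = c * (\<integral>\<^sup>+ w. u w * k w \<partial>Pr x)"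
      if [measurable]: "k \<in> borel_measurable W" for k
      unfolding mult.assoc by (rule nn_integral_cmult) measurable
    then show ?case using mult(4) by simp
  next
    case (add u v)
    have [measurable]: "u \<in> borel_measurable W" "v \<in> borel_measurable W" by (rule filt_W, fact)+
    have "(\<integral>\<^sup>+ w. (v w + u w) * k w \<partial>Pr x) = (\<integral>\<^sup>+ w. v w * k w \<partial>Pr x) + (\<integral>\<^sup>+ w. u w * k w \<partial>Pr x)"
      if [measurable]: "k \<in> borel_measurable W" for k
      unfolding distrib_right by (rule nn_integral_add) measurable
    then show ?case using add.IH by simp
  next
    case (seq U)
    have [measurable]: "U i \<in> borel_measurable W" for i using seq(1) by (rule filt_W)
    have inc: "incseq (\<lambda>i. (\<lambda>w. U i w * k w))" for k
      using seq(3) by (auto simp: incseq_def le_fun_def intro!: mult_right_mono)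
    have "(\<integral>\<^sup>+ w. (SUP i. U i w) * k w \<partial>Pr x) = (SUP i. \<integral>\<^sup>+ w. U i w * k w \<partial>Pr x)"
      if [measurable]: "k \<in> borel_measurable W" for k
      by (subst nn_integral_monotone_convergence_SUP[symmetric, OF inc])
         (simp_all add: SUP_mult_right_ennreal image_comp)
    then show ?case by (simp add: seq.IH image_comp)
  qed
  then show ?thesis unfolding f_def h_def .
qed

lemma law_at:
  fixes g :: "'s \<Rightarrow> ennreal"
  assumes x: "x \<in> topspace T" and t: "0 \<le> t" and g: "g \<in> borel_measurable (borel_of T)"
  shows "(\<integral>\<^sup>+ w. (case \<xi> t w of None \<Rightarrow> 0 | Some y \<Rightarrow> g y) \<partial>Pr x) = (\<integral>\<^sup>+ z. g z \<partial>P t x)"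
proof -
  have "(\<integral>\<^sup>+ w. (case \<xi> t w of None \<Rightarrow> 0 | Some y \<Rightarrow> g y) \<partial>Pr x) =
     (\<integral>\<^sup>+ w. (case \<xi> 0 w of None \<Rightarrow> 0 | Some y \<Rightarrow> (\<integral>\<^sup>+ z. g z \<partial>P t y)) \<partial>Pr x)"
    using markov[OF x order_refl t, of "\<lambda>_. 1" g] g by simp
  also have "\<dots> = (\<integral>\<^sup>+ w. (\<integral>\<^sup>+ z. g z \<partial>P t x) \<partial>Pr x)"
    using start[OF x] by (intro nn_integral_cong_AE) auto
  also have "\<dots> = (\<integral>\<^sup>+ z. g z \<partial>P t x)"
    using prob_space.emeasure_space_1[OF law_prob[OF x]] by simp
  finally show ?thesis .
qed

end

section \<open>Integration tools\<close>

text \<open>A right-continuous family is the limit of its values at the grid points strictly to the right of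
  the current time, hence jointly measurable. Times are truncated to \<open>[0,t]\<close>: with \<open>F\<close> the
  \<open>\<sigma>\<close>-algebra of the past of \<open>t\<close> this is progressive measurability.\<close>

lemma right_continuous_joint_measurable:
  fixes Y :: "real \<Rightarrow> 'w \<Rightarrow> 'b::metric_space"
  assumes t: "0 \<le> t"
    and meas: "\<And>s. 0 \<le> s \<Longrightarrow> s \<le> t \<Longrightarrow> Y s \<in> borel_measurable F"
    and rc: "\<And>s w. w \<in> space F \<Longrightarrow> 0 \<le> s \<Longrightarrow> s < t \<Longrightarrow> ((\<lambda>r. Y r w) \<longlongrightarrow> Y s w) (at_right s)"
  shows "(\<lambda>(s, w). Y (min t (max 0 s)) w) \<in> borel_measurable ((borel :: real measure) \<Otimes>\<^sub>M F)"
proof -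
  define c where "c n i = min t (max 0 ((of_int i + 1) / real (Suc n)))" for n and i :: int
  define j where "j n s = \<lfloor>real (Suc n) * max 0 s\<rfloor>" for n and s :: real
  have c: "0 \<le> c n i" "c n i \<le> t" for n i using t by (auto simp: c_def)
  show ?thesis
  proof (rule borel_measurable_LIMSEQ_metric)
    fix n
    have [measurable]: "Y (c n i) \<in> borel_measurable F" for i
      by (rule meas) (use c in auto)
    show "(\<lambda>x. Y (c n (j n (fst x))) (snd x)) \<in> borel_measurable ((borel :: real measure) \<Otimes>\<^sub>M F)"
      unfolding j_def
      by (rule measurable_compose_countable[where f="\<lambda>i x. Y (c n i) (snd x)"]) measurable
  next
    fix x assume "x \<in> space ((borel :: real measure) \<Otimes>\<^sub>M F)"
    then obtain s w where x: "x = (s, w)" and w: "w \<in> space F" by (auto simp: space_pair_measure)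
    define s' where "s' = max 0 s"
    have s': "0 \<le> s'" by (simp add: s'_def)
    have jn: "s' < (of_int (j n s) + 1) / real (Suc n)" for n
    proof -
      have "real (Suc n) * s' < of_int (j n s) + 1" unfolding j_def s'_def by linarith
      then show ?thesis by (simp add: pos_less_divide_eq mult.commute)
    qed
    have jn2: "(of_int (j n s) + 1) / real (Suc n) \<le> s' + 1 / real (Suc n)" for n
    proof -
      have "of_int (j n s) \<le> real (Suc n) * s'" unfolding j_def s'_def by linarith
      then have "(of_int (j n s) + 1) / real (Suc n) \<le> (real (Suc n) * s' + 1) / real (Suc n)"
        by (intro divide_right_mono) auto
      also have "\<dots> = s' + 1 / real (Suc n)" by (simp add: add_divide_distrib del: of_nat_Suc)
      finally show ?thesis .
    qed
    have "(\<lambda>n. Y (c n (j n s)) w) \<longlonglongrightarrow> Y (min t s') w"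
    proof (cases "t \<le> s'")
      case True
      have "c n (j n s) = t" for n using jn[of n] True t unfolding c_def by auto
      then show ?thesis using True by simp
    next
      case False
      have low: "s' < c n (j n s)" for n using jn[of n] False s' by (auto simp: c_def)
      have up: "c n (j n s) \<le> s' + 1 / real (Suc n)" for n
        unfolding c_def by (rule min.coboundedI2, rule max.boundedI, use s' in simp, rule jn2)
      have "(\<lambda>n. s' + 1 / real (Suc n)) \<longlonglongrightarrow> s' + 0"
        by (intro tendsto_intros LIMSEQ_Suc[OF lim_1_over_n])
      then have upper: "(\<lambda>n. s' + 1 / real (Suc n)) \<longlonglongrightarrow> s'" by simp
      have "(\<lambda>n. c n (j n s)) \<longlonglongrightarrow> s'"
      proof (rule tendsto_sandwich[OF _ _ tendsto_const upper])
        show "\<forall>\<^sub>F n in sequentially. s' \<le> c n (j n s)"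
          by (intro always_eventually allI less_imp_le low)
        show "\<forall>\<^sub>F n in sequentially. c n (j n s) \<le> s' + 1 / real (Suc n)"
          by (intro always_eventually allI up)
      qed
      then have "filterlim (\<lambda>n. c n (j n s)) (at_right s') sequentially"
        using low by (auto simp: filterlim_at intro!: always_eventually)
      from filterlim_compose[OF rc[OF w s'] this] False show ?thesis by simp
    qed
    then show "(\<lambda>n. Y (c n (j n (fst x))) (snd x)) \<longlonglongrightarrow> (case x of (s, w) \<Rightarrow> Y (min t (max 0 s)) w)"
      by (simp add: x s'_def)
  qed
qed

lemma Fubini_interval:
  fixes g :: "real \<Rightarrow> 'a \<Rightarrow> real"
  assumes N: "finite_measure N" and g: "(\<lambda>(q, w). g q w) \<in> borel_measurable (borel \<Otimes>\<^sub>M N)"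
    and bound: "\<And>q w. \<bar>g q w\<bar> \<le> C"
  shows "(LINT w|N. (LINT q:{a..b}|lborel. g q w)) = (LINT q:{a..b}|lborel. (LINT w|N. g q w))"
proof -
  interpret N: finite_measure N by fact
  interpret pair_sigma_finite lborel N
    by unfold_locales
  have g'[measurable]: "(\<lambda>(q, w). g q w) \<in> borel_measurable (lborel \<Otimes>\<^sub>M N)"
    using g by (simp cong: measurable_cong_sets sets_pair_measure_cong)
  have "integrable (lborel \<Otimes>\<^sub>M N) (\<lambda>z. indicator ({a..b} \<times> space N) z *\<^sub>R (case z of (q, w) \<Rightarrow> g q w))"
  proof (rule integrableI_bounded_set_indicator[where B=C])
    have "emeasure (lborel \<Otimes>\<^sub>M N) ({a..b} \<times> space N) = emeasure lborel {a..b} * emeasure N (space N)"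
      by (rule N.emeasure_pair_measure_Times) auto
    also have "\<dots> < \<infinity>"
      by (cases "a \<le> b") (auto simp: N.emeasure_eq_measure ennreal_mult_less_top)
    finally show "emeasure (lborel \<Otimes>\<^sub>M N) ({a..b} \<times> space N) < \<infinity>" .
  qed (use bound in auto)
  then have "integrable (lborel \<Otimes>\<^sub>M N) (\<lambda>(q, w). indicator {a..b} q * g q w)"
    by (rule Bochner_Integration.integrable_cong[THEN iffD1, rotated -1])
       (auto simp: indicator_def space_pair_measure)
  from Fubini_integral[OF this] show ?thesis
    by (simp add: set_lebesgue_integral_def)
qed

lemma Fubini_intervals:
  fixes h :: "real \<Rightarrow> real \<Rightarrow> real"
  assumes h[measurable]: "(\<lambda>(s, q). h s q) \<in> borel_measurable (borel \<Otimes>\<^sub>M borel)"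
    and bound: "\<And>s q. \<bar>h s q\<bar> \<le> C"
  shows "(LINT q:{c..d}|lborel. (LINT s:{a..b}|lborel. h s q)) = (LINT s:{a..b}|lborel. (LINT q:{c..d}|lborel. h s q))"
proof -
  define N where "N = density lborel (indicator {c..d})"
  have "emeasure N (space N) = emeasure lborel {c..d}"
    unfolding N_def by (subst emeasure_density) auto
  then have fin: "finite_measure N"
    by (intro finite_measureI) (cases "c \<le> d"; simp)
  have N: "(LINT q|N. f q) = (LINT q:{c..d}|lborel. f q)" if "f \<in> borel_measurable borel" for f :: "real \<Rightarrow> real"
    unfolding N_def set_lebesgue_integral_def using that
    by (subst integral_density[symmetric]) (auto simp: ennreal_indicator)
  have [measurable_cong]: "sets N = sets borel" by (simp add: N_def)
  have "(\<lambda>q. LINT s:{a..b}|lborel. h s q) \<in> borel_measurable borel"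
    unfolding set_lebesgue_integral_def by measurable
  moreover have "(\<lambda>q. h s q) \<in> borel_measurable borel" for s by measurable
  ultimately show ?thesis
    using Fubini_interval[OF fin, of h C a b] bound by (simp add: N)
qed

lemma integral_upto_measurable:
  fixes g :: "real \<Rightarrow> 'a \<Rightarrow> real"
  assumes g: "(\<lambda>(r, w). g r w) \<in> borel_measurable (borel \<Otimes>\<^sub>M N)"
  shows "(\<lambda>(s, w). LINT r:{0..s}|lborel. g r w) \<in> borel_measurable (borel \<Otimes>\<^sub>M N)"
proof -
  note measurable_compose[OF _ g, measurable]
  have "(\<lambda>z. LINT r|lborel. (if 0 \<le> r \<and> r \<le> fst z then case (r, snd z) of (r, w) \<Rightarrow> g r w else 0))
      \<in> borel_measurable ((borel :: real measure) \<Otimes>\<^sub>M N)"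
    by (rule lborel.borel_measurable_lebesgue_integral) measurable
  moreover have "(\<lambda>z. LINT r|lborel. (if 0 \<le> r \<and> r \<le> fst z then case (r, snd z) of (r, w) \<Rightarrow> g r w else 0)) =
     (\<lambda>(s, w). LINT r:{0..s}|lborel. g r w)"
    by (auto simp: fun_eq_iff set_lebesgue_integral_def indicator_def intro!: Bochner_Integration.integral_cong)
  ultimately show ?thesis by simp
qed

lemma integrable_interval_bounded:
  fixes b :: "real \<Rightarrow> real"
  assumes "b \<in> borel_measurable borel" "\<And>s. \<bar>b s\<bar> \<le> C"
  shows "set_integrable lborel {p..q} b"
  unfolding set_integrable_def
  by (rule integrableI_bounded_set_indicator[where B=C]) (use assms in \<open>auto simp: emeasure_lborel_Icc_eq\<close>)

lemma set_integral_split: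
  fixes b :: "real \<Rightarrow> real"
  assumes "\<And>p q. set_integrable lborel {p..q} b" "p \<le> q" "q \<le> r"
  shows "(LINT s:{p..r}|lborel. b s) = (LINT s:{p..q}|lborel. b s) + (LINT s:{q..r}|lborel. b s)"
proof -
  have "{p..r} = {p..q} \<union> {q..r}" using assms(2,3) by auto
  moreover have "AE x in lborel. \<not> (x \<in> {p..q} \<and> x \<in> {q..r})"
    using AE_lborel_singleton[of q] by eventually_elim auto
  ultimately show ?thesis
    using set_integral_Un_AE[of "{p..q}" "{q..r}" lborel b] assms(1) by simp
qed

lemma abs_set_integral_le:
  fixes b :: "real \<Rightarrow> real"
  assumes "b \<in> borel_measurable borel" "\<And>s. s \<in> {p..q} \<Longrightarrow> \<bar>b s\<bar> \<le> C" "p \<le> q"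
  shows "\<bar>LINT s:{p..q}|lborel. b s\<bar> \<le> C * (q - p)"
proof -
  have "norm (LINT s:{p..q}|lborel. b s) \<le> (LINT s|lborel. norm (indicator {p..q} s *\<^sub>R b s))"
    unfolding set_lebesgue_integral_def by (rule integral_norm_bound)
  also have "\<dots> \<le> (LINT s|lborel. C * indicator {p..q} s)"
  proof (rule integral_mono')
    show "integrable lborel (\<lambda>s. C * indicator {p..q} s)"
      using assms(3) by (intro integrable_mult_right integrable_real_indicator) auto
    show "norm (indicator {p..q} s *\<^sub>R b s) \<le> C * indicator {p..q} s" for s
      using assms(2)[of s] by (auto simp: indicator_def)
  qed (use order_trans[OF abs_ge_zero assms(2)] in \<open>auto simp: indicator_def\<close>)
  also have "\<dots> = C * (q - p)" using assms(3) by simp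
  finally show ?thesis by simp
qed

text \<open>The chain rule for \<open>exp(\<integral>\<^sub>0\<^sup>q b)\<close> with \<open>b\<close> merely bounded and measurable. The difference of
  both sides has increments of second order, hence derivative zero.\<close>

lemma exp_integral_identity:
  fixes b :: "real \<Rightarrow> real"
  assumes b[measurable]: "b \<in> borel_measurable borel" and bound: "\<And>s. \<bar>b s\<bar> \<le> C" and t: "0 \<le> t"
  defines "B \<equiv> \<lambda>s. LINT r:{0..s}|lborel. b r"
  shows "(LINT s:{0..t}|lborel. exp (B s) * b s) = exp (B t) - 1"
proof -
  have C: "0 \<le> C" using bound[of 0] by linarith
  have int: "set_integrable lborel {p..q} b" for p q
    by (rule integrable_interval_bounded[OF b bound])
  have B_diff: "B q = B p + (LINT r:{p..q}|lborel. b r)" if "0 \<le> p" "p \<le> q" for p q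
    unfolding B_def by (rule set_integral_split) (use int that in auto)
  have lip: "\<bar>B q - B p\<bar> \<le> C * (q - p)" if "0 \<le> p" "p \<le> q" for p q
    using abs_set_integral_le[OF b, of p q C] bound that B_diff[OF that] by simp
  have B_bound: "B s \<le> C * t" if "s \<le> t" for s
  proof (cases "0 \<le> s")
    case True
    have "B s \<le> C * s" using abs_set_integral_le[OF b bound, where p=0 and q=s] True by (simp add: B_def)
    also have "\<dots> \<le> C * t" using that C by (intro mult_left_mono) auto
    finally show ?thesis .
  next
    case False
    then show ?thesis using C t by (simp add: B_def set_lebesgue_integral_def)
  qed
  have [measurable]: "B \<in> borel_measurable borel"
    using measurable_compose[OF _ integral_upto_measurable[of "\<lambda>r _. b r" borel],
        of "\<lambda>s. (s, s)" borel]
    by (simp add: B_def)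
  define D where "D = exp (C * t)"
  have D: "0 < D" by (simp add: D_def)
  have expD: "exp (B s) \<le> D" if "s \<le> t" for s
    using B_bound[OF that] by (simp add: D_def)
  have exp_lip: "\<bar>exp (B q) - exp (B p)\<bar> \<le> D * (C * (q - p))" if "0 \<le> p" "p \<le> q" "q \<le> t" for p q
  proof -
    have "exp y - exp x \<le> exp y * (y - x)" for x y :: real
    proof -
      have "exp y * (1 + (x - y)) \<le> exp y * exp (x - y)"
        using exp_ge_add_one_self[of "x - y"] by (intro mult_left_mono) auto
      then show ?thesis by (simp add: exp_diff algebra_simps)
    qed
    then have le: "exp y - exp x \<le> D * \<bar>y - x\<bar>" if "exp y \<le> D" for x y :: real
    proof -
      have "exp y - exp x \<le> exp y * (y - x)" by fact
      also have "\<dots> \<le> exp y * \<bar>y - x\<bar>" by (intro mult_left_mono) auto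
      also have "\<dots> \<le> D * \<bar>y - x\<bar>" using that by (intro mult_right_mono) auto
      finally show ?thesis .
    qed
    have "p \<le> t" using that by simp
    from le[OF expD[OF this], of "B q"] le[OF expD[OF that(3)], of "B p"]
    have "\<bar>exp (B q) - exp (B p)\<bar> \<le> D * \<bar>B q - B p\<bar>"
      by (simp add: abs_le_iff abs_minus_commute)
    also have "\<dots> \<le> D * (C * (q - p))"
      using lip that D by (intro mult_left_mono) auto
    finally show ?thesis .
  qed
  \<comment> \<open>Truncating at \<open>t\<close> bounds the integrand on the whole line.\<close>
  define F where "F q = exp (B q) - 1 - (LINT s:{0..q}|lborel. exp (B (min t s)) * b s)" for q
  have bound2: "\<bar>exp (B (min t s)) * b s\<bar> \<le> D * C" for s
    using expD[of "min t s"] bound[of s] by (auto simp: abs_mult intro!: mult_mono D[THEN less_imp_le])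
  have int2: "set_integrable lborel {p..q} (\<lambda>s. exp (B (min t s)) * b s)" for p q
    by (rule integrable_interval_bounded[OF _ bound2]) measurable
  have F_diff: "\<bar>F q - F p\<bar> \<le> (D * C * C + D * C * C) * (q - p)\<^sup>2" if pq: "0 \<le> p" "p \<le> q" "q \<le> t" for p q
  proof -
    have "(LINT s:{0..q}|lborel. exp (B (min t s)) * b s) =
        (LINT s:{0..p}|lborel. exp (B (min t s)) * b s) + (LINT s:{p..q}|lborel. exp (B (min t s)) * b s)"
      by (rule set_integral_split) (use int2 pq in auto)
    then have "F q - F p = exp (B q) - exp (B p) - (LINT s:{p..q}|lborel. exp (B (min t s)) * b s)"
      by (simp add: F_def)
    also have "(LINT s:{p..q}|lborel. exp (B (min t s)) * b s) =
        (LINT s:{p..q}|lborel. exp (B p) * b s + (exp (B (min t s)) - exp (B p)) * b s)"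
      by (simp add: algebra_simps)
    also have "\<dots> = exp (B p) * (B q - B p) + (LINT s:{p..q}|lborel. (exp (B (min t s)) - exp (B p)) * b s)"
    proof (subst set_integral_add)
      show "set_integrable lborel {p..q} (\<lambda>s. exp (B p) * b s)"
        using int by (intro set_integrable_mult_right) simp
      show "set_integrable lborel {p..q} (\<lambda>s. (exp (B (min t s)) - exp (B p)) * b s)"
      proof -
        have "set_integrable lborel {p..q} (\<lambda>s. exp (B (min t s)) * b s - exp (B p) * b s)"
          using int int2 by (intro set_integral_diff set_integrable_mult_right) simp_all
        then show ?thesis by (simp add: algebra_simps)
      qed
    qed (use B_diff[OF pq(1,2)] in simp)
    finally have eq: "F q - F p = (exp (B q) - exp (B p) - exp (B p) * (B q - B p)) -
       (LINT s:{p..q}|lborel. (exp (B (min t s)) - exp (B p)) * b s)" by simp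
    have "\<bar>LINT s:{p..q}|lborel. (exp (B (min t s)) - exp (B p)) * b s\<bar> \<le> (D * (C * (q - p)) * C) * (q - p)"
    proof (rule abs_set_integral_le)
      show "\<bar>(exp (B (min t s)) - exp (B p)) * b s\<bar> \<le> D * (C * (q - p)) * C" if s: "s \<in> {p..q}" for s
      proof -
        have "\<bar>exp (B s) - exp (B p)\<bar> \<le> D * (C * (s - p))" using s pq by (intro exp_lip) auto
        also have "\<dots> \<le> D * (C * (q - p))" using s C D by (intro mult_left_mono) auto
        finally have "\<bar>exp (B s) - exp (B p)\<bar> * \<bar>b s\<bar> \<le> D * (C * (q - p)) * C"
          using bound[of s] C D pq by (intro mult_mono) auto
        moreover have "min t s = s" using s pq by auto
        ultimately show ?thesis by (simp add: abs_mult)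
      qed
    qed (use pq in auto)
    moreover have "\<bar>exp (B q) - exp (B p) - exp (B p) * (B q - B p)\<bar> \<le> D * C * C * (q - p)\<^sup>2"
    proof -
      have 1: "exp x - 1 - x \<ge> 0" for x :: real using exp_ge_add_one_self[of x] by linarith
      have "exp (B q) - exp (B p) - exp (B p) * (B q - B p) = exp (B p) * (exp (B q - B p) - 1 - (B q - B p))"
        by (simp add: exp_diff field_simps)
      then have nn: "0 \<le> exp (B q) - exp (B p) - exp (B p) * (B q - B p)" using 1 by simp
      have "exp (B q) - exp (B p) \<le> exp (B q) * (B q - B p)"
        using mult_left_mono[OF exp_ge_add_one_self[of "B p - B q"], of "exp (B q)"]
        by (simp add: exp_diff algebra_simps)
      then have "exp (B q) - exp (B p) - exp (B p) * (B q - B p) \<le> (exp (B q) - exp (B p)) * (B q - B p)"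
        by (simp add: algebra_simps)
      also have "\<dots> \<le> \<bar>exp (B q) - exp (B p)\<bar> * \<bar>B q - B p\<bar>" by (metis abs_ge_self abs_mult)
      also have "\<dots> \<le> (D * (C * (q - p))) * (C * (q - p))"
        using exp_lip[OF pq] lip[OF pq(1,2)] C D pq by (intro mult_mono) auto
      finally show ?thesis using nn by (simp add: power2_eq_square algebra_simps)
    qed
    ultimately show ?thesis unfolding eq by (simp add: power2_eq_square algebra_simps)
  qed
  define L where "L = D * C * C + D * C * C"
  have deriv: "(F has_field_derivative 0) (at p within {0..t})" if p: "p \<in> {0..t}" for p
  proof -
    have "((\<lambda>q. (F q - F p) / (q - p)) \<longlongrightarrow> 0) (at p within {0..t})"
    proof (rule Lim_null_comparison)
      show "\<forall>\<^sub>F q in at p within {0..t}. norm ((F q - F p) / (q - p)) \<le> L * \<bar>q - p\<bar>"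
      proof (unfold eventually_at_filter, intro always_eventually allI impI)
        fix q assume q: "q \<noteq> p" "q \<in> {0..t}"
        have "\<bar>F q - F p\<bar> \<le> L * (q - p)\<^sup>2"
        proof (cases "p \<le> q")
          case True then show ?thesis using F_diff[of p q] p q by (simp add: L_def)
        next
          case False then show ?thesis using F_diff[of q p] p q
            by (simp add: L_def power2_commute abs_minus_commute)
        qed
        then have "\<bar>F q - F p\<bar> \<le> (L * \<bar>q - p\<bar>) * \<bar>q - p\<bar>"
          by (simp add: power2_eq_square ac_simps flip: abs_mult)
        then show "norm ((F q - F p) / (q - p)) \<le> L * \<bar>q - p\<bar>"
          using q by (simp add: abs_divide divide_le_eq)
      qed
      have "((\<lambda>q. L * \<bar>q - p\<bar>) \<longlongrightarrow> L * \<bar>p - p\<bar>) (at p within {0..t})"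
        by (intro tendsto_intros)
      then show "((\<lambda>q. L * \<bar>q - p\<bar>) \<longlongrightarrow> 0) (at p within {0..t})" by simp
    qed
    then show ?thesis by (simp add: has_field_derivative_iff)
  qed
  have "F t = F 0"
    using has_field_derivative_zero_constant[of "{0..t}" F, OF _ deriv] t by fastforce
  moreover have "F 0 = 0"
  proof -
    have "(\<lambda>s. exp (B (min t s)) * b s) \<in> borel_measurable borel" by measurable
    from abs_set_integral_le[OF this bound2[rule_format], where p=0 and q=0]
    show ?thesis
      using abs_set_integral_le[OF b bound, where p=0 and q=0] by (simp add: F_def B_def)
  qed
  ultimately have "exp (B t) - 1 = (LINT s:{0..t}|lborel. exp (B (min t s)) * b s)"
    by (simp add: F_def)
  also have "\<dots> = (LINT s:{0..t}|lborel. exp (B s) * b s)"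
    by (intro set_lebesgue_integral_cong) auto
  finally show ?thesis by simp
qed

section \<open>The spatial motion and the perturbation formula\<close>

lemma borel_measurable_bounded_integrable:
  fixes f :: "'a \<Rightarrow> real"
  assumes "finite_measure M" "f \<in> borel_measurable M" "\<And>x. \<bar>f x\<bar> \<le> C"
  shows "integrable M f"
  using finite_measure.integrable_const_bound[OF assms(1), of f C] assms by simp

lemma abs_mult_le: "\<bar>a\<bar> \<le> A \<Longrightarrow> \<bar>b\<bar> \<le> B \<Longrightarrow> \<bar>a * b\<bar> \<le> A * B" for a b A B :: real
  unfolding abs_mult by (intro mult_mono) auto

lemma integral_kernel_measurable:
  fixes f :: "'a \<Rightarrow> 'b \<Rightarrow> real"
  assumes f[measurable]: "(\<lambda>(x, y). f x y) \<in> borel_measurable (M \<Otimes>\<^sub>M N)"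
    and L[measurable]: "L \<in> measurable M (subprob_algebra N)"
  shows "(\<lambda>x. LINT y|L x. f x y) \<in> borel_measurable M"
proof -
  note measurable_distr2[measurable]
  have "(\<lambda>x. integral\<^sup>L (distr (L x) (M \<Otimes>\<^sub>M N) (\<lambda>y. (x, y))) (\<lambda>(x, y). f x y)) \<in> borel_measurable M"
    by measurable
  then show ?thesis
  proof (rule measurable_cong[THEN iffD1, rotated])
    fix x assume x: "x \<in> space M"
    from measurable_space[OF L x] have [measurable_cong]: "sets (L x) = sets N"
      by (simp add: space_subprob_algebra)
    show "integral\<^sup>L (distr (L x) (M \<Otimes>\<^sub>M N) (\<lambda>y. (x, y))) (\<lambda>(x, y). f x y) = (LINT y|L x. f x y)"
      using x by (subst integral_distr) simp_all
  qed
qed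

text \<open>A right process whose state space is a Polish space, with its own topology.\<close>

locale spatial_motion = right_process "euclidean :: 'e::polish_space topology" P W \<xi> Pr
  for P :: "real \<Rightarrow> 'e::polish_space \<Rightarrow> 'e measure" and W :: "'w measure" and \<xi> :: "real \<Rightarrow> 'w \<Rightarrow> 'e option"
    and Pr :: "'e \<Rightarrow> 'w measure"
begin

text \<open>The position before the lifetime, and the constant \<open>the None\<close> afterwards. Negative times are read
  as time \<open>0\<close>, so that every real time is admissible.\<close>

definition pos :: "real \<Rightarrow> 'w \<Rightarrow> 'e" where
  "pos s w = the (\<xi> (max 0 s) w)"

text \<open>The indicator of being alive at time \<open>s\<close>.\<close>

definition alive :: "real \<Rightarrow> 'w \<Rightarrow> real" where
  "alive s w = (case \<xi> (max 0 s) w of None \<Rightarrow> 0 | Some y \<Rightarrow> 1)"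

lemma alive_bounds: "0 \<le> alive s w" "alive s w \<le> 1"
  by (auto simp: alive_def split: option.split)

lemma motion_kernel [measurable]: "0 \<le> t \<Longrightarrow> P t \<in> borel \<rightarrow>\<^sub>M subprob_algebra borel"
  using kernel by (simp add: borel_of_euclidean)

lemma motion_law [measurable]: "Pr \<in> borel \<rightarrow>\<^sub>M prob_algebra W"
  using law_kernel by (simp add: borel_of_euclidean)

lemma motion_law_subprob [measurable]: "Pr \<in> borel \<rightarrow>\<^sub>M subprob_algebra W"
  by (rule measurable_prob_algebraD) (rule motion_law)

lemma motion_sets: "sets (Pr x) = sets W" and motion_space: "space (Pr x) = space W"
  and motion_prob: "prob_space (Pr x)"
  using law_sets[of x] law_space[of x] law_prob[of x] by auto

lemma motion_finite: "finite_measure (Pr x)"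
  using motion_prob[of x] by (rule prob_space.finite_measure)

lemma motion_sets_kernel: "0 \<le> t \<Longrightarrow> sets (P t x) = sets borel"
  using sets_kernel[of t x] by (simp add: borel_of_euclidean)

lemma motion_finite_kernel: "0 \<le> t \<Longrightarrow> finite_measure (P t x)"
  using subprob_kernel[of t x] by (simp add: subprob_space_def)

lemma pos_alt: "pos s w = (case \<xi> (max 0 s) w of None \<Rightarrow> the None | Some y \<Rightarrow> y)"
  by (simp add: pos_def split: option.split)

lemma pos_filt: "0 \<le> s \<Longrightarrow> s \<le> t \<Longrightarrow> pos s \<in> borel_measurable (filt t)"
  and alive_filt: "0 \<le> s \<Longrightarrow> s \<le> t \<Longrightarrow> alive s \<in> borel_measurable (filt t)"
  unfolding pos_alt[abs_def] alive_def[abs_def] max_def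
  by (auto simp: borel_of_euclidean intro!: position_measurable_filt)

lemma eventually_at_right_later: "\<forall>\<^sub>F r in at_right (s::real). s < r"
  by (auto simp: eventually_at_right_less)

lemma pos_right_continuous:
  assumes w: "w \<in> space W" and s: "0 \<le> s"
  shows "((\<lambda>r. pos r w) \<longlongrightarrow> pos s w) (at_right s)"
proof (cases "\<xi> s w")
  case None
  have "\<forall>\<^sub>F r in at_right s. pos r w = pos s w"
    using eventually_at_right_later[of s]
    by eventually_elim (use absorbed[OF w s _ None] None s in \<open>simp add: pos_def\<close>)
  then show ?thesis by (rule tendsto_eventually)
next
  case (Some y)
  have "((\<lambda>r. the (\<xi> r w)) \<longlongrightarrow> y) (at_right s)"
    using right_limit[OF w s Some] by simp
  moreover have "\<forall>\<^sub>F r in at_right s. the (\<xi> r w) = pos r w"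
    using eventually_at_right_later[of s] by eventually_elim (use s in \<open>simp add: pos_def\<close>)
  ultimately show ?thesis using Some s by (simp add: pos_def tendsto_cong)
qed

lemma alive_right_continuous:
  assumes w: "w \<in> space W" and s: "0 \<le> s"
  shows "((\<lambda>r. alive r w) \<longlongrightarrow> alive s w) (at_right s)"
proof (cases "\<xi> s w")
  case None
  have "\<forall>\<^sub>F r in at_right s. alive r w = alive s w"
    using eventually_at_right_later[of s]
    by eventually_elim (use absorbed[OF w s _ None] None s in \<open>simp add: alive_def\<close>)
  then show ?thesis by (rule tendsto_eventually)
next
  case (Some y)
  have "\<forall>\<^sub>F r in at_right s. alive r w = alive s w"
    using eventually_at_right_later[of s] alive_right[OF w s Some]
    by eventually_elim (use Some s in \<open>auto simp: alive_def split: option.split\<close>)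
  then show ?thesis by (rule tendsto_eventually)
qed

lemma pos_progressive:
    "0 \<le> t \<Longrightarrow> (\<lambda>(s, w). pos (min t (max 0 s)) w) \<in> borel_measurable (borel \<Otimes>\<^sub>M filt t)"
  and alive_progressive:
    "0 \<le> t \<Longrightarrow> (\<lambda>(s, w). alive (min t (max 0 s)) w) \<in> borel_measurable (borel \<Otimes>\<^sub>M filt t)"
  by (intro right_continuous_joint_measurable pos_filt alive_filt;
      simp add: pos_right_continuous alive_right_continuous)+

lemma from_filt_joint:
  "f \<in> measurable (borel \<Otimes>\<^sub>M filt t) N \<Longrightarrow> f \<in> measurable ((borel :: real measure) \<Otimes>\<^sub>M W) N"
proof -
  assume f: "f \<in> measurable (borel \<Otimes>\<^sub>M filt t) N"
  have "(\<lambda>w. w) \<in> W \<rightarrow>\<^sub>M filt t"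
    using filt_subset[of t] by (auto simp: measurable_def)
  then have "(\<lambda>x. (fst x, snd x)) \<in> (borel :: real measure) \<Otimes>\<^sub>M W \<rightarrow>\<^sub>M borel \<Otimes>\<^sub>M filt t"
    by (intro measurable_Pair) (auto intro: measurable_compose[OF measurable_snd])
  from measurable_compose[OF this f] show ?thesis by simp
qed

lemma joint_of_truncations:
  fixes Y :: "real \<Rightarrow> 'w \<Rightarrow> 'b::metric_space"
  assumes Y: "\<And>t. 0 \<le> t \<Longrightarrow> (\<lambda>(s, w). Y (min t (max 0 s)) w) \<in> borel_measurable (borel \<Otimes>\<^sub>M W)"
    and neg: "\<And>s w. Y (max 0 s) w = Y s w"
  shows "(\<lambda>(s, w). Y s w) \<in> borel_measurable ((borel :: real measure) \<Otimes>\<^sub>M W)"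
proof (rule borel_measurable_LIMSEQ_metric)
  show "(\<lambda>(s, w). Y (min (real n) (max 0 s)) w) \<in> borel_measurable ((borel :: real measure) \<Otimes>\<^sub>M W)" for n
    by (rule Y) simp
  fix x assume "x \<in> space ((borel :: real measure) \<Otimes>\<^sub>M W)"
  obtain s w where x: "x = (s, w)" by (cases x)
  have "\<forall>\<^sub>F n in sequentially. Y (min (real n) (max 0 s)) w = Y s w"
    using eventually_ge_at_top[of "nat \<lceil>max 0 s\<rceil>"]
  proof eventually_elim
    case (elim n)
    then have "max 0 s \<le> real n" by linarith
    then have "min (real n) (max 0 s) = max 0 s" by (rule min_absorb2)
    then show ?case by (simp add: neg)
  qed
  then show "(\<lambda>n. case x of (s, w) \<Rightarrow> Y (min (real n) (max 0 s)) w) \<longlonglongrightarrow> (case x of (s, w) \<Rightarrow> Y s w)"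
    unfolding x by (simp add: tendsto_eventually)
qed

lemma pos_joint: "(\<lambda>(s, w). pos s w) \<in> borel_measurable (borel \<Otimes>\<^sub>M W)"
  by (rule joint_of_truncations, rule from_filt_joint, erule pos_progressive) (simp add: pos_def)

lemma alive_joint: "(\<lambda>(s, w). alive s w) \<in> borel_measurable (borel \<Otimes>\<^sub>M W)"
  by (rule joint_of_truncations, rule from_filt_joint, erule alive_progressive) (simp add: alive_def)

lemma pos_measurable' [measurable (raw)]:
  "f \<in> borel_measurable N \<Longrightarrow> g \<in> measurable N W \<Longrightarrow> (\<lambda>x. pos (f x) (g x)) \<in> borel_measurable N"
  using measurable_compose[OF _ pos_joint, of "\<lambda>x. (f x, g x)" N] by simp

lemma alive_measurable' [measurable (raw)]:
  "f \<in> borel_measurable N \<Longrightarrow> g \<in> measurable N W \<Longrightarrow> (\<lambda>x. alive (f x) (g x)) \<in> borel_measurable N"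
  using measurable_compose[OF _ alive_joint, of "\<lambda>x. (f x, g x)" N] by simp

text \<open>The law of the position at time \<open>t\<close>; through it, integrals against \<open>P t x\<close> inherit joint
  measurability in \<open>(t, x)\<close> from that of the paths.\<close>

lemma kernel_as_law:
  assumes t: "0 \<le> t"
  shows "P t x = distr (density (Pr x) (\<lambda>w. ennreal (alive t w))) borel (pos t)"
proof (rule measure_eqI)
  note [measurable_cong] = motion_sets
  show "sets (P t x) = sets (distr (density (Pr x) (\<lambda>w. ennreal (alive t w))) borel (pos t))"
    using motion_sets_kernel[OF t] by simp
  fix B assume "B \<in> sets (P t x)"
  then have B[measurable]: "B \<in> sets borel" by (simp add: motion_sets_kernel[OF t])
  have "emeasure (P t x) B = (\<integral>\<^sup>+ z. indicator B z \<partial>P t x)"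
    using t by (simp add: motion_sets_kernel)
  also have "\<dots> = (\<integral>\<^sup>+ w. (case \<xi> t w of None \<Rightarrow> 0 | Some y \<Rightarrow> indicator B y) \<partial>Pr x)"
    by (rule law_at[symmetric]) (simp_all add: t borel_of_euclidean)
  also have "\<dots> = (\<integral>\<^sup>+ w. ennreal (alive t w) * indicator B (pos t w) \<partial>Pr x)"
    using t by (intro nn_integral_cong) (auto simp: alive_def pos_def split: option.split)
  also have "\<dots> = emeasure (density (Pr x) (\<lambda>w. ennreal (alive t w))) (pos t -` B \<inter> space W)"
    by (subst emeasure_density)
       (auto intro!: nn_integral_cong simp: motion_space indicator_def)
  also have "\<dots> = emeasure (distr (density (Pr x) (\<lambda>w. ennreal (alive t w))) borel (pos t)) B"
    by (subst emeasure_distr) (auto simp: motion_space)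
  finally show "emeasure (P t x) B = emeasure (distr (density (Pr x) (\<lambda>w. ennreal (alive t w))) borel (pos t)) B" .
qed

lemma kernel_integral:
  fixes f :: "'e \<Rightarrow> real"
  assumes t: "0 \<le> t" and f[measurable]: "f \<in> borel_measurable borel"
  shows "(LINT z|P t x. f z) = (LINT w|Pr x. alive t w * f (pos t w))"
proof -
  note [measurable_cong] = motion_sets
  show ?thesis unfolding kernel_as_law[OF t]
    by (subst integral_distr) (simp_all add: integral_density alive_bounds)
qed

text \<open>The Markov property for bounded real functions.\<close>

lemma markov_real_nonneg:
  fixes Z :: "'w \<Rightarrow> real" and g :: "'e \<Rightarrow> real"
  assumes s: "0 \<le> s" and t: "0 \<le> t"
    and Z: "Z \<in> borel_measurable (filt s)" "\<And>w. 0 \<le> Z w"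
    and g[measurable]: "g \<in> borel_measurable borel" and gn: "\<And>y. 0 \<le> g y" and gb: "\<And>y. g y \<le> C"
  shows "(LINT w|Pr x. Z w * (alive (s + t) w * g (pos (s + t) w))) =
    (LINT w|Pr x. Z w * (alive s w * (LINT z|P t (pos s w). g z)))"
proof -
  note [measurable_cong] = motion_sets
  have [measurable]: "Z \<in> borel_measurable W" using Z(1) by (rule measurable_from_filt)
  have [measurable]: "(\<lambda>y. LINT z|P t y. g z) \<in> borel_measurable borel"
    by (rule integral_kernel_measurable[OF _ motion_kernel[OF t]]) simp
  have nn: "0 \<le> (LINT z|P t y. g z)" for y by (rule integral_nonneg_AE) (simp add: gn)
  have "(LINT w|Pr x. Z w * (alive (s + t) w * g (pos (s + t) w))) =
      enn2real (\<integral>\<^sup>+ w. ennreal (Z w) * (case \<xi> (s + t) w of None \<Rightarrow> 0 | Some y \<Rightarrow> ennreal (g y)) \<partial>Pr x)"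
  proof -
    have i: "(LINT w|Pr x. Z w * (alive (s + t) w * g (pos (s + t) w))) =
        enn2real (\<integral>\<^sup>+ w. ennreal (Z w * (alive (s + t) w * g (pos (s + t) w))) \<partial>Pr x)"
      by (rule integral_eq_nn_integral) (simp_all add: Z gn alive_bounds)
    have "ennreal (Z w * (alive (s + t) w * g (pos (s + t) w))) =
        ennreal (Z w) * (case \<xi> (s + t) w of None \<Rightarrow> 0 | Some y \<Rightarrow> ennreal (g y))" for w
      using s t Z(2)[of w] by (auto simp: alive_def pos_def ennreal_mult gn split: option.split)
    then show ?thesis unfolding i by simp
  qed
  also have "(\<integral>\<^sup>+ w. ennreal (Z w) * (case \<xi> (s + t) w of None \<Rightarrow> 0 | Some y \<Rightarrow> ennreal (g y)) \<partial>Pr x) =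
     (\<integral>\<^sup>+ w. ennreal (Z w) * (case \<xi> s w of None \<Rightarrow> 0 | Some y \<Rightarrow> (\<integral>\<^sup>+ z. ennreal (g z) \<partial>P t y)) \<partial>Pr x)"
    using Z(1) by (intro markov s t) (simp_all add: borel_of_euclidean)
  also have "(\<lambda>y. \<integral>\<^sup>+ z. ennreal (g z) \<partial>P t y) = (\<lambda>y. ennreal (LINT z|P t y. g z))"
  proof
    fix y
    have "integrable (P t y) g"
      by (rule borel_measurable_bounded_integrable[of _ _ C, OF motion_finite_kernel[OF t]])
         (use gn gb in \<open>auto simp: measurable_cong_sets[OF motion_sets_kernel[OF t] refl]\<close>)
    then show "(\<integral>\<^sup>+ z. ennreal (g z) \<partial>P t y) = ennreal (LINT z|P t y. g z)"
      by (rule nn_integral_eq_integral) (simp add: gn)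
  qed
  also have "enn2real (\<integral>\<^sup>+ w. ennreal (Z w) * (case \<xi> s w of None \<Rightarrow> 0 | Some y \<Rightarrow> ennreal (LINT z|P t y. g z)) \<partial>Pr x) =
     (LINT w|Pr x. Z w * (alive s w * (LINT z|P t (pos s w). g z)))"
  proof -
    have i: "(LINT w|Pr x. Z w * (alive s w * (LINT z|P t (pos s w). g z))) =
        enn2real (\<integral>\<^sup>+ w. ennreal (Z w * (alive s w * (LINT z|P t (pos s w). g z))) \<partial>Pr x)"
      by (rule integral_eq_nn_integral) (simp_all add: Z nn alive_bounds)
    have "ennreal (Z w * (alive s w * (LINT z|P t (pos s w). g z))) =
        ennreal (Z w) * (case \<xi> s w of None \<Rightarrow> 0 | Some y \<Rightarrow> ennreal (LINT z|P t y. g z))" for w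
      using s Z(2)[of w] by (auto simp: alive_def pos_def ennreal_mult nn split: option.split)
    then show ?thesis unfolding i by simp
  qed
  finally show ?thesis .
qed

lemma kernel_integral_bound:
  fixes g :: "'e \<Rightarrow> real"
  assumes t: "0 \<le> t" and g[measurable]: "g \<in> borel_measurable borel" and gb: "\<And>y. \<bar>g y\<bar> \<le> C"
  shows "\<bar>LINT z|P t x. g z\<bar> \<le> C"
proof -
  interpret prob_space "Pr x" by (rule motion_prob)
  note [measurable_cong] = motion_sets
  have C: "0 \<le> C" using gb[of undefined] by linarith
  have le: "\<bar>alive t w * g (pos t w)\<bar> \<le> C" for w
    using mult_mono[of "alive t w" 1 "\<bar>g (pos t w)\<bar>" C] gb[of "pos t w"] C alive_bounds[of t w]
    by (simp add: abs_mult)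
  have "\<bar>LINT w|Pr x. alive t w * g (pos t w)\<bar> \<le> (LINT w|Pr x. \<bar>alive t w * g (pos t w)\<bar>)"
    by (rule integral_abs_bound)
  also have "\<dots> \<le> C"
    by (rule integral_le_const) (use le in \<open>auto intro!: integrable_const_bound[of _ C]\<close>)
  finally show ?thesis by (simp add: kernel_integral[OF t])
qed

lemma markov_real:
  fixes Z :: "'w \<Rightarrow> real" and g :: "'e \<Rightarrow> real"
  assumes s: "0 \<le> s" and t: "0 \<le> t"
    and Z: "Z \<in> borel_measurable (filt s)" and Zb: "\<And>w. \<bar>Z w\<bar> \<le> D"
    and g[measurable]: "g \<in> borel_measurable borel" and gb: "\<And>y. \<bar>g y\<bar> \<le> C"
  shows "(LINT w|Pr x. Z w * (alive (s + t) w * g (pos (s + t) w))) =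
    (LINT w|Pr x. Z w * (alive s w * (LINT z|P t (pos s w). g z)))"
proof -
  interpret prob_space "Pr x" by (rule motion_prob)
  note [measurable_cong] = motion_sets
  have C: "0 \<le> C" using gb[of undefined] by linarith
  have D: "0 \<le> D" using Zb[of undefined] by linarith
  define Zp Zm where "Zp w = max 0 (Z w)" and "Zm w = max 0 (- Z w)" for w
  define gp gm where "gp y = max 0 (g y)" and "gm y = max 0 (- g y)" for y
  note [measurable] = measurable_from_filt[OF Z]
  have Zf: "Zp \<in> borel_measurable (filt s)" "Zm \<in> borel_measurable (filt s)"
    using Z unfolding Zp_def[abs_def] Zm_def[abs_def] by measurable
  have [measurable]: "Zp \<in> borel_measurable W" "Zm \<in> borel_measurable W"
    "gp \<in> borel_measurable borel" "gm \<in> borel_measurable borel"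
    unfolding Zp_def[abs_def] Zm_def[abs_def] gp_def[abs_def] gm_def[abs_def] by measurable
  have Zn: "0 \<le> Zp w" "0 \<le> Zm w" "\<bar>Zp w\<bar> \<le> D" "\<bar>Zm w\<bar> \<le> D" and Zeq: "Z w = Zp w - Zm w" for w
    using Zb[of w] by (auto simp: Zp_def Zm_def)
  have gn: "0 \<le> gp y" "0 \<le> gm y" "\<bar>gp y\<bar> \<le> C" "\<bar>gm y\<bar> \<le> C" and geq: "g y = gp y - gm y" for y
    using gb[of y] by (auto simp: gp_def gm_def)
  have gn': "gp y \<le> C" "gm y \<le> C" for y using gn[of y] by auto
  have int: "integrable (Pr x) (\<lambda>w. U w * (alive r w * G w))"
    if [measurable]: "U \<in> borel_measurable W" "G \<in> borel_measurable W"
      and b: "\<And>w. \<bar>U w\<bar> \<le> D" "\<And>w. \<bar>G w\<bar> \<le> C" for U G r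
  proof (rule borel_measurable_bounded_integrable[of _ _ "D * C", OF motion_finite])
    fix w
    have "\<bar>alive r w * G w\<bar> \<le> 1 * C"
      unfolding abs_mult using alive_bounds b C by (intro mult_mono) auto
    then show "\<bar>U w * (alive r w * G w)\<bar> \<le> D * C"
      unfolding abs_mult[of "U w"] using b D by (intro mult_mono) auto
  qed measurable
  have expand: "(LINT w|Pr x. Z w * (alive r w * (G w - G' w))) =
      (LINT w|Pr x. Zp w * (alive r w * G w)) - (LINT w|Pr x. Zp w * (alive r w * G' w)) -
      ((LINT w|Pr x. Zm w * (alive r w * G w)) - (LINT w|Pr x. Zm w * (alive r w * G' w)))"
    if [measurable]: "G \<in> borel_measurable W" "G' \<in> borel_measurable W"
      and b: "\<And>w. \<bar>G w\<bar> \<le> C" "\<And>w. \<bar>G' w\<bar> \<le> C" for G G' r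
  proof -
    have "(LINT w|Pr x. Z w * (alive r w * (G w - G' w))) =
      (LINT w|Pr x. Zp w * (alive r w * G w) - Zp w * (alive r w * G' w) -
        (Zm w * (alive r w * G w) - Zm w * (alive r w * G' w)))"
      by (simp add: Zeq algebra_simps)
    moreover have "integrable (Pr x) (\<lambda>w. U w * (alive r w * K w))"
      if "U = Zp \<or> U = Zm" "K = G \<or> K = G'" for U K
      by (rule int) (use that b Zn in auto)
    ultimately show ?thesis by simp
  qed
  have [measurable]: "(\<lambda>y. LINT z|P t y. h z) \<in> borel_measurable borel"
    if [measurable]: "h \<in> borel_measurable borel" for h :: "'e \<Rightarrow> real"
    by (rule integral_kernel_measurable[OF _ motion_kernel[OF t]]) simp
  have intP: "integrable (P t y) h" if "h \<in> borel_measurable borel" "\<And>y. \<bar>h y\<bar> \<le> C" for h y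
    by (rule borel_measurable_bounded_integrable[OF motion_finite_kernel[OF t]])
       (use that in \<open>auto simp: measurable_cong_sets[OF motion_sets_kernel[OF t] refl]\<close>)
  have P_eq: "(LINT z|P t y. g z) = (LINT z|P t y. gp z) - (LINT z|P t y. gm z)" for y
    unfolding geq by (rule Bochner_Integration.integral_diff) (auto intro!: intP gn)
  have Pb: "\<bar>LINT z|P t y. gp z\<bar> \<le> C" "\<bar>LINT z|P t y. gm z\<bar> \<le> C" for y
    by (auto intro!: kernel_integral_bound[OF t] gn simp del: abs_le_iff)
  have "(LINT w|Pr x. Z w * (alive (s + t) w * g (pos (s + t) w))) =
    (LINT w|Pr x. Z w * (alive (s + t) w * (gp (pos (s + t) w) - gm (pos (s + t) w))))"
    by (simp add: geq)
  also have "\<dots> = (LINT w|Pr x. Z w * (alive s w * ((LINT z|P t (pos s w). gp z) - (LINT z|P t (pos s w). gm z))))"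
  proof -
    have "(LINT w|Pr x. U w * (alive (s + t) w * h (pos (s + t) w))) =
        (LINT w|Pr x. U w * (alive s w * (LINT z|P t (pos s w). h z)))"
      if "U = Zp \<or> U = Zm" "h = gp \<or> h = gm" for U h
      by (rule markov_real_nonneg[OF s t, of _ _ C]) (use that Zf Zn gn gn' in auto)
    note m = this
    have e1: "(LINT w|Pr x. Z w * (alive (s + t) w * (gp (pos (s + t) w) - gm (pos (s + t) w)))) =
      (LINT w|Pr x. Zp w * (alive (s + t) w * gp (pos (s + t) w))) - (LINT w|Pr x. Zp w * (alive (s + t) w * gm (pos (s + t) w))) -
      ((LINT w|Pr x. Zm w * (alive (s + t) w * gp (pos (s + t) w))) - (LINT w|Pr x. Zm w * (alive (s + t) w * gm (pos (s + t) w))))"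
      by (rule expand) (measurable, intro gn, intro gn)
    have e2: "(LINT w|Pr x. Z w * (alive s w * ((LINT z|P t (pos s w). gp z) - (LINT z|P t (pos s w). gm z)))) =
      (LINT w|Pr x. Zp w * (alive s w * (LINT z|P t (pos s w). gp z))) - (LINT w|Pr x. Zp w * (alive s w * (LINT z|P t (pos s w). gm z))) -
      ((LINT w|Pr x. Zm w * (alive s w * (LINT z|P t (pos s w). gp z))) - (LINT w|Pr x. Zm w * (alive s w * (LINT z|P t (pos s w). gm z))))"
      by (rule expand) (measurable, intro Pb, intro Pb)
    show ?thesis unfolding e1 e2 by (simp only: m simp_thms)
  qed
  finally show ?thesis by (simp add: P_eq)
qed


text \<open>The Feynman-Kac weight \<open>exp(\<integral>\<^sub>0\<^sup>s \<beta>(\<xi>\<^sub>r) dr)\<close>.\<close>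

definition weight :: "('e \<Rightarrow> real) \<Rightarrow> real \<Rightarrow> 'w \<Rightarrow> real" where
  "weight \<beta> s w = exp (LINT r:{0..s}|lborel. \<beta> (pos r w))"

lemma weight_pos: "0 < weight \<beta> s w"
  by (simp add: weight_def)

lemma weight_joint:
  assumes [measurable]: "\<beta> \<in> borel_measurable borel"
  shows "(\<lambda>(s, w). weight \<beta> s w) \<in> borel_measurable (borel \<Otimes>\<^sub>M W)"
proof -
  have "(\<lambda>(r, w). \<beta> (pos r w)) \<in> borel_measurable ((borel :: real measure) \<Otimes>\<^sub>M W)"
    by measurable
  note [measurable] = integral_upto_measurable[OF this]
  have "(\<lambda>z. exp (case z of (s, w) \<Rightarrow> LINT r:{0..s}|lborel. \<beta> (pos r w))) \<in> borel_measurable (borel \<Otimes>\<^sub>M W)"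
    by measurable
  then show ?thesis by (simp add: weight_def split_beta')
qed

lemma weight_measurable [measurable (raw)]:
  "\<beta> \<in> borel_measurable borel \<Longrightarrow> f \<in> borel_measurable N \<Longrightarrow> g \<in> measurable N W \<Longrightarrow>
    (\<lambda>x. weight \<beta> (f x) (g x)) \<in> borel_measurable N"
  using measurable_compose[OF _ weight_joint, of "\<lambda>x. (f x, g x)" N] by simp

lemma weight_filt:
  assumes [measurable]: "\<beta> \<in> borel_measurable borel" and s: "0 \<le> s"
  shows "weight \<beta> s \<in> borel_measurable (filt s)"
proof -
  have [measurable]: "(\<lambda>(r, w). pos (min s (max 0 r)) w) \<in> borel_measurable (borel \<Otimes>\<^sub>M filt s)"
    by (rule pos_progressive[OF s])
  have "(\<lambda>z. \<beta> (case z of (r, w) \<Rightarrow> pos (min s (max 0 r)) w)) \<in> borel_measurable (borel \<Otimes>\<^sub>M filt s)"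
    by measurable
  then have "(\<lambda>(r, w). \<beta> (pos (min s (max 0 r)) w)) \<in> borel_measurable (borel \<Otimes>\<^sub>M filt s)"
    by (simp add: split_beta')
  from measurable_compose[OF _ integral_upto_measurable[OF this], of "\<lambda>w. (s, w)" "filt s"]
  have "(\<lambda>w. LINT r:{0..s}|lborel. \<beta> (pos (min s (max 0 r)) w)) \<in> borel_measurable (filt s)"
    by simp
  moreover have "(LINT r:{0..s}|lborel. \<beta> (pos (min s (max 0 r)) w)) = (LINT r:{0..s}|lborel. \<beta> (pos r w))" for w
    by (intro set_lebesgue_integral_cong) auto
  ultimately show ?thesis unfolding weight_def[abs_def] by simp
qed

lemma path_borel: "w \<in> space W \<Longrightarrow> (\<lambda>r. pos r w) \<in> borel_measurable borel"
  using measurable_compose[OF _ pos_joint, of "\<lambda>r. (r, w)" borel] by simp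

lemma weight_bounds:
  assumes [measurable]: "\<beta> \<in> borel_measurable borel" and b: "\<And>y. \<bar>\<beta> y\<bar> \<le> b"
    and s: "s \<le> t" "0 \<le> t" and w: "w \<in> space W"
  shows "weight \<beta> s w \<le> exp (b * t)" "exp (- (b * t)) \<le> weight \<beta> s w"
proof -
  have b0: "0 \<le> b" using b[of undefined] by linarith
  note [measurable] = path_borel[OF w]
  have "\<bar>LINT r:{0..s}|lborel. \<beta> (pos r w)\<bar> \<le> b * t"
  proof (cases "0 \<le> s")
    case True
    have "(\<lambda>r. \<beta> (pos r w)) \<in> borel_measurable borel" by measurable
    from abs_set_integral_le[OF this b, of 0 s] True
    have "\<bar>LINT r:{0..s}|lborel. \<beta> (pos r w)\<bar> \<le> b * s" by simp
    also have "\<dots> \<le> b * t" using s b0 by (intro mult_left_mono)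
    finally show ?thesis .
  next
    case False
    then show ?thesis using b0 s by (simp add: set_lebesgue_integral_def)
  qed
  then show "weight \<beta> s w \<le> exp (b * t)" "exp (- (b * t)) \<le> weight \<beta> s w"
    by (auto simp: weight_def abs_le_iff)
qed

lemma weight_identity:
  assumes [measurable]: "\<beta> \<in> borel_measurable borel" and b: "\<And>y. \<bar>\<beta> y\<bar> \<le> b" and s: "0 \<le> s" and w: "w \<in> space W"
  shows "(LINT r:{0..s}|lborel. weight \<beta> r w * \<beta> (pos r w)) = weight \<beta> s w - 1"
  using exp_integral_identity[of "\<lambda>r. \<beta> (pos r w)" b s] path_borel[OF w] b s
  by (simp add: weight_def)

text \<open>The Markov property along a solution of \<open>u\<^sub>q = P\<^sub>q f + \<integral>\<^sub>0\<^sup>q P\<^sub>r k\<^bsub>q-r\<^esub> dr\<close>: in other words,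
  \<open>u\<^bsub>t-s\<^esub>(\<xi>\<^sub>s) + \<integral>\<^sub>0\<^sup>s k\<^bsub>t-q\<^esub>(\<xi>\<^sub>q) dq\<close> is a martingale on \<open>[0,t]\<close>.\<close>

lemma markov_along_solution:
  fixes u k :: "real \<Rightarrow> 'e \<Rightarrow> real"
  assumes s: "0 \<le> s" "s \<le> t"
    and f[measurable]: "f \<in> borel_measurable borel" and fb: "\<And>y. \<bar>f y\<bar> \<le> C"
    and u[measurable]: "(\<lambda>(s, y). u s y) \<in> borel_measurable (borel \<Otimes>\<^sub>M borel)" and ub: "\<And>s y. \<bar>u s y\<bar> \<le> C"
    and k[measurable]: "(\<lambda>(s, y). k s y) \<in> borel_measurable (borel \<Otimes>\<^sub>M borel)" and kb: "\<And>s y. \<bar>k s y\<bar> \<le> C"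
    and eqn: "\<And>q y. 0 \<le> q \<Longrightarrow> q \<le> t \<Longrightarrow>
        u q y = (LINT z|P q y. f z) + (LINT r:{0..q}|lborel. (LINT z|P r y. k (q - r) z))"
    and Z: "Z \<in> borel_measurable (filt s)" and Zb: "\<And>w. \<bar>Z w\<bar> \<le> D"
  shows "(LINT w|Pr x. Z w * (alive t w * f (pos t w))) =
    (LINT w|Pr x. Z w * (alive s w * u (t - s) (pos s w))) -
    (LINT q:{s..t}|lborel. (LINT w|Pr x. Z w * (alive q w * k (t - q) (pos q w))))"
proof -
  interpret prob_space "Pr x" by (rule motion_prob)
  note [measurable_cong] = motion_sets
  have ts: "0 \<le> t - s" "s + (t - s) = t" using s by auto
  have C: "0 \<le> C" using fb[of undefined] by linarith
  have ab: "\<bar>alive r w\<bar> \<le> 1" for r w using alive_bounds[of r w] by simp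
  note [measurable] = measurable_from_filt[OF Z]
  define A where "A r y = (LINT w|Pr y. alive r w * k (t - s - r) (pos r w))" for r y
  have A_eq: "A r y = (LINT z|P r y. k (t - s - r) z)" if "0 \<le> r" for r y
    unfolding A_def using that by (subst kernel_integral) simp_all
  have Ab: "\<bar>A r y\<bar> \<le> C" for r y
  proof -
    have "A r y = A' r y" if "\<And>r y. A' r y = (LINT w|Pr y. alive (max 0 r) w * k (t - s - r) (pos (max 0 r) w))" for A'
      using that by (simp add: A_def alive_def pos_def)
    then have "A r y = (LINT z|P (max 0 r) y. k (t - s - r) z)"
      by (subst kernel_integral) simp_all
    then show ?thesis by (simp only:) (rule kernel_integral_bound; simp add: kb)
  qed
  have Am[measurable]: "(\<lambda>(r, y). A r y) \<in> borel_measurable (borel \<Otimes>\<^sub>M borel)"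
  proof -
    have "(\<lambda>z. LINT w|Pr (snd z). alive (fst z) w * k (t - s - fst z) (pos (fst z) w)) \<in> borel_measurable (borel \<Otimes>\<^sub>M borel)"
      by (rule integral_kernel_measurable[where N=W]) measurable
    then show ?thesis by (simp add: A_def split_beta')
  qed
  define J where "J y = (LINT r:{0..t - s}|lborel. A r y)" for y
  have Pf: "(LINT z|P (t - s) y. f z) = u (t - s) y - J y" for y
  proof -
    have "J y = (LINT r:{0..t - s}|lborel. (LINT z|P r y. k (t - s - r) z))"
      unfolding J_def by (intro set_lebesgue_integral_cong) (auto simp: A_eq)
    then show ?thesis using eqn[of "t - s" y] s by simp
  qed
  have Jm[measurable]: "J \<in> borel_measurable borel"
  proof -
    have "(\<lambda>y. LINT r|lborel. indicator {0..t - s} r *\<^sub>R A r y) \<in> borel_measurable borel" by measurable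
    then show ?thesis by (simp add: J_def[abs_def] set_lebesgue_integral_def)
  qed
  have Jb: "\<bar>J y\<bar> \<le> C * (t - s)" for y
  proof -
    have "(\<lambda>r. A r y) \<in> borel_measurable borel" by measurable
    from abs_set_integral_le[OF this Ab, of 0 "t - s"] ts show ?thesis by (simp add: J_def)
  qed
  have int: "integrable (Pr x) (\<lambda>w. Z w * (alive s w * G (pos s w)))"
    if [measurable]: "G \<in> borel_measurable borel" and G: "\<And>y. \<bar>G y\<bar> \<le> B" for G B
    by (rule borel_measurable_bounded_integrable[of _ _ "D * (1 * B)", OF motion_finite])
       (simp, intro abs_mult_le Zb ab G)
  have "(LINT w|Pr x. Z w * (alive t w * f (pos t w))) = (LINT w|Pr x. Z w * (alive s w * (LINT z|P (t - s) (pos s w). f z)))"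
    using markov_real[OF s(1) ts(1) Z Zb f fb, where x=x] by (simp add: ts)
  also have "\<dots> = (LINT w|Pr x. Z w * (alive s w * u (t - s) (pos s w)) - Z w * (alive s w * J (pos s w)))"
    by (simp add: Pf algebra_simps)
  also have "\<dots> = (LINT w|Pr x. Z w * (alive s w * u (t - s) (pos s w))) - (LINT w|Pr x. Z w * (alive s w * J (pos s w)))"
    by (rule Bochner_Integration.integral_diff[OF int[OF _ ub] int[OF _ Jb]]) measurable
  also have "(LINT w|Pr x. Z w * (alive s w * J (pos s w))) =
      (LINT w|Pr x. (LINT r:{0..t - s}|lborel. Z w * (alive s w * A r (pos s w))))"
    by (simp add: J_def)
  also have "\<dots> = (LINT r:{0..t - s}|lborel. (LINT w|Pr x. Z w * (alive s w * A r (pos s w))))"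
    by (rule Fubini_interval[where C="D * (1 * C)", OF motion_finite]) (measurable, intro abs_mult_le Zb ab Ab)
  also have "\<dots> = (LINT r:{0..t - s}|lborel. (LINT w|Pr x. Z w * (alive (s + r) w * k (t - (s + r)) (pos (s + r) w))))"
  proof (intro set_lebesgue_integral_cong)
    show "\<forall>r. r \<in> {0..t - s} \<longrightarrow> (LINT w|Pr x. Z w * (alive s w * A r (pos s w))) =
        (LINT w|Pr x. Z w * (alive (s + r) w * k (t - (s + r)) (pos (s + r) w)))"
    proof (intro allI impI)
      fix r assume "r \<in> {0..t - s}"
      then have r: "0 \<le> r" by simp
      have "(\<lambda>y. k (t - s - r) y) \<in> borel_measurable borel" by measurable
      from markov_real[OF s(1) r Z Zb this kb, where x=x]
      show "(LINT w|Pr x. Z w * (alive s w * A r (pos s w))) =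
        (LINT w|Pr x. Z w * (alive (s + r) w * k (t - (s + r)) (pos (s + r) w)))"
        by (simp add: A_eq[OF r] diff_diff_add)
    qed
  qed simp
  also have "\<dots> = (LINT q:{s..t}|lborel. (LINT w|Pr x. Z w * (alive q w * k (t - q) (pos q w))))"
    unfolding set_lebesgue_integral_def
    by (subst (2) lborel_integral_real_affine[of 1 _ s])
       (auto intro!: Bochner_Integration.integral_cong simp: indicator_def)
  finally show ?thesis .
qed

end

context spatial_motion
begin

lemma law_integral_measurable:
  fixes g :: "real \<Rightarrow> 'w \<Rightarrow> real"
  assumes "(\<lambda>(s, w). g s w) \<in> borel_measurable (borel \<Otimes>\<^sub>M W)"
  shows "(\<lambda>s. LINT w|Pr x. g s w) \<in> borel_measurable borel"
  by (rule integral_kernel_measurable[where N=W]) (use assms measurable_space[OF motion_law_subprob, of x] in auto)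

lemma law_integral_bound:
  fixes g :: "'w \<Rightarrow> real"
  assumes "g \<in> borel_measurable W" "\<And>w. w \<in> space W \<Longrightarrow> \<bar>g w\<bar> \<le> C"
  shows "\<bar>LINT w|Pr x. g w\<bar> \<le> C" and "integrable (Pr x) g"
proof -
  interpret prob_space "Pr x" by (rule motion_prob)
  note [measurable_cong] = motion_sets
  have [measurable]: "g \<in> borel_measurable (Pr x)" using assms(1) by simp
  show int: "integrable (Pr x) g"
    by (rule integrable_const_bound[of _ C]) (use assms(2) in \<open>auto simp: motion_space\<close>)
  have "\<bar>LINT w|Pr x. g w\<bar> \<le> (LINT w|Pr x. \<bar>g w\<bar>)" by (rule integral_abs_bound)
  also have "\<dots> \<le> C"
    by (rule integral_le_const) (use assms(2) int in \<open>auto simp: motion_space\<close>)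
  finally show "\<bar>LINT w|Pr x. g w\<bar> \<le> C" .
qed

text \<open>If \<open>u\<close> solves \<open>u\<^sub>q = P\<^sub>q f + \<integral>\<^sub>0\<^sup>q P\<^sub>r k\<^bsub>q-r\<^esub> dr\<close>, then for the Feynman-Kac semigroup \<open>T\<close> with rate \<open>\<beta>\<close>,
  \<open>T\<^sub>t f = u\<^sub>t + \<integral>\<^sub>0\<^sup>t T\<^sub>s(\<beta> u\<^bsub>t-s\<^esub> - k\<^bsub>t-s\<^esub>) ds\<close>. The weight is expanded as \<open>1 + \<integral> weight\<^sub>s \<beta>(\<xi>\<^sub>s) ds\<close>, the Markov
  property is applied at time \<open>s\<close>, and the double time integral is folded back into a weight.\<close>

theorem perturbation_formula:
  fixes u k :: "real \<Rightarrow> 'e \<Rightarrow> real"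
  assumes t: "0 \<le> t"
    and \<beta>[measurable]: "\<beta> \<in> borel_measurable borel" and \<beta>b: "\<And>y. \<bar>\<beta> y\<bar> \<le> b"
    and f[measurable]: "f \<in> borel_measurable borel" and fb: "\<And>y. \<bar>f y\<bar> \<le> C"
    and u[measurable]: "(\<lambda>(s, y). u s y) \<in> borel_measurable (borel \<Otimes>\<^sub>M borel)" and ub: "\<And>s y. \<bar>u s y\<bar> \<le> C"
    and k[measurable]: "(\<lambda>(s, y). k s y) \<in> borel_measurable (borel \<Otimes>\<^sub>M borel)" and kb: "\<And>s y. \<bar>k s y\<bar> \<le> C"
    and eqn: "\<And>q y. 0 \<le> q \<Longrightarrow> q \<le> t \<Longrightarrow>
        u q y = (LINT z|P q y. f z) + (LINT r:{0..q}|lborel. (LINT z|P r y. k (q - r) z))"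
  shows "(LINT w|Pr x. weight \<beta> t w * (alive t w * f (pos t w))) = u t x +
    (LINT s:{0..t}|lborel. (LINT w|Pr x. weight \<beta> s w * (alive s w *
        (\<beta> (pos s w) * u (t - s) (pos s w) - k (t - s) (pos s w)))))"
proof -
  interpret prob_space "Pr x" by (rule motion_prob)
  note [measurable_cong] = motion_sets
  have C: "0 \<le> C" using fb[of undefined] by linarith
  have ab: "\<bar>alive r w\<bar> \<le> 1" for r w using alive_bounds[of r w] by simp
  define D where "D = exp (b * t)"
  \<comment> \<open>The weight stopped at time \<open>t\<close> and set to zero off the sample space is bounded by \<open>D\<close> everywhere.\<close>
  define wt where "wt s w = (if w \<in> space W then weight \<beta> (min t s) w else 0)" for s w
  have [measurable]: "(\<lambda>(s, w). wt s w) \<in> borel_measurable (borel \<Otimes>\<^sub>M W)"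
  proof -
    have "(\<lambda>z. weight \<beta> (min t (fst z)) (snd z)) \<in> borel_measurable ((borel :: real measure) \<Otimes>\<^sub>M W)" by measurable
    then show ?thesis
      by (rule measurable_cong[THEN iffD1, rotated]) (auto simp: wt_def space_pair_measure)
  qed
  have wtb: "\<bar>wt s w\<bar> \<le> D" for s w
    using weight_bounds(1)[OF \<beta> \<beta>b, of "min t s" t w] weight_pos[of \<beta> "min t s" w] t
    by (auto simp: wt_def D_def)
  have wt_filt: "wt s \<in> borel_measurable (filt s)" if "0 \<le> s" "s \<le> t" for s
    using weight_filt[OF \<beta> that(1)]
    by (rule measurable_cong[THEN iffD1, rotated]) (use that in \<open>auto simp: wt_def\<close>)
  have wt_eq: "wt s w = weight \<beta> s w" if "s \<le> t" "w \<in> space W" for s w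
    using that by (simp add: wt_def)
  define G where "G s w = wt s w * \<beta> (pos s w)" for s w
  have [measurable]: "(\<lambda>(s, w). G s w) \<in> borel_measurable (borel \<Otimes>\<^sub>M W)"
    unfolding G_def[abs_def] by measurable
  have Gb: "\<bar>G s w\<bar> \<le> D * b" for s w
    unfolding G_def by (intro abs_mult_le wtb \<beta>b)
  have G_filt: "G s \<in> borel_measurable (filt s)" if "0 \<le> s" "s \<le> t" for s
  proof -
    note [measurable] = wt_filt[OF that] pos_filt[OF that(1) order_refl]
    show ?thesis unfolding G_def[abs_def] by measurable
  qed
  have G_int: "(LINT r:{0..s}|lborel. G r w) = wt s w - 1" if "0 \<le> s" "s \<le> t" "w \<in> space W" for s w
  proof -
    have "(LINT r:{0..s}|lborel. G r w) = (LINT r:{0..s}|lborel. weight \<beta> r w * \<beta> (pos r w))"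
      by (intro set_lebesgue_integral_cong) (use that in \<open>auto simp: G_def wt_eq\<close>)
    then show ?thesis using weight_identity[OF \<beta> \<beta>b that(1,3)] that by (simp add: wt_eq)
  qed
  define F where "F w = alive t w * f (pos t w)" for w
  have [measurable]: "F \<in> borel_measurable W" unfolding F_def[abs_def] by measurable
  have Fb: "\<bar>F w\<bar> \<le> 1 * C" for w unfolding F_def by (intro abs_mult_le ab fb)
  define K where "K q w = alive q w * k (t - q) (pos q w)" for q w
  have [measurable]: "(\<lambda>(s, w). K s w) \<in> borel_measurable (borel \<Otimes>\<^sub>M W)"
    unfolding K_def[abs_def] by measurable
  have Kb: "\<bar>K q w\<bar> \<le> 1 * C" for q w unfolding K_def by (intro abs_mult_le ab kb)
  define U where "U s w = alive s w * u (t - s) (pos s w)" for s w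
  have [measurable]: "(\<lambda>(s, w). U s w) \<in> borel_measurable (borel \<Otimes>\<^sub>M W)"
    unfolding U_def[abs_def] by measurable
  have Ub: "\<bar>U q w\<bar> \<le> 1 * C" for q w unfolding U_def by (intro abs_mult_le ab ub)
  have M: "(LINT w|Pr x. Z w * F w) = (LINT w|Pr x. Z w * U s w) - (LINT q:{s..t}|lborel. (LINT w|Pr x. Z w * K q w))"
    if "0 \<le> s" "s \<le> t" "Z \<in> borel_measurable (filt s)" "\<And>w. \<bar>Z w\<bar> \<le> B" for s Z B
    unfolding F_def U_def K_def by (rule markov_along_solution[OF that(1,2) f fb u ub k kb eqn that(3,4)])
  have start_val: "(LINT w|Pr x. F w) = u t x - (LINT q:{0..t}|lborel. (LINT w|Pr x. K q w))"
  proof -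
    have "AE w in Pr x. U 0 w = u t x"
      using start[of x] by (auto simp: U_def alive_def pos_def)
    then have "(LINT w|Pr x. U 0 w) = (LINT w|Pr x. u t x)"
      by (intro integral_cong_AE) auto
    then show ?thesis using M[of 0 "\<lambda>_. 1" 1] t by (simp add: prob_space)
  qed
  define I where "I s q = (LINT w|Pr x. G s w * K q w)" for s q
  have Ib: "\<bar>I s q\<bar> \<le> D * b * (1 * C)" for s q
    unfolding I_def by (rule law_integral_bound(1)) (measurable, intro abs_mult_le Gb Kb)
  have Im[measurable]: "(\<lambda>(s, q). I s q) \<in> borel_measurable (borel \<Otimes>\<^sub>M borel)"
  proof -
    have "(\<lambda>z. LINT w|Pr x. G (fst z) w * K (snd z) w) \<in> borel_measurable ((borel :: real measure) \<Otimes>\<^sub>M (borel :: real measure))"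
      by (rule integral_kernel_measurable[where N=W]) (use measurable_space[OF motion_law_subprob, of x] in auto)
    then show ?thesis by (simp add: I_def split_beta')
  qed
  have I_upto: "(LINT s:{0..q}|lborel. I s q) = (LINT w|Pr x. (wt q w - 1) * K q w)" if q: "q \<in> {0..t}" for q
  proof -
    have "(LINT s:{0..q}|lborel. I s q) = (LINT w|Pr x. (LINT s:{0..q}|lborel. G s w * K q w))"
      unfolding I_def
      by (rule Fubini_interval[symmetric, where C="D * b * (1 * C)", OF motion_finite]) (measurable, intro abs_mult_le Gb Kb)
    also have "\<dots> = (LINT w|Pr x. (wt q w - 1) * K q w)"
      using q by (intro Bochner_Integration.integral_cong) (auto simp: G_int motion_space)
    finally show ?thesis .
  qed
  define A where "A s = (LINT w|Pr x. G s w * U s w)" for s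
  have Am[measurable]: "A \<in> borel_measurable borel"
    unfolding A_def[abs_def] by (rule law_integral_measurable) measurable
  have Ab: "\<bar>A s\<bar> \<le> D * b * (1 * C)" for s
    unfolding A_def by (rule law_integral_bound(1)) (measurable, intro abs_mult_le Gb Ub)
  define J where "J s = (LINT q:{0..t}|lborel. (if s \<le> q then I s q else 0))" for s
  have Jm[measurable]: "J \<in> borel_measurable borel"
    unfolding J_def[abs_def] set_lebesgue_integral_def by measurable
  have Ib': "\<bar>if s \<le> q then I s q else 0\<bar> \<le> D * b * (1 * C)" for s q
    using Ib[of s q] by auto
  have "\<bar>J s\<bar> \<le> D * b * (1 * C) * (t - 0)" for s
    unfolding J_def using t by (intro abs_set_integral_le Ib') auto
  then have Jint: "set_integrable lborel {0..t} J"
    by (intro integrable_interval_bounded) auto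
  have "(LINT w|Pr x. (wt t w - 1) * F w) = (LINT w|Pr x. (LINT s:{0..t}|lborel. G s w * F w))"
    using t by (intro Bochner_Integration.integral_cong) (auto simp: G_int motion_space)
  also have "\<dots> = (LINT s:{0..t}|lborel. (LINT w|Pr x. G s w * F w))"
    by (rule Fubini_interval[where C="D * b * (1 * C)", OF motion_finite]) (measurable, intro abs_mult_le Gb Fb)
  also have "\<dots> = (LINT s:{0..t}|lborel. A s - J s)"
  proof (intro set_lebesgue_integral_cong allI impI)
    fix s assume "s \<in> {0..t}"
    then have s: "0 \<le> s" "s \<le> t" by auto
    have "J s = (LINT q:{s..t}|lborel. I s q)"
      unfolding J_def set_lebesgue_integral_def using s
      by (intro Bochner_Integration.integral_cong) (auto simp: indicator_def)
    then show "(LINT w|Pr x. G s w * F w) = A s - J s"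
      using M[OF s G_filt[OF s] Gb] by (simp add: A_def I_def)
  qed simp
  also have "\<dots> = (LINT s:{0..t}|lborel. A s) - (LINT s:{0..t}|lborel. J s)"
    by (rule set_integral_diff(2)[OF integrable_interval_bounded[OF Am Ab] Jint])
  also have "(LINT s:{0..t}|lborel. J s) = (LINT q:{0..t}|lborel. (LINT s:{0..t}|lborel. (if s \<le> q then I s q else 0)))"
    unfolding J_def by (rule Fubini_intervals[symmetric, OF _ Ib']) measurable
  also have "\<dots> = (LINT q:{0..t}|lborel. (LINT w|Pr x. (wt q w - 1) * K q w))"
  proof (intro set_lebesgue_integral_cong allI impI)
    fix q assume q: "q \<in> {0..t}"
    have "(LINT s:{0..t}|lborel. (if s \<le> q then I s q else 0)) = (LINT s:{0..q}|lborel. I s q)"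
      unfolding set_lebesgue_integral_def using q
      by (intro Bochner_Integration.integral_cong) (auto simp: indicator_def)
    then show "(LINT s:{0..t}|lborel. (if s \<le> q then I s q else 0)) = (LINT w|Pr x. (wt q w - 1) * K q w)"
      using I_upto[OF q] by simp
  qed simp
  finally have part: "(LINT w|Pr x. (wt t w - 1) * F w) =
     (LINT s:{0..t}|lborel. A s) - (LINT q:{0..t}|lborel. (LINT w|Pr x. (wt q w - 1) * K q w))" .
  have intZ: "integrable (Pr x) (\<lambda>w. wt q w * K r w)" "integrable (Pr x) (K r)" "integrable (Pr x) (\<lambda>w. wt q w * F w)"
    "integrable (Pr x) F" "integrable (Pr x) (\<lambda>w. G q w * U q w)" for q r
    by (rule law_integral_bound(2)[OF _ abs_mult_le[OF wtb Kb]], measurable)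
       (rule law_integral_bound(2)[OF _ Kb], measurable,
        rule law_integral_bound(2)[OF _ abs_mult_le[OF wtb Fb]], measurable,
        rule law_integral_bound(2)[OF _ Fb], measurable,
        rule law_integral_bound(2)[OF _ abs_mult_le[OF Gb Ub]], measurable)
  have Km: "(\<lambda>q. LINT w|Pr x. K q w) \<in> borel_measurable borel"
    "(\<lambda>q. LINT w|Pr x. wt q w * K q w) \<in> borel_measurable borel"
    by (rule law_integral_measurable, measurable)+
  have Kint: "set_integrable lborel {0..t} (\<lambda>q. LINT w|Pr x. K q w)"
    "set_integrable lborel {0..t} (\<lambda>q. LINT w|Pr x. wt q w * K q w)"
  proof -
    show "set_integrable lborel {0..t} (\<lambda>q. LINT w|Pr x. K q w)"
      by (rule integrable_interval_bounded[OF Km(1)]) (rule law_integral_bound(1)[OF _ Kb], measurable)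
    show "set_integrable lborel {0..t} (\<lambda>q. LINT w|Pr x. wt q w * K q w)"
      by (rule integrable_interval_bounded[OF Km(2)], rule law_integral_bound(1)[OF _ abs_mult_le[OF wtb Kb]], measurable)
  qed
  have "(LINT w|Pr x. weight \<beta> t w * (alive t w * f (pos t w))) = (LINT w|Pr x. wt t w * F w)"
    by (intro Bochner_Integration.integral_cong) (simp_all add: F_def wt_eq motion_space)
  also have "\<dots> = (LINT w|Pr x. F w + (wt t w - 1) * F w)" by (simp add: algebra_simps)
  also have "\<dots> = (LINT w|Pr x. F w) + (LINT w|Pr x. (wt t w - 1) * F w)"
    using intZ by (intro Bochner_Integration.integral_add) (auto simp: left_diff_distrib)
  also have "\<dots> = u t x + ((LINT s:{0..t}|lborel. A s) - ((LINT q:{0..t}|lborel. (LINT w|Pr x. K q w)) +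
      (LINT q:{0..t}|lborel. (LINT w|Pr x. (wt q w - 1) * K q w))))"
    unfolding part start_val by simp
  also have "(LINT q:{0..t}|lborel. (LINT w|Pr x. (wt q w - 1) * K q w)) =
      (LINT q:{0..t}|lborel. (LINT w|Pr x. wt q w * K q w) - (LINT w|Pr x. K q w))"
    using intZ by (simp add: left_diff_distrib)
  also have "\<dots> = (LINT q:{0..t}|lborel. (LINT w|Pr x. wt q w * K q w)) - (LINT q:{0..t}|lborel. (LINT w|Pr x. K q w))"
    by (rule set_integral_diff(2)[OF Kint(2,1)])
  also have "u t x + ((LINT s:{0..t}|lborel. A s) - ((LINT q:{0..t}|lborel. (LINT w|Pr x. K q w)) +
      ((LINT q:{0..t}|lborel. (LINT w|Pr x. wt q w * K q w)) - (LINT q:{0..t}|lborel. (LINT w|Pr x. K q w))))) =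
      u t x + ((LINT s:{0..t}|lborel. A s) - (LINT q:{0..t}|lborel. (LINT w|Pr x. wt q w * K q w)))"
    by simp
  also have "(LINT s:{0..t}|lborel. A s) - (LINT q:{0..t}|lborel. (LINT w|Pr x. wt q w * K q w)) =
      (LINT s:{0..t}|lborel. A s - (LINT w|Pr x. wt s w * K s w))"
    by (rule set_integral_diff(2)[OF integrable_interval_bounded[OF Am Ab] Kint(2), symmetric])
  also have "\<dots> = (LINT s:{0..t}|lborel. (LINT w|Pr x. weight \<beta> s w * (alive s w *
        (\<beta> (pos s w) * u (t - s) (pos s w) - k (t - s) (pos s w)))))"
  proof (intro set_lebesgue_integral_cong allI impI)
    fix s assume s: "s \<in> {0..t}"
    have "A s - (LINT w|Pr x. wt s w * K s w) = (LINT w|Pr x. G s w * U s w - wt s w * K s w)"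
      unfolding A_def using intZ by simp
    also have "\<dots> = (LINT w|Pr x. weight \<beta> s w * (alive s w *
        (\<beta> (pos s w) * u (t - s) (pos s w) - k (t - s) (pos s w))))"
      using s by (intro Bochner_Integration.integral_cong)
        (simp_all add: G_def U_def K_def wt_eq motion_space algebra_simps)
    finally show "A s - (LINT w|Pr x. wt s w * K s w) = (LINT w|Pr x. weight \<beta> s w * (alive s w *
        (\<beta> (pos s w) * u (t - s) (pos s w) - k (t - s) (pos s w))))" .
  qed simp
  finally show ?thesis .
qed


lemma mean_semigroup_eq:
  assumes t: "0 \<le> t" and [measurable]: "\<beta> \<in> borel_measurable borel"
  shows "mean_semigroup \<beta> \<xi> Pr t f x = (\<integral>\<^sup>+ w. ennreal (weight \<beta> t w * alive t w) * f (pos t w) \<partial>Pr x)"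
  unfolding mean_semigroup_def
proof (rule nn_integral_cong)
  fix w
  have "(LINT s:{0..t}|lborel. \<beta> (the (\<xi> s w))) = (LINT s:{0..t}|lborel. \<beta> (pos s w))"
    by (intro set_lebesgue_integral_cong) (auto simp: pos_def)
  then show "(case \<xi> t w of None \<Rightarrow> 0
        | Some y \<Rightarrow> ennreal (exp (LINT s:{0..t}|lborel. \<beta> (the (\<xi> s w)))) * f y) =
        ennreal (weight \<beta> t w * alive t w) * f (pos t w)"
    using t by (auto simp: weight_def alive_def pos_def split: option.split)
qed

text \<open>The Feynman-Kac semigroup with rate \<open>\<beta>\<close> as a real-valued integral; it agrees with
  \<^const>\<open>mean_semigroup\<close> on bounded non-negative functions.\<close>

definition mean_integral :: "('e \<Rightarrow> real) \<Rightarrow> real \<Rightarrow> ('e \<Rightarrow> real) \<Rightarrow> 'e \<Rightarrow> real" where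
  "mean_integral \<beta> t f x = (LINT w|Pr x. weight \<beta> t w * (alive t w * f (pos t w)))"

lemma weight_alive_bound:
  assumes "\<beta> \<in> borel_measurable borel" "\<And>y. \<bar>\<beta> y\<bar> \<le> b" "0 \<le> t" "\<And>y. \<bar>f y\<bar> \<le> C" "w \<in> space W"
  shows "\<bar>weight \<beta> t w * (alive t w * f (pos t w))\<bar> \<le> exp (b * t) * (1 * C)"
  using weight_bounds(1)[OF assms(1,2) order_refl assms(3,5)] weight_pos[of \<beta> t w] alive_bounds[of t w] assms(4)
  by (intro abs_mult_le) auto

lemma mean_semigroup_real:
  assumes t: "0 \<le> t" and \<beta>[measurable]: "\<beta> \<in> borel_measurable borel" and \<beta>b: "\<And>y. \<bar>\<beta> y\<bar> \<le> b"
    and f[measurable]: "f \<in> borel_measurable borel" and fn: "\<And>y. 0 \<le> f y" and fb: "\<And>y. \<bar>f y\<bar> \<le> C"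
  shows "mean_semigroup \<beta> \<xi> Pr t (\<lambda>y. ennreal (f y)) x = ennreal (mean_integral \<beta> t f x)"
proof -
  have int: "integrable (Pr x) (\<lambda>w. weight \<beta> t w * (alive t w * f (pos t w)))"
    by (rule law_integral_bound(2)[OF _ weight_alive_bound[OF \<beta> \<beta>b t fb]]) measurable
  have "mean_semigroup \<beta> \<xi> Pr t (\<lambda>y. ennreal (f y)) x =
      (\<integral>\<^sup>+ w. ennreal (weight \<beta> t w * (alive t w * f (pos t w))) \<partial>Pr x)"
    unfolding mean_semigroup_eq[OF t \<beta>]
    by (intro nn_integral_cong) (simp add: fn alive_bounds weight_pos less_imp_le mult.assoc flip: ennreal_mult)
  also have "\<dots> = ennreal (mean_integral \<beta> t f x)"
    unfolding mean_integral_def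
    by (rule nn_integral_eq_integral[OF int]) (simp add: fn alive_bounds weight_pos less_imp_le)
  finally show ?thesis .
qed

lemma mean_integral_diff:
  assumes t: "0 \<le> t" and \<beta>[measurable]: "\<beta> \<in> borel_measurable borel" and \<beta>b: "\<And>y. \<bar>\<beta> y\<bar> \<le> b"
    and [measurable]: "f \<in> borel_measurable borel" "g \<in> borel_measurable borel"
    and fb: "\<And>y. \<bar>f y\<bar> \<le> C" and gb: "\<And>y. \<bar>g y\<bar> \<le> D"
  shows "mean_integral \<beta> t (\<lambda>y. f y - g y) x = mean_integral \<beta> t f x - mean_integral \<beta> t g x"
proof -
  have "mean_integral \<beta> t (\<lambda>y. f y - g y) x =
     (LINT w|Pr x. weight \<beta> t w * (alive t w * f (pos t w)) - weight \<beta> t w * (alive t w * g (pos t w)))"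
    by (simp add: mean_integral_def algebra_simps)
  also have "\<dots> = mean_integral \<beta> t f x - mean_integral \<beta> t g x"
    unfolding mean_integral_def
    by (intro Bochner_Integration.integral_diff law_integral_bound(2)[OF _ weight_alive_bound[OF \<beta> \<beta>b t fb]]
          law_integral_bound(2)[OF _ weight_alive_bound[OF \<beta> \<beta>b t gb]]) measurable
  finally show ?thesis .
qed

lemma mean_integral_cmult: "mean_integral \<beta> t (\<lambda>y. c * f y) x = c * mean_integral \<beta> t f x"
proof -
  have "mean_integral \<beta> t (\<lambda>y. c * f y) x = (LINT w|Pr x. c * (weight \<beta> t w * (alive t w * f (pos t w))))"
    by (simp add: mean_integral_def algebra_simps)
  then show ?thesis by (simp add: mean_integral_def)
qed

text \<open>Comparison with the mean semigroup: signs of \<open>\<beta> u - k\<close> in the perturbation formula.\<close>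

lemma compare_mean:
  fixes u k :: "real \<Rightarrow> 'e \<Rightarrow> real"
  assumes t: "0 \<le> t"
    and \<beta>[measurable]: "\<beta> \<in> borel_measurable borel" and \<beta>b: "\<And>y. \<bar>\<beta> y\<bar> \<le> b"
    and f[measurable]: "f \<in> borel_measurable borel" and fb: "\<And>y. \<bar>f y\<bar> \<le> C"
    and u[measurable]: "(\<lambda>(s, y). u s y) \<in> borel_measurable (borel \<Otimes>\<^sub>M borel)" and ub: "\<And>s y. \<bar>u s y\<bar> \<le> C"
    and k[measurable]: "(\<lambda>(s, y). k s y) \<in> borel_measurable (borel \<Otimes>\<^sub>M borel)" and kb: "\<And>s y. \<bar>k s y\<bar> \<le> C"
    and eqn: "\<And>q y. 0 \<le> q \<Longrightarrow> q \<le> t \<Longrightarrow>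
        u q y = (LINT z|P q y. f z) + (LINT r:{0..q}|lborel. (LINT z|P r y. k (q - r) z))"
  shows "(\<And>s y. k s y \<le> \<beta> y * u s y) \<Longrightarrow> u t x \<le> mean_integral \<beta> t f x"
    and "(\<And>s y. \<beta> y * u s y \<le> k s y) \<Longrightarrow> mean_integral \<beta> t f x \<le> u t x"
proof -
  define R where "R s w = weight \<beta> s w * (alive s w * (\<beta> (pos s w) * u (t - s) (pos s w) - k (t - s) (pos s w)))" for s w
  have eq: "mean_integral \<beta> t f x = u t x + (LINT s:{0..t}|lborel. (LINT w|Pr x. R s w))"
    unfolding mean_integral_def R_def by (rule perturbation_formula[OF t \<beta> \<beta>b f fb u ub k kb eqn])
  show "u t x \<le> mean_integral \<beta> t f x" if "\<And>s y. k s y \<le> \<beta> y * u s y"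
  proof -
    have "0 \<le> (LINT s:{0..t}|lborel. (LINT w|Pr x. R s w))"
      unfolding set_lebesgue_integral_def R_def
      by (intro Bochner_Integration.integral_nonneg scaleR_nonneg_nonneg mult_nonneg_nonneg)
         (auto simp: that alive_bounds weight_pos less_imp_le)
    then show ?thesis using eq by simp
  qed
  show "mean_integral \<beta> t f x \<le> u t x" if "\<And>s y. \<beta> y * u s y \<le> k s y"
  proof -
    have "0 \<le> (LINT s:{0..t}|lborel. (LINT w|Pr x. - R s w))"
      unfolding set_lebesgue_integral_def R_def mult_minus_right[symmetric] minus_diff_eq
      by (intro Bochner_Integration.integral_nonneg scaleR_nonneg_nonneg mult_nonneg_nonneg)
         (auto simp: that alive_bounds weight_pos less_imp_le)
    then show ?thesis using eq by (simp add: set_lebesgue_integral_def)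
  qed
qed

end

section \<open>The branching mechanism\<close>

text \<open>Measurability in the parameter for a family of measures that need not be finite.\<close>

lemma nn_integral_measurable_of_emeasure:
  fixes K :: "'a \<Rightarrow> 'b measure" and f :: "'b \<Rightarrow> ennreal"
  assumes K: "\<And>x. x \<in> space M \<Longrightarrow> sets (K x) = sets N"
    and emeas: "\<And>B. B \<in> sets N \<Longrightarrow> (\<lambda>x. emeasure (K x) B) \<in> borel_measurable M"
    and f: "f \<in> borel_measurable N"
  shows "(\<lambda>x. \<integral>\<^sup>+ u. f u \<partial>K x) \<in> borel_measurable M"
  using f
proof (induction rule: borel_measurable_induct)
  case (cong f g)
  have "(\<integral>\<^sup>+ u. f u \<partial>K x) = (\<integral>\<^sup>+ u. g u \<partial>K x)" if "x \<in> space M" for x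
    by (rule nn_integral_cong) (simp add: cong(3) sets_eq_imp_space_eq[OF K[OF that]])
  then show ?case by (rule measurable_cong[THEN iffD2, OF _ cong(4)])
next
  case (set A)
  have "(\<integral>\<^sup>+ u. indicator A u \<partial>K x) = emeasure (K x) A" if "x \<in> space M" for x
    using set K[OF that] by simp
  then show ?case by (rule measurable_cong[THEN iffD2, OF _ emeas[OF set]])
next
  case (mult u c)
  have "(\<integral>\<^sup>+ v. c * u v \<partial>K x) = c * (\<integral>\<^sup>+ v. u v \<partial>K x)" if "x \<in> space M" for x
    by (rule nn_integral_cmult) (simp add: measurable_cong_sets[OF K[OF that] refl] mult.hyps)
  moreover have "(\<lambda>x. c * (\<integral>\<^sup>+ v. u v \<partial>K x)) \<in> borel_measurable M"
    using borel_measurable_times_ennreal[OF borel_measurable_const mult.IH] .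
  ultimately show ?case by (rule measurable_cong[THEN iffD2])
next
  case (add u v)
  have "(\<integral>\<^sup>+ r. v r + u r \<partial>K x) = (\<integral>\<^sup>+ r. v r \<partial>K x) + (\<integral>\<^sup>+ r. u r \<partial>K x)" if "x \<in> space M" for x
    by (rule nn_integral_add) (simp_all add: measurable_cong_sets[OF K[OF that] refl] add.hyps)
  moreover have "(\<lambda>x. (\<integral>\<^sup>+ r. v r \<partial>K x) + (\<integral>\<^sup>+ r. u r \<partial>K x)) \<in> borel_measurable M"
    by (intro borel_measurable_add add.IH)
  ultimately show ?case by (rule measurable_cong[THEN iffD2])
next
  case (seq U)
  have "(\<integral>\<^sup>+ v. (SUP i. U i) v \<partial>K x) = (SUP i. \<integral>\<^sup>+ v. U i v \<partial>K x)" if "x \<in> space M" for x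
    unfolding SUP_apply
    by (intro nn_integral_monotone_convergence_SUP seq.hyps)
       (simp add: measurable_cong_sets[OF K[OF that] refl] seq.hyps)
  moreover have "(\<lambda>x. SUP i. \<integral>\<^sup>+ v. U i v \<partial>K x) \<in> borel_measurable M"
    by (intro borel_measurable_SUP seq.IH) simp
  ultimately show ?case by (rule measurable_cong[THEN iffD2])
qed

lemma exp_remainder_bounds:
  fixes v :: real assumes "0 \<le> v"
  shows "0 \<le> exp (- v) - 1 + v" "exp (- v) - 1 + v \<le> v" "exp (- v) - 1 + v \<le> v\<^sup>2"
proof -
  show "0 \<le> exp (- v) - 1 + v" using exp_ge_add_one_self[of "- v"] by linarith
  show "exp (- v) - 1 + v \<le> v" using assms by simp
  have "(1 + v) * (1 - v + v\<^sup>2) = 1 + v ^ 3" by (simp add: power2_eq_square power3_eq_cube algebra_simps)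
  then have "1 \<le> (1 + v) * (1 - v + v\<^sup>2)" using assms by simp
  moreover have "exp (- v) * (1 + v) \<le> 1"
    using mult_left_mono[OF exp_ge_add_one_self[of v], of "exp (- v)"] by (simp flip: exp_add)
  ultimately have "(1 + v) * exp (- v) \<le> (1 + v) * (1 - v + v\<^sup>2)" by (simp add: mult.commute)
  then have "exp (- v) \<le> 1 - v + v\<^sup>2" using assms by simp
  then show "exp (- v) - 1 + v \<le> v\<^sup>2" by simp
qed

text \<open>The parameters of a branching mechanism.\<close>

locale branching =
  fixes \<beta> \<sigma> :: "'e::polish_space \<Rightarrow> real" and \<pi> :: "'e \<Rightarrow> real measure"
  assumes beta: "bounded_borel \<beta>" and sigma: "bounded_borel \<sigma>" and levy: "levy_kernel \<pi>"
begin

text \<open>The branching mechanism without its linear part.\<close>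

definition nonlinear :: "'e \<Rightarrow> real \<Rightarrow> real" where
  "nonlinear x z = (\<sigma> x)\<^sup>2 * z\<^sup>2 + (LINT u|\<pi> x. exp (- z * u) - 1 + z * u)"

lemma branching_mechanism_eq: "branching_mechanism \<beta> \<sigma> \<pi> x z = - \<beta> x * z + nonlinear x z"
  by (simp add: branching_mechanism_def nonlinear_def)

lemma \<beta>_borel [measurable]: "\<beta> \<in> borel_measurable borel"
  and \<sigma>_borel [measurable]: "\<sigma> \<in> borel_measurable borel"
  using beta sigma by (auto simp: bounded_borel_def)

lemma \<beta>_bound: "\<exists>b\<ge>0. \<forall>y. \<bar>\<beta> y\<bar> \<le> b"
  using beta unfolding bounded_borel_def bounded_iff
  by (metis abs_ge_zero order_trans rangeI real_norm_def)

lemma \<sigma>_bound: "\<exists>b\<ge>0. \<forall>y. \<bar>\<sigma> y\<bar> \<le> b"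
  using sigma unfolding bounded_borel_def bounded_iff
  by (metis abs_ge_zero order_trans rangeI real_norm_def)

abbreviation positive_reals :: "real measure" where
  "positive_reals \<equiv> restrict_space borel {0<..}"

lemma levy_sets [measurable_cong]: "sets (\<pi> x) = sets positive_reals"
  and levy_emeasure: "B \<in> sets positive_reals \<Longrightarrow> (\<lambda>x. emeasure (\<pi> x) B) \<in> borel_measurable borel"
  using levy by (auto simp: levy_kernel_def)

lemma positive_reals_measurable:
  fixes f :: "real \<Rightarrow> 'b::topological_space"
  shows "f \<in> borel_measurable borel \<Longrightarrow> f \<in> borel_measurable positive_reals"
  by (rule measurable_restrict_space1)

lemma levy_measurable:
  fixes f :: "real \<Rightarrow> 'b::topological_space"
  shows "f \<in> borel_measurable borel \<Longrightarrow> f \<in> borel_measurable (\<pi> x)"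
  unfolding measurable_cong_sets[OF levy_sets refl] by (rule positive_reals_measurable)

lemma levy_space: "space (\<pi> x) = {0<..}"
  using sets_eq_imp_space_eq[OF levy_sets[of x]] by (simp add: space_restrict_space)

lemma levy_mass: "\<exists>M>0. \<forall>x. (\<integral>\<^sup>+ u. ennreal (min u (u\<^sup>2)) \<partial>\<pi> x) \<le> ennreal M"
proof -
  define S where "S = (SUP x. \<integral>\<^sup>+ u. ennreal (min u (u\<^sup>2)) \<partial>\<pi> x)"
  have "S < \<infinity>" using levy by (simp add: levy_kernel_def S_def)
  then have S: "S = ennreal (enn2real S)" by simp
  have "(\<integral>\<^sup>+ u. ennreal (min u (u\<^sup>2)) \<partial>\<pi> x) \<le> ennreal (enn2real S + 1)" for x
  proof -
    have "(\<integral>\<^sup>+ u. ennreal (min u (u\<^sup>2)) \<partial>\<pi> x) \<le> S" unfolding S_def by (rule SUP_upper) simp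
    also have "\<dots> \<le> ennreal (enn2real S + 1)" by (subst S) (rule ennreal_leI, simp)
    finally show ?thesis .
  qed
  moreover have "0 < enn2real S + 1" by (simp add: add_nonneg_pos)
  ultimately show ?thesis by blast
qed

lemma levy_nn_integral_measurable:
  fixes f :: "real \<Rightarrow> ennreal"
  assumes "f \<in> borel_measurable positive_reals"
  shows "(\<lambda>x. \<integral>\<^sup>+ u. f u \<partial>\<pi> x) \<in> borel_measurable borel"
  by (rule nn_integral_measurable_of_emeasure[OF levy_sets levy_emeasure assms])

lemma levy_integral_eq:
  assumes "0 \<le> z"
  shows "(LINT u|\<pi> x. exp (- z * u) - 1 + z * u) = enn2real (\<integral>\<^sup>+ u. ennreal (exp (- z * u) - 1 + z * u) \<partial>\<pi> x)"
proof (rule integral_eq_nn_integral)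
  show "(\<lambda>u. exp (- z * u) - 1 + z * u) \<in> borel_measurable (\<pi> x)"
    by (rule levy_measurable) measurable
  show "AE u in \<pi> x. 0 \<le> exp (- z * u) - 1 + z * u"
  proof (rule AE_I2)
    fix u assume "u \<in> space (\<pi> x)"
    then show "0 \<le> exp (- z * u) - 1 + z * u"
      using exp_remainder_bounds(1)[of "z * u"] assms by (simp add: levy_space)
  qed
qed

text \<open>Although \<open>\<pi>(x,\<cdot>)\<close> may be infinite, \<open>(u \<and> u\<^sup>2) \<pi>(x,du)\<close> is a bounded kernel, and this gives
  measurability in the pair \<open>(x,z)\<close>.\<close>

lemma nonlinear_measurable:
  "(\<lambda>(x, z). nonlinear x (max 0 z)) \<in> borel_measurable (borel \<Otimes>\<^sub>M borel)"
proof -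
  obtain M where M: "0 < M" "\<And>x. (\<integral>\<^sup>+ u. ennreal (min u (u\<^sup>2)) \<partial>\<pi> x) \<le> ennreal M"
    using levy_mass by blast
  \<comment> \<open>Division by \<open>M\<close> turns the finite kernel into a sub-probability kernel.\<close>
  define m where "m u = min u (u\<^sup>2) / M" for u :: real
  have [measurable]: "m \<in> borel_measurable borel" unfolding m_def[abs_def] by measurable
  have [measurable]: "m \<in> borel_measurable positive_reals"
    by (rule positive_reals_measurable) measurable
  have m_pos: "0 < m u" if "0 < u" for u using that M by (simp add: m_def)
  define \<kappa> where "\<kappa> x = density (\<pi> x) (\<lambda>u. ennreal (m u))" for x
  have mass: "(\<integral>\<^sup>+ u. ennreal (m u) \<partial>\<pi> x) \<le> 1" for x
  proof -
    have "(\<integral>\<^sup>+ u. ennreal (m u) \<partial>\<pi> x) = (\<integral>\<^sup>+ u. ennreal (1 / M) * ennreal (min u (u\<^sup>2)) \<partial>\<pi> x)"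
      using M by (intro nn_integral_cong) (simp add: m_def levy_space flip: ennreal_mult)
    also have "\<dots> = ennreal (1 / M) * (\<integral>\<^sup>+ u. ennreal (min u (u\<^sup>2)) \<partial>\<pi> x)"
      by (rule nn_integral_cmult, rule levy_measurable) measurable
    also have "\<dots> \<le> ennreal (1 / M) * ennreal M" using M by (intro mult_left_mono) auto
    also have "\<dots> = 1" using M by (simp flip: ennreal_mult)
    finally show ?thesis .
  qed
  have \<kappa>[measurable]: "\<kappa> \<in> borel \<rightarrow>\<^sub>M subprob_algebra positive_reals"
  proof (rule measurable_subprob_algebra)
    fix x
    show "subprob_space (\<kappa> x)"
    proof (rule subprob_spaceI)
      have "emeasure (\<kappa> x) (space (\<kappa> x)) = (\<integral>\<^sup>+ u. ennreal (m u) \<partial>\<pi> x)"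
        unfolding \<kappa>_def by (subst emeasure_density) (auto intro!: nn_integral_cong)
      then show "emeasure (\<kappa> x) (space (\<kappa> x)) \<le> 1" using mass[of x] by simp
      show "space (\<kappa> x) \<noteq> {}" by (simp add: \<kappa>_def levy_space)
    qed
    show "sets (\<kappa> x) = sets positive_reals" by (simp add: \<kappa>_def levy_sets)
  next
    fix A assume A[measurable]: "A \<in> sets positive_reals"
    have "(\<lambda>x. emeasure (\<kappa> x) A) = (\<lambda>x. \<integral>\<^sup>+ u. ennreal (m u) * indicator A u \<partial>\<pi> x)"
      unfolding \<kappa>_def by (intro ext emeasure_density) measurable
    moreover have "(\<lambda>x. \<integral>\<^sup>+ u. ennreal (m u) * indicator A u \<partial>\<pi> x) \<in> borel_measurable borel"
      by (rule levy_nn_integral_measurable) measurable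
    ultimately show "(\<lambda>x. emeasure (\<kappa> x) A) \<in> borel_measurable borel" by simp
  qed
  have [measurable]: "snd \<in> borel_measurable ((borel :: real measure) \<Otimes>\<^sub>M positive_reals)"
    using measurable_compose[OF measurable_snd positive_reals_measurable[of "\<lambda>u. u"]] by simp
  define g where "g z u = (exp (- max 0 z * u) - 1 + max 0 z * u) / m u" for z u :: real
  have g_meas: "(\<lambda>z. ennreal (g (fst z) (snd z))) \<in> borel_measurable (borel \<Otimes>\<^sub>M positive_reals)"
    unfolding g_def m_def by measurable
  have "(\<lambda>z. \<integral>\<^sup>+ u. ennreal (g (snd z) u) \<partial>\<kappa> (fst z)) \<in> borel_measurable ((borel :: 'e measure) \<Otimes>\<^sub>M (borel :: real measure))"
  proof (rule nn_integral_measurable_subprob_algebra2[where N=positive_reals])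
    have "(\<lambda>x. (snd (fst x), snd x)) \<in> ((borel :: 'e measure) \<Otimes>\<^sub>M (borel :: real measure)) \<Otimes>\<^sub>M positive_reals
        \<rightarrow>\<^sub>M borel \<Otimes>\<^sub>M positive_reals"
      by (intro measurable_Pair measurable_snd measurable_compose[OF measurable_fst measurable_snd])
    from measurable_compose[OF this g_meas]
    show "(\<lambda>(z, u). ennreal (g (snd z) u)) \<in> borel_measurable (((borel :: 'e measure) \<Otimes>\<^sub>M (borel :: real measure)) \<Otimes>\<^sub>M positive_reals)"
      by (simp add: split_beta')
    show "(\<lambda>z. \<kappa> (fst z)) \<in> (borel :: 'e measure) \<Otimes>\<^sub>M (borel :: real measure) \<rightarrow>\<^sub>M subprob_algebra positive_reals"
      by (rule measurable_compose[OF measurable_fst \<kappa>])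
  qed
  moreover have "(\<lambda>z. (\<sigma> (fst z))\<^sup>2 * (max 0 (snd z))\<^sup>2) \<in> borel_measurable ((borel :: 'e measure) \<Otimes>\<^sub>M (borel :: real measure))"
    by measurable
  ultimately have "(\<lambda>z. (\<sigma> (fst z))\<^sup>2 * (max 0 (snd z))\<^sup>2 + enn2real (\<integral>\<^sup>+ u. ennreal (g (snd z) u) \<partial>\<kappa> (fst z)))
     \<in> borel_measurable ((borel :: 'e measure) \<Otimes>\<^sub>M (borel :: real measure))"
    by measurable
  moreover have "nonlinear x (max 0 z) = (\<sigma> x)\<^sup>2 * (max 0 z)\<^sup>2 + enn2real (\<integral>\<^sup>+ u. ennreal (g z u) \<partial>\<kappa> x)" for x z
  proof -
    have "(\<integral>\<^sup>+ u. ennreal (g z u) \<partial>\<kappa> x) = (\<integral>\<^sup>+ u. ennreal (m u) * ennreal (g z u) \<partial>\<pi> x)"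
      unfolding \<kappa>_def by (rule nn_integral_density; rule levy_measurable) (unfold g_def, measurable)
    also have "\<dots> = (\<integral>\<^sup>+ u. ennreal (exp (- max 0 z * u) - 1 + max 0 z * u) \<partial>\<pi> x)"
    proof (rule nn_integral_cong)
      fix u assume "u \<in> space (\<pi> x)"
      then have "0 < u" by (simp add: levy_space)
      from m_pos[OF this] show "ennreal (m u) * ennreal (g z u) = ennreal (exp (- max 0 z * u) - 1 + max 0 z * u)"
        by (simp add: g_def flip: ennreal_mult')
    qed
    finally have eq: "enn2real (\<integral>\<^sup>+ u. ennreal (g z u) \<partial>\<kappa> x) =
       enn2real (\<integral>\<^sup>+ u. ennreal (exp (- max 0 z * u) - 1 + max 0 z * u) \<partial>\<pi> x)" by simp
    show ?thesis by (simp only: nonlinear_def eq levy_integral_eq max.cobounded1)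
  qed
  ultimately show ?thesis by (simp add: split_beta')
qed

lemma nonlinear_nonneg:
  assumes "0 \<le> z"
  shows "0 \<le> nonlinear x z"
proof -
  have "0 \<le> (LINT u|\<pi> x. exp (- z * u) - 1 + z * u)"
    using levy_integral_eq[OF assms, of x] by simp
  then show ?thesis by (simp add: nonlinear_def)
qed

text \<open>Linear growth on bounded ranges of \<open>z\<close>, uniformly in \<open>x\<close>.\<close>

lemma nonlinear_bound: "\<exists>c\<ge>0. \<forall>x z. 0 \<le> z \<longrightarrow> z \<le> Z \<longrightarrow> nonlinear x z \<le> c * z"
proof -
  obtain M where M: "0 < M" "\<And>x. (\<integral>\<^sup>+ u. ennreal (min u (u\<^sup>2)) \<partial>\<pi> x) \<le> ennreal M"
    using levy_mass by blast
  obtain s where s: "0 \<le> s" "\<And>y. \<bar>\<sigma> y\<bar> \<le> s" using \<sigma>_bound by blast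
  define N where "N = max 1 Z"
  have N: "1 \<le> N" "Z \<le> N" by (auto simp: N_def)
  have "nonlinear x z \<le> (s\<^sup>2 * N + N * M) * z" if z: "0 \<le> z" "z \<le> Z" for x z
  proof -
    have zN: "z \<le> N" using z N by simp
    have "(\<sigma> x)\<^sup>2 \<le> s\<^sup>2" using s(2)[of x] by (metis abs_ge_zero power2_abs power_mono)
    moreover have "z * z \<le> N * z" using z zN by (intro mult_right_mono)
    ultimately have 1: "(\<sigma> x)\<^sup>2 * z\<^sup>2 \<le> s\<^sup>2 * (N * z)"
      using z by (intro mult_mono) (auto simp: power2_eq_square)
    have pt: "exp (- z * u) - 1 + z * u \<le> N * z * min u (u\<^sup>2)" if u: "0 < u" for u
    proof (cases "u \<le> 1")
      case True
      then have "u\<^sup>2 \<le> u" using u by (simp add: power2_eq_square mult_left_le)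
      have "exp (- (z * u)) - 1 + z * u \<le> (z * u)\<^sup>2" using u z by (intro exp_remainder_bounds) auto
      also have "\<dots> = (z * z) * u\<^sup>2" by (simp add: power2_eq_square)
      also have "\<dots> \<le> (N * z) * u\<^sup>2" using \<open>z * z \<le> N * z\<close> by (rule mult_right_mono) simp
      also have "u\<^sup>2 = min u (u\<^sup>2)" using \<open>u\<^sup>2 \<le> u\<close> by simp
      finally show ?thesis by simp
    next
      case False
      then have "u \<le> u\<^sup>2" by (simp add: power2_eq_square)
      have "exp (- (z * u)) - 1 + z * u \<le> 1 * (z * u)" using u z exp_remainder_bounds(2)[of "z * u"] by simp
      also have "\<dots> \<le> N * (z * u)" using u z N by (intro mult_right_mono) auto
      also have "N * (z * u) = N * z * min u (u\<^sup>2)" using \<open>u \<le> u\<^sup>2\<close> by simp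
      finally show ?thesis by simp
    qed
    have "(\<integral>\<^sup>+ u. ennreal (exp (- z * u) - 1 + z * u) \<partial>\<pi> x) \<le> (\<integral>\<^sup>+ u. ennreal (N * z) * ennreal (min u (u\<^sup>2)) \<partial>\<pi> x)"
      using pt N z by (intro nn_integral_mono) (auto simp: levy_space simp flip: ennreal_mult intro!: ennreal_leI)
    also have "\<dots> = ennreal (N * z) * (\<integral>\<^sup>+ u. ennreal (min u (u\<^sup>2)) \<partial>\<pi> x)"
      by (rule nn_integral_cmult, rule levy_measurable) measurable
    also have "\<dots> \<le> ennreal (N * z) * ennreal M" using M by (intro mult_left_mono) auto
    also have "\<dots> = ennreal (N * z * M)" using N z M by (simp flip: ennreal_mult)
    finally have "enn2real (\<integral>\<^sup>+ u. ennreal (exp (- z * u) - 1 + z * u) \<partial>\<pi> x) \<le> N * z * M"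
      using N z M by (intro enn2real_leI) auto
    moreover have "(LINT u|\<pi> x. exp (- z * u) - 1 + z * u) =
      enn2real (\<integral>\<^sup>+ u. ennreal (exp (- z * u) - 1 + z * u) \<partial>\<pi> x)"
      by (rule levy_integral_eq[OF z(1)])
    ultimately show ?thesis using 1 by (simp add: nonlinear_def algebra_simps)
  qed
  moreover have "0 \<le> s\<^sup>2 * N + N * M" using N M by simp
  ultimately show ?thesis by blast
qed

end

section \<open>Comparison of the cumulant semigroup with the mean semigroup\<close>

text \<open>A spatial motion, a branching mechanism and the solutions \<open>V t f\<close> of the cumulant equation.\<close>

locale cumulant_setting = spatial_motion P W \<xi> Pr + branching \<beta> \<sigma> \<pi>
  for P :: "real \<Rightarrow> 'e::polish_space \<Rightarrow> 'e measure" and W :: "'w measure"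
    and \<xi> :: "real \<Rightarrow> 'w \<Rightarrow> 'e option" and Pr :: "'e \<Rightarrow> 'w measure"
    and \<beta> \<sigma> :: "'e \<Rightarrow> real" and \<pi> :: "'e \<Rightarrow> real measure" +
  fixes V :: "real \<Rightarrow> ('e \<Rightarrow> real) \<Rightarrow> 'e \<Rightarrow> real"
  assumes cumulant: "\<And>f. bounded_borel f \<Longrightarrow> (\<And>x. 0 \<le> f x) \<Longrightarrow>
      cumulant_solution (branching_mechanism \<beta> \<sigma> \<pi>) P f (\<lambda>t. V t f)"
begin

lemma V_nonneg: "bounded_borel f \<Longrightarrow> (\<And>x. 0 \<le> f x) \<Longrightarrow> 0 \<le> t \<Longrightarrow> 0 \<le> V t f x"
  and V_locally_bounded: "bounded_borel f \<Longrightarrow> (\<And>x. 0 \<le> f x) \<Longrightarrow> 0 \<le> t \<Longrightarrow> \<exists>C. \<forall>s\<in>{0..t}. \<forall>x. V s f x \<le> C"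
  and V_equation: "bounded_borel f \<Longrightarrow> (\<And>x. 0 \<le> f x) \<Longrightarrow> 0 \<le> t \<Longrightarrow>
    V t f x + (LINT s:{0..t}|lborel. (LINT y|P s x. branching_mechanism \<beta> \<sigma> \<pi> y (V (t - s) f y))) = (LINT y|P t x. f y)"
  using cumulant[of f] unfolding cumulant_solution_def by blast+

lemma V_joint:
  assumes "bounded_borel f" "\<And>x. 0 \<le> f x"
  shows "(\<lambda>(t, x). V (max 0 t) f x) \<in> borel_measurable (borel \<Otimes>\<^sub>M borel)"
proof -
  have 1: "(\<lambda>(t, x). V t f x) \<in> borel_measurable (restrict_space borel ({0..} \<times> UNIV))"
    using cumulant[of f] assms unfolding cumulant_solution_def by blast
  have "(\<lambda>z. (max 0 (fst z), snd z)) \<in> (borel :: real measure) \<Otimes>\<^sub>M (borel :: 'e measure) \<rightarrow>\<^sub>M borel \<Otimes>\<^sub>M borel"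
    by measurable
  then have "(\<lambda>z. (max 0 (fst z), snd z)) \<in> (borel :: real measure) \<Otimes>\<^sub>M (borel :: 'e measure) \<rightarrow>\<^sub>M restrict_space borel ({0..} \<times> UNIV)"
    by (intro measurable_restrict_space2) (auto simp: borel_prod)
  from measurable_compose[OF this 1] show ?thesis by (simp add: split_beta')
qed

lemma V_bounded_borel:
  assumes "bounded_borel f" "\<And>x. 0 \<le> f x" "0 \<le> t"
  shows "bounded_borel (V t f)"
proof -
  have "(\<lambda>x. V (max 0 t) f x) \<in> borel_measurable borel"
    using measurable_compose[OF _ V_joint[OF assms(1,2)], of "\<lambda>x. (t, x)" borel] by simp
  moreover obtain C where "\<forall>s\<in>{0..t}. \<forall>x. V s f x \<le> C" using V_locally_bounded[OF assms] by blast
  then have "norm (V t f x) \<le> C" for x using V_nonneg[OF assms, of x] assms(3) by auto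
  ultimately show ?thesis
    using assms(3) unfolding bounded_borel_def bounded_iff by auto
qed

text \<open>Along a solution with values in \<open>[0,Z]\<close>, a pointwise bound of \<open>- \<psi>(y,z)\<close> by \<open>\<alpha>(y) z\<close> becomes a bound
  of \<open>V\<^sub>t f\<close> by the Feynman-Kac semigroup with rate \<open>\<alpha>\<close>.\<close>

lemma V_compare:
  assumes f: "bounded_borel f" "\<And>x. 0 \<le> f x" and t: "0 \<le> t"
    and \<alpha>[measurable]: "\<alpha> \<in> borel_measurable borel" and \<alpha>b: "\<And>y. \<bar>\<alpha> y\<bar> \<le> a"
    and Z: "\<And>s y. 0 \<le> s \<Longrightarrow> s \<le> t \<Longrightarrow> V s f y \<le> Z"
  shows "(\<And>y z. 0 \<le> z \<Longrightarrow> z \<le> Z \<Longrightarrow> \<beta> y * z - nonlinear y z \<le> \<alpha> y * z) \<Longrightarrow> V t f x \<le> mean_integral \<alpha> t f x"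
    and "(\<And>y z. 0 \<le> z \<Longrightarrow> z \<le> Z \<Longrightarrow> \<alpha> y * z \<le> \<beta> y * z - nonlinear y z) \<Longrightarrow> mean_integral \<alpha> t f x \<le> V t f x"
proof -
  have Z0: "0 \<le> Z" using order_trans[OF V_nonneg[OF f t] Z[OF t order_refl]] by simp
  obtain b where b: "0 \<le> b" "\<And>y. \<bar>\<beta> y\<bar> \<le> b" using \<beta>_bound by blast
  obtain c where c: "0 \<le> c" "\<And>x z. 0 \<le> z \<Longrightarrow> z \<le> Z \<Longrightarrow> nonlinear x z \<le> c * z"
    using nonlinear_bound[of Z] by blast
  obtain F where F: "\<And>x. \<bar>f x\<bar> \<le> F"
    using f(1) unfolding bounded_borel_def bounded_iff by auto
  have [measurable]: "f \<in> borel_measurable borel" using f(1) by (simp add: bounded_borel_def)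
  define u where "u s y = (if 0 \<le> s \<and> s \<le> t then V (max 0 s) f y else 0)" for s y
  define k where "k s y = \<beta> y * u s y - nonlinear y (max 0 (u s y))" for s y
  have u_range: "0 \<le> u s y" "u s y \<le> Z" for s y
    using V_nonneg[OF f] Z[of s y] Z0 by (auto simp: u_def)
  have um[measurable]: "(\<lambda>(s, y). u s y) \<in> borel_measurable (borel \<Otimes>\<^sub>M borel)"
    unfolding u_def[abs_def] using V_joint[OF f] by measurable
  have km: "(\<lambda>(s, y). k s y) \<in> borel_measurable (borel \<Otimes>\<^sub>M borel)"
  proof -
    have "(\<lambda>z. (snd z, u (fst z) (snd z))) \<in> borel \<Otimes>\<^sub>M borel \<rightarrow>\<^sub>M borel \<Otimes>\<^sub>M borel" by measurable
    note [measurable] = measurable_compose[OF this nonlinear_measurable, unfolded case_prod_conv]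
    have "(\<lambda>z. \<beta> (snd z) * u (fst z) (snd z) - nonlinear (snd z) (max 0 (u (fst z) (snd z)))) \<in> borel_measurable (borel \<Otimes>\<^sub>M borel)"
      by measurable
    then show ?thesis by (simp add: k_def split_beta')
  qed
  define C where "C = max F (max Z (b * Z + c * Z))"
  have kb: "\<bar>k s y\<bar> \<le> C" for s y
  proof -
    have "\<bar>\<beta> y * u s y\<bar> \<le> b * Z" using b u_range[of s y] by (intro abs_mult_le) auto
    moreover have "0 \<le> nonlinear y (u s y)" "nonlinear y (u s y) \<le> c * Z"
      using nonlinear_nonneg[OF u_range(1)] c(2)[OF u_range, of y s y] mult_left_mono[OF u_range(2) c(1), of s y]
      by auto
    ultimately show ?thesis using u_range[of s y] by (auto simp: k_def C_def)
  qed
  have ub: "\<bar>u s y\<bar> \<le> C" for s y using u_range[of s y] by (simp add: C_def)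
  have fb: "\<bar>f y\<bar> \<le> C" for y using F[of y] by (simp add: C_def)
  have eqn: "u q y = (LINT z|P q y. f z) + (LINT r:{0..q}|lborel. (LINT z|P r y. k (q - r) z))"
    if q: "0 \<le> q" "q \<le> t" for q y
  proof -
    have "(LINT r:{0..q}|lborel. (LINT z|P r y. k (q - r) z)) =
       (LINT r:{0..q}|lborel. - (LINT z|P r y. branching_mechanism \<beta> \<sigma> \<pi> z (V (q - r) f z)))"
    proof (intro set_lebesgue_integral_cong allI impI)
      fix r assume r: "r \<in> {0..q}"
      have "k (q - r) z = - branching_mechanism \<beta> \<sigma> \<pi> z (V (q - r) f z)" for z
        using r q u_range(1)[of "q - r" z] by (simp add: k_def u_def branching_mechanism_eq)
      then show "(LINT z|P r y. k (q - r) z) = - (LINT z|P r y. branching_mechanism \<beta> \<sigma> \<pi> z (V (q - r) f z))"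
        by simp
    qed simp
    also have "\<dots> = - (LINT r:{0..q}|lborel. (LINT z|P r y. branching_mechanism \<beta> \<sigma> \<pi> z (V (q - r) f z)))"
      by (simp add: set_lebesgue_integral_def)
    finally show ?thesis using V_equation[OF f q(1), of y] q by (simp add: u_def)
  qed
  have ut: "u t x = V t f x" using t by (simp add: u_def)
  have max_u: "max 0 (u s y) = u s y" for s y using u_range[of s y] by simp
  show "V t f x \<le> mean_integral \<alpha> t f x" if "\<And>y z. 0 \<le> z \<Longrightarrow> z \<le> Z \<Longrightarrow> \<beta> y * z - nonlinear y z \<le> \<alpha> y * z"
    unfolding ut[symmetric]
    by (rule compare_mean(1)[OF t \<alpha> \<alpha>b _ fb um ub km kb eqn]) (simp_all add: k_def max_u that u_range)
  show "mean_integral \<alpha> t f x \<le> V t f x" if "\<And>y z. 0 \<le> z \<Longrightarrow> z \<le> Z \<Longrightarrow> \<alpha> y * z \<le> \<beta> y * z - nonlinear y z"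
    unfolding ut[symmetric]
    by (rule compare_mean(2)[OF t \<alpha> \<alpha>b _ fb um ub km kb eqn]) (simp_all add: k_def max_u that u_range)
qed

lemma V_le_mean:
  assumes f: "bounded_borel f" "\<And>x. 0 \<le> f x" and t: "0 \<le> t"
  shows "V t f x \<le> mean_integral \<beta> t f x"
proof -
  obtain b where b: "\<And>y. \<bar>\<beta> y\<bar> \<le> b" using \<beta>_bound by blast
  obtain Z where "\<forall>s\<in>{0..t}. \<forall>x. V s f x \<le> Z" using V_locally_bounded[OF f t] by blast
  then show ?thesis
    by (intro V_compare(1)[OF f t \<beta>_borel b, of Z]) (auto simp: nonlinear_nonneg)
qed

text \<open>The converse of \<open>V_le_mean\<close> up to a constant: on \<open>[0, exp(bt)]\<close>, which contains the values of the
  solution, \<open>\<psi>(y,z) \<le> (b + c) z\<close>, so \<open>V\<close> dominates the semigroup of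
  the motion killed at the constant rate \<open>b + c\<close>.\<close>

lemma V_ge_mean:
  assumes t: "0 \<le> t"
  shows "\<exists>c>0. \<forall>f x. bounded_borel f \<longrightarrow> (\<forall>y. 0 \<le> f y \<and> f y \<le> 1) \<longrightarrow> c * mean_integral \<beta> t f x \<le> V t f x"
proof -
  obtain b where b: "0 \<le> b" "\<And>y. \<bar>\<beta> y\<bar> \<le> b" using \<beta>_bound by blast
  obtain c where c: "0 \<le> c" "\<And>x z. 0 \<le> z \<Longrightarrow> z \<le> exp (b * t) \<Longrightarrow> nonlinear x z \<le> c * z"
    using nonlinear_bound[of "exp (b * t)"] by blast
  define a where "a = b + c"
  have a: "\<bar>- a\<bar> \<le> a" using b c by (simp add: a_def)
  have "exp (- (a * t)) * exp (- (b * t)) * mean_integral \<beta> t f x \<le> V t f x"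
    if f: "bounded_borel f" and f01: "\<And>y. 0 \<le> f y \<and> f y \<le> 1" for f x
  proof -
    have [measurable]: "f \<in> borel_measurable borel" using f by (simp add: bounded_borel_def)
    have f0: "\<And>y. 0 \<le> f y" and f1: "\<And>y. \<bar>f y\<bar> \<le> 1" using f01 by auto
    have bd: "V s f y \<le> exp (b * t)" if s: "0 \<le> s" "s \<le> t" for s y
    proof -
      have "V s f y \<le> mean_integral \<beta> s f y" by (rule V_le_mean[OF f f0 s(1)])
      also have "\<dots> \<le> exp (b * s) * (1 * 1)"
        unfolding mean_integral_def
        by (rule abs_le_D1, rule law_integral_bound(1)[OF _ weight_alive_bound[OF \<beta>_borel b(2) s(1) f1]]) measurable
      also have "\<dots> \<le> exp (b * t)" using s b by (simp add: mult_left_mono)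
      finally show ?thesis .
    qed
    have "exp (- (a * t)) * exp (- (b * t)) * mean_integral \<beta> t f x \<le> mean_integral (\<lambda>_. - a) t f x"
      unfolding mean_integral_def integral_mult_right_zero[symmetric]
    proof (rule integral_mono)
      note [measurable_cong] = motion_sets
      show "integrable (Pr x) (\<lambda>w. exp (- (a * t)) * exp (- (b * t)) * (weight \<beta> t w * (alive t w * f (pos t w))))"
        by (intro integrable_mult_right law_integral_bound(2)[OF _ weight_alive_bound[OF \<beta>_borel b(2) t f1]]) measurable
      show "integrable (Pr x) (\<lambda>w. weight (\<lambda>_. - a) t w * (alive t w * f (pos t w)))"
        by (intro law_integral_bound(2)[OF _ weight_alive_bound[OF _ a t f1]]) measurable
      fix w assume "w \<in> space (Pr x)"
      then have w: "w \<in> space W" by (simp add: motion_space)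
      have "exp (- (a * t)) * (exp (- (b * t)) * weight \<beta> t w) \<le> exp (- (a * t)) * (exp (- (b * t)) * exp (b * t))"
        using weight_bounds(1)[OF \<beta>_borel b(2) order_refl t w] by (intro mult_left_mono) auto
      also have "\<dots> = exp (- (a * t))" by (simp flip: exp_add)
      also have "\<dots> \<le> weight (\<lambda>_. - a) t w"
        using weight_bounds(2)[OF _ a order_refl t w] by simp
      finally have "exp (- (a * t)) * (exp (- (b * t)) * weight \<beta> t w) * (alive t w * f (pos t w)) \<le>
          weight (\<lambda>_. - a) t w * (alive t w * f (pos t w))"
        by (intro mult_right_mono mult_nonneg_nonneg alive_bounds f0)
      then show "exp (- (a * t)) * exp (- (b * t)) * (weight \<beta> t w * (alive t w * f (pos t w)))
          \<le> weight (\<lambda>_. - a) t w * (alive t w * f (pos t w))"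
        by (simp add: ac_simps)
    qed
    also have "\<dots> \<le> V t f x"
    proof (rule V_compare(2)[OF f f0 t _ a bd])
      fix y z :: "_" and r :: real assume z: "0 \<le> r" "r \<le> exp (b * t)"
      have "- b * r \<le> \<beta> y * r" using b(2)[of y] z by (intro mult_right_mono) auto
      then show "- a * r \<le> \<beta> y * r - nonlinear y r" using c(2)[OF z, of y] by (simp add: a_def algebra_simps)
    qed simp_all
    finally show ?thesis .
  qed
  moreover have "0 < exp (- (a * t)) * exp (- (b * t))" by simp
  ultimately show ?thesis by blast
qed

end

section \<open>Measurability for the weak topology\<close>

lemma weak_integral_measurable:
  fixes f :: "'e::topological_space \<Rightarrow> real"
  assumes "continuous_on UNIV f" "bounded (range f)"
  shows "(\<lambda>m. LINT x|m. f x) \<in> borel_measurable (borel_of weak_topology)"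
proof (rule borel_measurableI)
  fix U :: "real set" assume "open U"
  then have "openin weak_topology {m \<in> finite_borel_measures. (LINT x|m. f x) \<in> U}"
    unfolding weak_topology_def using assms by (intro topology_generated_by_Basis) blast
  moreover have "{m \<in> finite_borel_measures. (LINT x|m. f x) \<in> U} =
      (\<lambda>m. LINT x|m. f x) -` U \<inter> space (borel_of weak_topology)"
    by (auto simp: topspace_weak_topology)
  ultimately show "(\<lambda>m. LINT x|m. f x) -` U \<inter> space (borel_of weak_topology) \<in> sets (borel_of weak_topology)"
    using openin_in_borel_of by metis
qed

lemma finite_borel_measure_sets: "m \<in> finite_borel_measures \<Longrightarrow> sets m = sets borel"
  and finite_borel_measure_finite: "m \<in> finite_borel_measures \<Longrightarrow> finite_measure m"
  by (auto simp: finite_borel_measures_def)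

lemma finite_borel_measure_integrable:
  fixes f :: "'e::topological_space \<Rightarrow> real"
  assumes m: "m \<in> finite_borel_measures" and f: "bounded_borel f"
  shows "integrable m f"
proof -
  obtain C where "\<And>x. \<bar>f x\<bar> \<le> C" using f unfolding bounded_borel_def bounded_iff by auto
  moreover have "f \<in> borel_measurable m"
    using f by (simp add: bounded_borel_def measurable_cong_sets[OF finite_borel_measure_sets[OF m] refl])
  ultimately show ?thesis
    by (intro borel_measurable_bounded_integrable[OF finite_borel_measure_finite[OF m]])
qed

text \<open>The mass of a closed set is the limit of the integrals of \<open>max 0 (1 - n d(x,A))\<close>.\<close>

lemma weak_closed_measurable:
  fixes A :: "'e::metric_space set"
  assumes A: "closed A"
  shows "(\<lambda>m. measure m A) \<in> borel_measurable (borel_of weak_topology)"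
proof (cases "A = {}")
  case False
  define f where "f n x = max 0 (1 - real n * infdist x A)" for n x
  have cont: "continuous_on UNIV (f n)" for n
    unfolding f_def[abs_def] by (intro continuous_intros continuous_on_infdist)
  have bounds: "0 \<le> f n x" "f n x \<le> 1" for n x
    by (auto simp: f_def infdist_nonneg)
  show ?thesis
  proof (rule borel_measurable_LIMSEQ_real)
    show "(\<lambda>m. LINT x|m. f n x) \<in> borel_measurable (borel_of weak_topology)" for n
      by (rule weak_integral_measurable[OF cont]) (auto simp: bounded_iff bounds intro!: exI[of _ 1])
    fix m :: "'e measure" assume "m \<in> space (borel_of weak_topology)"
    then have m: "m \<in> finite_borel_measures" by (simp add: topspace_weak_topology)
    interpret finite_measure m by (rule finite_borel_measure_finite[OF m])
    note [measurable_cong] = finite_borel_measure_sets[OF m]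
    have [measurable]: "A \<in> sets borel" using A by simp
    have "(\<lambda>n. LINT x|m. f n x) \<longlonglongrightarrow> (LINT x|m. indicator A x)"
    proof (rule integral_dominated_convergence[where w="\<lambda>_. 1"])
      show "f n \<in> borel_measurable m" for n
        using borel_measurable_continuous_onI[OF cont] by simp
      show "AE x in m. (\<lambda>n. f n x) \<longlonglongrightarrow> indicator A x"
      proof (rule AE_I2)
        fix x
        show "(\<lambda>n. f n x) \<longlonglongrightarrow> indicator A x"
        proof (cases "x \<in> A")
          case True
          then show ?thesis by (simp add: f_def)
        next
          case x: False
          then have d: "0 < infdist x A"
            using in_closed_iff_infdist_zero[OF A \<open>A \<noteq> {}\<close>] infdist_nonneg[of x A] by (auto simp: less_le)
          obtain N :: nat where N: "1 / infdist x A < real N" using reals_Archimedean2 by blast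
          have "\<forall>\<^sub>F n in sequentially. f n x = 0"
            using eventually_ge_at_top[of N]
          proof eventually_elim
            case (elim n)
            have "1 < real N * infdist x A" using N d by (simp add: divide_less_eq)
            also have "\<dots> \<le> real n * infdist x A" using elim d by (intro mult_right_mono) auto
            finally show ?case by (simp add: f_def)
          qed
          then show ?thesis using x by (simp add: tendsto_eventually)
        qed
      qed
      show "AE x in m. norm (f n x) \<le> 1" for n using bounds by simp
    qed auto
    then show "(\<lambda>n. LINT x|m. f n x) \<longlonglongrightarrow> measure m A"
      by simp
  qed
qed simp

lemma weak_emeasure_measurable:
  fixes A :: "'e::metric_space set"
  assumes A: "A \<in> sets borel"
  shows "(\<lambda>m. emeasure m A) \<in> borel_measurable (borel_of weak_topology)"
proof -
  have eq: "emeasure m A = ennreal (measure m A)" if "m \<in> space (borel_of weak_topology)" for m :: "'e measure" and A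
    using that finite_measure.emeasure_eq_measure[OF finite_borel_measure_finite, of m A]
    by (simp add: topspace_weak_topology)
  have "(\<lambda>m. measure m A) \<in> borel_measurable (borel_of weak_topology)"
  proof -
    have "Int_stable (Collect closed :: 'e set set)" "Collect closed \<subseteq> Pow (UNIV :: 'e set)"
      "A \<in> sigma_sets UNIV (Collect closed)"
      using A by (auto simp: borel_eq_closed Int_stable_def)
    then show ?thesis
    proof (induction rule: sigma_sets_induct_disjoint)
      case (basic A) then show ?case by (simp add: weak_closed_measurable)
    next
      case empty then show ?case by simp
    next
      case (compl A)
      then have "A \<in> sets borel" by (simp add: borel_eq_closed)
      then have "measure m (UNIV - A) = measure m UNIV - measure m A" if "m \<in> space (borel_of weak_topology)" for m :: "'e measure"
        using that finite_measure.finite_measure_compl[OF finite_borel_measure_finite, of m A]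
          sets_eq_imp_space_eq[OF finite_borel_measure_sets, of m] finite_borel_measure_sets[of m]
        by (simp add: topspace_weak_topology)
      moreover have "(\<lambda>m. measure m UNIV - measure m A) \<in> borel_measurable (borel_of weak_topology)"
        using weak_closed_measurable[of "UNIV :: 'e set"] compl by measurable
      ultimately show ?case by (rule measurable_cong[THEN iffD2])
    next
      case (union A)
      then have A: "range A \<subseteq> sets borel" by (auto simp: borel_eq_closed)
      have "(\<lambda>n. \<Sum>i<n. measure m (A i)) \<longlonglongrightarrow> measure m (\<Union>i. A i)" if "m \<in> space (borel_of weak_topology)" for m :: "'e measure"
        using finite_measure.finite_measure_UNION[OF finite_borel_measure_finite, of m A] A union.hyps(1) that
          finite_borel_measure_sets[of m]
        by (auto simp: topspace_weak_topology sums_def)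
      moreover have "(\<lambda>m. \<Sum>i<n. measure m (A i)) \<in> borel_measurable (borel_of weak_topology)" for n
        by (intro borel_measurable_sum union.IH)
      ultimately show ?case by (rule borel_measurable_LIMSEQ_real)
    qed
  qed
  then have "(\<lambda>m. ennreal (measure m A)) \<in> borel_measurable (borel_of weak_topology)" by measurable
  with eq[of _ A] show ?thesis by (rule measurable_cong[THEN iffD2])
qed

lemma weak_nn_integral_measurable:
  fixes f :: "'e::metric_space \<Rightarrow> ennreal"
  assumes "f \<in> borel_measurable borel"
  shows "(\<lambda>m. \<integral>\<^sup>+ x. f x \<partial>m) \<in> borel_measurable (borel_of weak_topology)"
  by (rule nn_integral_measurable_of_emeasure[OF _ weak_emeasure_measurable assms])
     (simp_all add: finite_borel_measure_sets topspace_weak_topology)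

lemma weak_bounded_integral_measurable:
  fixes f :: "'e::metric_space \<Rightarrow> real"
  assumes f: "bounded_borel f" "\<And>x. 0 \<le> f x"
  shows "(\<lambda>m. LINT x|m. f x) \<in> borel_measurable (borel_of weak_topology)"
proof -
  have fm: "f \<in> borel_measurable borel" using f by (simp add: bounded_borel_def)
  have "(\<lambda>m. enn2real (\<integral>\<^sup>+ x. ennreal (f x) \<partial>m)) \<in> borel_measurable (borel_of weak_topology)"
    using weak_nn_integral_measurable[of "\<lambda>x. ennreal (f x)"] fm by measurable
  moreover have "(LINT x|m. f x) = enn2real (\<integral>\<^sup>+ x. ennreal (f x) \<partial>m)" if "m \<in> space (borel_of weak_topology)" for m :: "'e measure"
    using that fm f
    by (intro integral_eq_nn_integral)
       (auto simp: measurable_cong_sets[OF finite_borel_measure_sets refl] topspace_weak_topology)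
  ultimately show ?thesis by (rule measurable_cong[THEN iffD2, rotated])
qed

lemma null_measure_iff:
  fixes m :: "'e::topological_space measure"
  assumes m: "m \<in> finite_borel_measures"
  shows "m = null_measure borel \<longleftrightarrow> measure m UNIV = 0"
proof
  assume "measure m UNIV = 0"
  then have 0: "emeasure m UNIV = 0"
    using finite_measure.emeasure_eq_measure[OF finite_borel_measure_finite[OF m]] by simp
  show "m = null_measure borel"
  proof (rule measure_eqI)
    show "sets m = sets (null_measure borel)" using finite_borel_measure_sets[OF m] by simp
    fix A assume "A \<in> sets m"
    have "emeasure m A \<le> emeasure m UNIV"
      using finite_borel_measure_sets[OF m] by (intro emeasure_mono) auto
    then show "emeasure m A = emeasure (null_measure borel) A" using 0 by simp
  qed
qed simp

lemma null_measure_finite_borel: "null_measure borel \<in> finite_borel_measures"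
  by (auto simp: finite_borel_measures_def intro: finite_measureI)

lemma null_measure_event: "{null_measure borel :: 'e::metric_space measure} \<in> sets (borel_of weak_topology)"
proof -
  have "(\<lambda>m. measure m (UNIV :: 'e set)) -` {0} \<inter> space (borel_of weak_topology) \<in> sets (borel_of weak_topology)"
    by (rule measurable_sets[OF weak_closed_measurable]) auto
  also have "(\<lambda>m. measure m (UNIV :: 'e set)) -` {0} \<inter> space (borel_of weak_topology) = {null_measure borel}"
    using null_measure_iff null_measure_finite_borel by (auto simp: topspace_weak_topology)
  finally show ?thesis .
qed

lemma return_finite_borel: "return borel x \<in> finite_borel_measures"
  using prob_space.finite_measure[OF prob_space_return[of x borel]] by (simp add: finite_borel_measures_def)

lemma integral_return_bounded: "bounded_borel f \<Longrightarrow> (LINT y|return borel x. f y) = f x"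
  by (rule integral_return) (auto simp: bounded_borel_def)

lemma return_not_null: "return borel x \<noteq> null_measure borel"
proof
  assume eq: "return borel x = null_measure borel"
  have "emeasure (return borel x) UNIV = 1" by simp
  then show False unfolding eq by simp
qed

section \<open>The superprocess and its extinction probabilities\<close>

text \<open>The superprocess with transition semigroup \<open>Q\<close> and laws \<open>\<P>\<close>.\<close>

locale superprocess_setting = cumulant_setting P W \<xi> Pr \<beta> \<sigma> \<pi> V
  for P :: "real \<Rightarrow> 'e::polish_space \<Rightarrow> 'e measure" and W :: "'w measure"
    and \<xi> :: "real \<Rightarrow> 'w \<Rightarrow> 'e option" and Pr :: "'e \<Rightarrow> 'w measure"
    and \<beta> \<sigma> :: "'e \<Rightarrow> real" and \<pi> :: "'e \<Rightarrow> real measure"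
    and V :: "real \<Rightarrow> ('e \<Rightarrow> real) \<Rightarrow> 'e \<Rightarrow> real" +
  fixes Q :: "real \<Rightarrow> 'e measure \<Rightarrow> 'e measure measure"
    and \<P> :: "'e measure \<Rightarrow> (real \<Rightarrow> 'e measure) measure"
  assumes superprocess: "superprocess V Q \<P>"
begin

sublocale X: right_process weak_topology Q "path_sigma {0..}" coordinate \<P>
  using superprocess by unfold_locales (simp add: superprocess_def)

abbreviation states :: "'e measure measure" where
  "states \<equiv> borel_of weak_topology"

lemma space_paths: "space (path_sigma I) = right_continuous_paths"
  by (simp add: path_sigma_def)

lemma filt_paths: "X.filt s = path_sigma {0..s}"
  by (simp add: X.filt_def space_paths) (simp add: path_sigma_def)

lemma path_value: "w \<in> right_continuous_paths \<Longrightarrow> 0 \<le> t \<Longrightarrow> w t \<in> finite_borel_measures"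
  by (auto simp: right_continuous_paths_def PiE_iff)

lemma path_law_prob: "\<mu> \<in> finite_borel_measures \<Longrightarrow> prob_space (\<P> \<mu>)"
  and path_law_sets: "\<mu> \<in> finite_borel_measures \<Longrightarrow> sets (\<P> \<mu>) = sets (path_sigma {0..})"
  and path_law_space: "\<mu> \<in> finite_borel_measures \<Longrightarrow> space (\<P> \<mu>) = right_continuous_paths"
  using X.law_prob[of \<mu>] X.law_sets[of \<mu>] X.law_space[of \<mu>]
  by (auto simp: topspace_weak_topology space_paths)

lemma evaluation_measurable:
  assumes "0 \<le> t" "t \<le> s"
  shows "(\<lambda>w. w t) \<in> path_sigma {0..s} \<rightarrow>\<^sub>M states"
  using X.position_measurable_filt[of "\<lambda>m. m" states "null_measure borel" t s] assms
  by (simp add: coordinate_def filt_paths topspace_weak_topology null_measure_finite_borel)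

lemma evaluation_measurable_all: "0 \<le> t \<Longrightarrow> (\<lambda>w. w t) \<in> path_sigma {0..} \<rightarrow>\<^sub>M states"
  using X.measurable_from_filt[of "\<lambda>w. w t" t states] evaluation_measurable[of t t]
  by (simp add: filt_paths)

lemma transition_law:
  fixes g :: "'e measure \<Rightarrow> ennreal"
  assumes "\<mu> \<in> finite_borel_measures" "0 \<le> t" "g \<in> borel_measurable states"
  shows "(\<integral>\<^sup>+ w. g (w t) \<partial>\<P> \<mu>) = (\<integral>\<^sup>+ \<eta>. g \<eta> \<partial>Q t \<mu>)"
  using X.law_at[of \<mu> t g] assms by (simp add: coordinate_def topspace_weak_topology)

lemma markov_paths:
  fixes g :: "'e measure \<Rightarrow> ennreal" and Z :: "(real \<Rightarrow> 'e measure) \<Rightarrow> ennreal"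
  assumes "\<mu> \<in> finite_borel_measures" "0 \<le> s" "0 \<le> t" "Z \<in> borel_measurable (path_sigma {0..s})" "g \<in> borel_measurable states"
  shows "(\<integral>\<^sup>+ w. Z w * g (w (s + t)) \<partial>\<P> \<mu>) = (\<integral>\<^sup>+ w. Z w * (\<integral>\<^sup>+ \<eta>. g \<eta> \<partial>Q t (w s)) \<partial>\<P> \<mu>)"
  using X.markov[of \<mu> s t Z g] assms by (simp add: coordinate_def topspace_weak_topology filt_paths)

lemma Q_sets: "\<mu> \<in> finite_borel_measures \<Longrightarrow> 0 \<le> t \<Longrightarrow> sets (Q t \<mu>) = sets states"
  using X.sets_kernel[of t \<mu>] by (simp add: topspace_weak_topology)

lemma Q_space: "\<mu> \<in> finite_borel_measures \<Longrightarrow> 0 \<le> t \<Longrightarrow> space (Q t \<mu>) = finite_borel_measures"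
  using sets_eq_imp_space_eq[OF Q_sets[of \<mu> t]] by (simp add: topspace_weak_topology)

lemma Q_prob:
  assumes \<mu>: "\<mu> \<in> finite_borel_measures" and t: "0 \<le> t"
  shows "prob_space (Q t \<mu>)"
proof (rule prob_spaceI)
  have "emeasure (Q t \<mu>) (space (Q t \<mu>)) = (\<integral>\<^sup>+ \<eta>. 1 \<partial>Q t \<mu>)" by simp
  also have "\<dots> = (\<integral>\<^sup>+ w. 1 \<partial>\<P> \<mu>)" using transition_law[OF assms, of "\<lambda>_. 1"] by simp
  also have "\<dots> = 1" using prob_space.emeasure_space_1[OF path_law_prob[OF \<mu>]] by simp
  finally show "emeasure (Q t \<mu>) (space (Q t \<mu>)) = 1" .
qed

lemma Q_measurable_iff: "\<mu> \<in> finite_borel_measures \<Longrightarrow> 0 \<le> t \<Longrightarrow> measurable (Q t \<mu>) N = measurable states N"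
  by (rule measurable_cong_sets) (simp_all add: Q_sets)

lemma laplace_measurable:
  assumes "bounded_borel f" "\<And>x. 0 \<le> f x"
  shows "(\<lambda>\<eta>. exp (- (LINT x|\<eta>. f x))) \<in> borel_measurable states"
  using weak_bounded_integral_measurable[OF assms] by measurable

lemma laplace:
  assumes "\<mu> \<in> finite_borel_measures" "0 \<le> t" "bounded_borel f" "\<And>x. 0 \<le> f x"
  shows "(LINT \<eta>|Q t \<mu>. exp (- (LINT x|\<eta>. f x))) = exp (- (LINT x|\<mu>. V t f x))"
  using superprocess assms unfolding superprocess_def by blast

lemma laplace_integrable:
  assumes \<mu>: "\<mu> \<in> finite_borel_measures" and t: "0 \<le> t" and f: "bounded_borel f" "\<And>x. 0 \<le> f x"
  shows "integrable (Q t \<mu>) (\<lambda>\<eta>. exp (- (LINT x|\<eta>. f x)))"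
proof -
  interpret prob_space "Q t \<mu>" by (rule Q_prob[OF \<mu> t])
  show ?thesis
    by (rule integrable_const_bound[of _ 1])
       (use laplace_measurable[OF f] in \<open>auto simp: Q_measurable_iff[OF \<mu> t] f Bochner_Integration.integral_nonneg\<close>)
qed

lemma laplace_nn:
  assumes \<mu>: "\<mu> \<in> finite_borel_measures" and t: "0 \<le> t" and f: "bounded_borel f" "\<And>x. 0 \<le> f x"
  shows "(\<integral>\<^sup>+ \<eta>. ennreal (exp (- (LINT x|\<eta>. f x))) \<partial>Q t \<mu>) = ennreal (exp (- (LINT x|\<mu>. V t f x)))"
  using nn_integral_eq_integral[OF laplace_integrable[OF assms]] laplace[OF assms] by simp

lemma V_via_laplace:
  assumes t: "0 \<le> t" and f: "bounded_borel f" "\<And>x. 0 \<le> f x"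
  shows "exp (- V t f x) = (LINT \<eta>|Q t (return borel x). exp (- (LINT y|\<eta>. f y)))"
  using laplace[OF return_finite_borel t f] integral_return_bounded[OF V_bounded_borel[OF f t]] by simp

lemma V_mono:
  assumes t: "0 \<le> t" and f: "bounded_borel f" "\<And>x. 0 \<le> f x" and g: "bounded_borel g" "\<And>x. 0 \<le> g x"
    and le: "\<And>x. f x \<le> g x"
  shows "V t f x \<le> V t g x"
proof -
  have "exp (- V t g x) \<le> exp (- V t f x)"
    unfolding V_via_laplace[OF t f] V_via_laplace[OF t g]
  proof (rule integral_mono[OF laplace_integrable[OF return_finite_borel t g] laplace_integrable[OF return_finite_borel t f]])
    fix \<eta> assume "\<eta> \<in> space (Q t (return borel x))"
    then have "\<eta> \<in> finite_borel_measures" by (simp add: Q_space[OF return_finite_borel t])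
    then have "(LINT y|\<eta>. f y) \<le> (LINT y|\<eta>. g y)"
      by (intro integral_mono finite_borel_measure_integrable f g le)
    then show "exp (- (LINT y|\<eta>. g y)) \<le> exp (- (LINT y|\<eta>. f y))" by simp
  qed
  then show ?thesis by simp
qed

lemma chapman_nn:
  fixes g :: "'e measure \<Rightarrow> ennreal"
  assumes \<mu>: "\<mu> \<in> finite_borel_measures" and r: "0 \<le> r" and t: "0 \<le> t" and g: "g \<in> borel_measurable states"
  shows "(\<integral>\<^sup>+ \<eta>. g \<eta> \<partial>Q (r + t) \<mu>) = (\<integral>\<^sup>+ \<zeta>. (\<integral>\<^sup>+ \<eta>. g \<eta> \<partial>Q t \<zeta>) \<partial>Q r \<mu>)"
proof -
  have "Q (r + t) \<mu> = Q r \<mu> \<bind> Q t"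
    using X.chapman[OF r t] \<mu> by (simp add: topspace_weak_topology)
  moreover have "Q t \<in> Q r \<mu> \<rightarrow>\<^sub>M subprob_algebra states"
    using X.kernel[OF t] by (simp add: Q_measurable_iff[OF \<mu> r])
  ultimately show ?thesis using nn_integral_bind[OF g] by simp
qed

text \<open>The semigroup property is read off from the Chapman-Kolmogorov equation of the superprocess.\<close>

lemma V_semigroup:
  assumes r: "0 \<le> r" and t: "0 \<le> t" and f: "bounded_borel f" "\<And>x. 0 \<le> f x"
  shows "V (r + t) f x = V r (V t f) x"
proof -
  have Vf: "bounded_borel (V t f)" "\<And>x. 0 \<le> V t f x"
    using V_bounded_borel[OF f t] V_nonneg[OF f t] by auto
  have rt: "0 \<le> r + t" using r t by simp
  have \<delta>: "return borel x \<in> finite_borel_measures" by (rule return_finite_borel)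
  have "ennreal (exp (- V (r + t) f x)) = (\<integral>\<^sup>+ \<eta>. ennreal (exp (- (LINT y|\<eta>. f y))) \<partial>Q (r + t) (return borel x))"
    using laplace_nn[OF \<delta> rt f] integral_return_bounded[OF V_bounded_borel[OF f rt]] by simp
  also have "\<dots> = (\<integral>\<^sup>+ \<zeta>. (\<integral>\<^sup>+ \<eta>. ennreal (exp (- (LINT y|\<eta>. f y))) \<partial>Q t \<zeta>) \<partial>Q r (return borel x))"
    by (rule chapman_nn[OF \<delta> r t measurable_compose[OF laplace_measurable[OF f] measurable_ennreal]])
  also have "\<dots> = (\<integral>\<^sup>+ \<zeta>. ennreal (exp (- (LINT y|\<zeta>. V t f y))) \<partial>Q r (return borel x))"
    by (intro nn_integral_cong laplace_nn t f) (simp add: Q_space[OF \<delta> r])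
  also have "\<dots> = ennreal (exp (- V r (V t f) x))"
    using laplace_nn[OF \<delta> r Vf] integral_return_bounded[OF V_bounded_borel[OF Vf r]] by simp
  finally show ?thesis by (simp add: ennreal_inj)
qed

lemma const_bounded_borel: "bounded_borel (\<lambda>_. c)"
  by (simp add: bounded_borel_def)

text \<open>Letting \<open>n \<rightarrow> \<infinity>\<close> in the Laplace functional of the total mass gives the extinction probability.\<close>

lemma extinction_limit:
  assumes \<eta>: "\<eta> \<in> finite_borel_measures" and t: "0 \<le> t"
  shows "(\<lambda>n. exp (- (LINT x|\<eta>. V t (\<lambda>_. real n) x))) \<longlonglongrightarrow> measure (Q t \<eta>) {null_measure borel}"
proof -
  interpret prob_space "Q t \<eta>" by (rule Q_prob[OF \<eta> t])
  have "(\<lambda>n. LINT \<zeta>|Q t \<eta>. exp (- (LINT x|\<zeta>. real n))) \<longlonglongrightarrow> (LINT \<zeta>|Q t \<eta>. indicator {null_measure borel} \<zeta>)"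
  proof (rule integral_dominated_convergence[where w="\<lambda>_. 1"])
    show "(\<lambda>\<zeta>. exp (- (LINT x|\<zeta>. real n))) \<in> borel_measurable (Q t \<eta>)" for n
      using laplace_measurable[OF const_bounded_borel, of "real n"] by (simp only: Q_measurable_iff[OF \<eta> t])
    show "(indicator {null_measure borel} :: _ \<Rightarrow> real) \<in> borel_measurable (Q t \<eta>)"
      using borel_measurable_indicator[OF null_measure_event] by (simp only: Q_measurable_iff[OF \<eta> t])
    show "AE \<zeta> in Q t \<eta>. (\<lambda>n. exp (- (LINT x|\<zeta>. real n))) \<longlonglongrightarrow> indicator {null_measure borel} \<zeta>"
    proof (rule AE_I2)
      fix \<zeta> assume "\<zeta> \<in> space (Q t \<eta>)"
      then have \<zeta>: "\<zeta> \<in> finite_borel_measures" by (simp add: Q_space[OF \<eta> t])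
      have sp: "space \<zeta> = UNIV" using sets_eq_imp_space_eq[OF finite_borel_measure_sets[OF \<zeta>]] by simp
      show "(\<lambda>n. exp (- (LINT x|\<zeta>. real n))) \<longlonglongrightarrow> indicator {null_measure borel} \<zeta>"
      proof (cases "\<zeta> = null_measure borel")
        case False
        then have m: "0 < measure \<zeta> UNIV" using null_measure_iff[OF \<zeta>] by (simp add: less_le)
        have "filterlim (\<lambda>n. measure \<zeta> UNIV * real n) at_top sequentially"
          by (rule filterlim_tendsto_pos_mult_at_top[OF tendsto_const m filterlim_real_sequentially])
        then have "(\<lambda>n. exp (- (measure \<zeta> UNIV * real n))) \<longlonglongrightarrow> 0"
          by (intro filterlim_compose[OF exp_at_bot] filterlim_compose[OF filterlim_uminus_at_bot_at_top])
        then show ?thesis using False by (simp add: sp mult.commute)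
      qed simp
    qed
    show "AE \<zeta> in Q t \<eta>. norm (exp (- (LINT x|\<zeta>. real n))) \<le> 1" for n by simp
  qed simp
  moreover have "{null_measure borel} \<inter> space (Q t \<eta>) = {null_measure borel}"
    using null_measure_finite_borel by (auto simp: Q_space[OF \<eta> t])
  ultimately show ?thesis
    using laplace[OF \<eta> t const_bounded_borel] by simp
qed

end

section \<open>First moments of the subcritical superprocess\<close>

lemma ratio_bound:
  fixes A p p0 y y0 e :: real
  assumes A: "0 < A" "0 < p" "0 < p0" and e: "0 < e" "e \<le> 1 / 4"
    and y: "A * p * (1 - 2 * e) \<le> y" "y \<le> A * p * (1 + 2 * e)"
    and y0: "A * p0 * (1 - 2 * e) \<le> y0" "y0 \<le> A * p0 * (1 + 2 * e)"
  shows "\<bar>y / y0 - p / p0\<bar> \<le> 8 * e * (p / p0)"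
proof -
  have pos: "0 < A * p0 * (1 - 2 * e)" using A e by simp
  then have y0p: "0 < y0" using y0 by linarith
  have "0 < A * p * (1 - 2 * e)" using A e by simp
  then have yp: "0 < y" using y by linarith
  have "y / y0 \<le> (A * p * (1 + 2 * e)) / (A * p0 * (1 - 2 * e))"
    using y y0 pos yp by (intro frac_le) auto
  also have "\<dots> = (p / p0) * ((1 + 2 * e) / (1 - 2 * e))" using A by (simp add: mult.assoc)
  also have "\<dots> \<le> (p / p0) * (1 + 8 * e)"
  proof (intro mult_left_mono)
    have "1 + 2 * e \<le> (1 + 8 * e) * (1 - 2 * e)"
    proof -
      have "e * e \<le> e * (1 / 4)" using e by (intro mult_left_mono) auto
      then show ?thesis by (simp add: algebra_simps)
    qed
    then show "(1 + 2 * e) / (1 - 2 * e) \<le> 1 + 8 * e" using e by (simp add: pos_divide_le_eq)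
  qed (use A in simp)
  finally have up: "y / y0 \<le> (p / p0) * (1 + 8 * e)" .
  have "(p / p0) * (1 - 8 * e) \<le> (p / p0) * ((1 - 2 * e) / (1 + 2 * e))"
  proof (intro mult_left_mono)
    have "(1 - 8 * e) * (1 + 2 * e) \<le> 1 - 2 * e"
      using e mult_pos_pos[of e e] by (simp add: algebra_simps)
    then show "1 - 8 * e \<le> (1 - 2 * e) / (1 + 2 * e)" using e by (simp add: pos_le_divide_eq)
  qed (use A in simp)
  also have "\<dots> = (A * p * (1 - 2 * e)) / (A * p0 * (1 + 2 * e))" using A by (simp add: mult.assoc)
  also have "\<dots> \<le> y / y0" using y y0 y0p yp A e by (intro frac_le) auto
  finally have "(p / p0) * (1 - 8 * e) \<le> y / y0" .
  with up show ?thesis by (simp add: abs_le_iff algebra_simps)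
qed

lemma exp_remainder_mono:
  fixes u v :: real
  assumes "0 \<le> u" "u \<le> v"
  shows "exp (- u) - 1 + u \<le> exp (- v) - 1 + v"
proof -
  have "exp (- v) * (1 + (v - u)) \<le> exp (- v) * exp (v - u)"
    by (intro mult_left_mono exp_ge_add_one_self) simp
  then have 1: "exp (- v) + exp (- v) * (v - u) \<le> exp (- u)" by (simp add: algebra_simps flip: exp_add)
  have "exp (- u) * (1 + (u - v)) \<le> exp (- u) * exp (u - v)"
    by (intro mult_left_mono exp_ge_add_one_self) simp
  then have 2: "exp (- u) - exp (- v) \<le> exp (- u) * (v - u)" by (simp add: algebra_simps flip: exp_add)
  have "exp (- u) * (v - u) \<le> 1 * (v - u)" using assms by (intro mult_right_mono) auto
  with 2 show ?thesis by simp
qed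

text \<open>The superprocess under the spectral, subcriticality and extinction hypotheses, and the laws
  \<open>\<P>inf\<close> obtained from the martingale change of measure.\<close>

locale subcritical_setting = superprocess_setting P W \<xi> Pr \<beta> \<sigma> \<pi> V Q \<P>
  for P :: "real \<Rightarrow> 'e::polish_space \<Rightarrow> 'e measure" and W :: "'w measure"
    and \<xi> :: "real \<Rightarrow> 'w \<Rightarrow> 'e option" and Pr :: "'e \<Rightarrow> 'w measure"
    and \<beta> \<sigma> :: "'e \<Rightarrow> real" and \<pi> :: "'e \<Rightarrow> real measure"
    and V :: "real \<Rightarrow> ('e \<Rightarrow> real) \<Rightarrow> 'e \<Rightarrow> real"
    and Q :: "real \<Rightarrow> 'e measure \<Rightarrow> 'e measure measure"
    and \<P> :: "'e measure \<Rightarrow> (real \<Rightarrow> 'e measure) measure" +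
  fixes \<P>inf :: "'e measure \<Rightarrow> (real \<Rightarrow> 'e measure) measure"
    and lam :: real and \<phi> :: "'e \<Rightarrow> real" and \<nu> :: "'e measure"
    and H :: "real \<Rightarrow> ('e \<Rightarrow> real) \<Rightarrow> 'e \<Rightarrow> real"
  assumes \<phi>: "bounded_borel \<phi>" "\<And>x. 0 < \<phi> x"
    and \<nu>: "prob_space \<nu>" "sets \<nu> = sets borel"
    and normalized: "(LINT x|\<nu>. \<phi> x) = 1"
    and eigenfunction: "\<And>t x. 0 \<le> t \<Longrightarrow>
          mean_semigroup \<beta> \<xi> Pr t (\<lambda>y. ennreal (\<phi> y)) x = ennreal (exp (lam * t) * \<phi> x)"
    and mean_expansion: "\<And>t x f. 0 < t \<Longrightarrow> f \<in> L1_plus \<nu> \<Longrightarrow>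
          enn2real (mean_semigroup \<beta> \<xi> Pr t (\<lambda>y. ennreal (f y)) x) =
            exp (lam * t) * \<phi> x * (LINT y|\<nu>. f y) * (1 + H t f x)"
    and H_bounded: "\<And>t. 0 < t \<Longrightarrow> (SUP x. SUP f\<in>L1_plus \<nu>. ennreal \<bar>H t f x\<bar>) < \<infinity>"
    and H_limit: "((\<lambda>t. SUP x. SUP f\<in>L1_plus \<nu>. ennreal \<bar>H t f x\<bar>) \<longlongrightarrow> 0) at_top"
    and subcritical: "lam < 0"
    and extinction: "\<And>t. 0 < t \<Longrightarrow> 0 < measure (\<P> \<nu>) {w \<in> right_continuous_paths. w t = null_measure borel}"
    and limit_law: "\<And>\<mu>. \<mu> \<in> finite_borel_measures - {null_measure borel} \<Longrightarrow>
          is_phi_transform \<P> lam \<phi> \<mu> (\<P>inf \<mu>)"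
begin

lemma \<nu>_finite_borel: "\<nu> \<in> finite_borel_measures"
  using \<nu> by (simp add: finite_borel_measures_def prob_space.finite_measure)

lemma \<phi>_nonneg: "0 \<le> \<phi> x" using \<phi>(2)[of x] by simp

lemma \<phi>_borel [measurable]: "\<phi> \<in> borel_measurable borel" using \<phi> by (simp add: bounded_borel_def)

text \<open>The uniform relative error in the expansion of the mean semigroup. The supremum is finite for
  \<open>t > 0\<close>, so the conversion to a real number loses nothing there.\<close>

definition h :: "real \<Rightarrow> real" where
  "h t = enn2real (SUP x. SUP f\<in>L1_plus \<nu>. ennreal \<bar>H t f x\<bar>)"

lemma h_nonneg: "0 \<le> h t" by (simp add: h_def)

lemma H_le:
  assumes "0 < t" "f \<in> L1_plus \<nu>"
  shows "\<bar>H t f x\<bar> \<le> h t"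
proof -
  have "ennreal \<bar>H t f x\<bar> \<le> (SUP x. SUP f\<in>L1_plus \<nu>. ennreal \<bar>H t f x\<bar>)"
    using assms(2) by (intro SUP_upper2[of x]) (auto intro: SUP_upper)
  also have "\<dots> = ennreal (h t)" using H_bounded[OF assms(1)] by (simp add: h_def)
  finally show ?thesis by (simp add: h_nonneg)
qed

lemma h_tendsto: "(h \<longlongrightarrow> 0) at_top"
  unfolding h_def[abs_def] using H_limit by (intro tendsto_enn2real) auto

lemma bounded_borel_L1:
  assumes f: "bounded_borel f" "\<And>x. 0 \<le> f x"
  shows "f \<in> L1_plus \<nu>"
  using f nn_integral_eq_integral[OF finite_borel_measure_integrable[OF \<nu>_finite_borel f(1)]]
  by (simp add: L1_plus_def bounded_borel_def)

lemma mean_integral_nonneg: "(\<And>x. 0 \<le> f x) \<Longrightarrow> 0 \<le> mean_integral \<beta> t f x"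
  unfolding mean_integral_def
  by (intro Bochner_Integration.integral_nonneg) (simp add: alive_bounds weight_pos less_imp_le)

lemma mean_semigroup_bounded:
  assumes f: "bounded_borel f" "\<And>x. 0 \<le> f x" and t: "0 \<le> t"
  shows "mean_semigroup \<beta> \<xi> Pr t (\<lambda>y. ennreal (f y)) x = ennreal (mean_integral \<beta> t f x)"
proof -
  obtain b where b: "\<And>y. \<bar>\<beta> y\<bar> \<le> b" using \<beta>_bound by blast
  obtain C where C: "\<And>x. \<bar>f x\<bar> \<le> C" using f unfolding bounded_borel_def bounded_iff by auto
  show ?thesis using f by (intro mean_semigroup_real[OF t \<beta>_borel b _ _ C]) (auto simp: bounded_borel_def)
qed

lemma mean_integral_eq:
  assumes f: "bounded_borel f" "\<And>x. 0 \<le> f x" and t: "0 < t"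
  shows "mean_integral \<beta> t f x = exp (lam * t) * \<phi> x * (LINT y|\<nu>. f y) * (1 + H t f x)"
  using mean_expansion[OF t bounded_borel_L1[OF f], of x] mean_semigroup_bounded[of f t x] t f
    mean_integral_nonneg[of f t x]
  by simp

lemma mean_bounds:
  assumes f: "bounded_borel f" "\<And>x. 0 \<le> f x" and t: "0 < t"
  shows "mean_integral \<beta> t f x \<le> exp (lam * t) * \<phi> x * (LINT y|\<nu>. f y) * (1 + h t)"
    and "exp (lam * t) * \<phi> x * (LINT y|\<nu>. f y) * (1 - h t) \<le> mean_integral \<beta> t f x"
proof -
  have nn: "0 \<le> exp (lam * t) * \<phi> x * (LINT y|\<nu>. f y)"
    by (intro mult_nonneg_nonneg Bochner_Integration.integral_nonneg \<phi>_nonneg f) simp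
  have Hle: "\<bar>H t f x\<bar> \<le> h t" by (rule H_le[OF t bounded_borel_L1[OF f]])
  show "mean_integral \<beta> t f x \<le> exp (lam * t) * \<phi> x * (LINT y|\<nu>. f y) * (1 + h t)"
    and "exp (lam * t) * \<phi> x * (LINT y|\<nu>. f y) * (1 - h t) \<le> mean_integral \<beta> t f x"
    unfolding mean_integral_eq[OF f t] by (rule mult_left_mono[OF _ nn]; use Hle in linarith)+
qed

lemma mean_\<phi>: "0 \<le> t \<Longrightarrow> mean_integral \<beta> t \<phi> x = exp (lam * t) * \<phi> x"
  using eigenfunction[of t x] mean_semigroup_bounded[of \<phi> t x] \<phi>(1) \<phi>_nonneg
    mean_integral_nonneg[of \<phi> t x]
  by simp

lemma \<phi>_mass_pos:
  assumes \<mu>: "\<mu> \<in> finite_borel_measures - {null_measure borel}"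
  shows "0 < (LINT x|\<mu>. \<phi> x)"
proof -
  have m: "\<mu> \<in> finite_borel_measures" using \<mu> by simp
  have "(LINT x|\<mu>. \<phi> x) \<noteq> 0"
  proof
    assume "(LINT x|\<mu>. \<phi> x) = 0"
    then have "AE x in \<mu>. \<phi> x = 0"
      using integral_nonneg_eq_0_iff_AE[OF finite_borel_measure_integrable[OF m \<phi>(1)]] by (simp add: \<phi>_nonneg)
    then have "AE x in \<mu>. False" by eventually_elim (use \<phi>(2) in \<open>auto simp: less_le\<close>)
    then have "emeasure \<mu> (space \<mu>) = 0" using AE_iff_measurable[of "space \<mu>" \<mu> "\<lambda>_. False"] by simp
    moreover have "space \<mu> = UNIV" using sets_eq_imp_space_eq[OF finite_borel_measure_sets[OF m]] by simp
    ultimately have "measure \<mu> UNIV = 0" by (simp add: measure_def)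
    then show False using null_measure_iff[OF m] \<mu> by simp
  qed
  then show ?thesis using Bochner_Integration.integral_nonneg[of \<mu> \<phi>] \<phi>_nonneg by (simp add: less_le)
qed

lemma path_\<phi>_measurable: "0 \<le> s \<Longrightarrow> (\<lambda>w. LINT x|w s. \<phi> x) \<in> borel_measurable (path_sigma {0..})"
  using measurable_compose[OF evaluation_measurable_all weak_bounded_integral_measurable[OF \<phi>(1) \<phi>_nonneg]] .

lemma path_\<phi>_nonneg: "0 \<le> (LINT x|m. \<phi> x)"
  by (intro Bochner_Integration.integral_nonneg \<phi>_nonneg)

text \<open>The transformed law has total mass one; this is the first moment of \<open>X\<^sub>s(\<phi>)\<close>.\<close>

lemma \<phi>_moment_paths:
  assumes \<mu>: "\<mu> \<in> finite_borel_measures - {null_measure borel}" and s: "0 \<le> s"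
  shows "(\<integral>\<^sup>+ w. ennreal (LINT x|w s. \<phi> x) \<partial>\<P> \<mu>) = ennreal (exp (lam * s) * (LINT x|\<mu>. \<phi> x))"
proof -
  have m: "\<mu> \<in> finite_borel_measures" using \<mu> by simp
  define D where "D = exp (lam * s) * (LINT x|\<mu>. \<phi> x)"
  have D: "0 < D" using \<phi>_mass_pos[OF \<mu>] by (simp add: D_def)
  note R = limit_law[OF \<mu>, unfolded is_phi_transform_def path_law_def]
  have "1 = (\<integral>\<^sup>+ w. 1 \<partial>\<P>inf \<mu>)" using R prob_space.emeasure_space_1[of "\<P>inf \<mu>"] by simp
  also have "\<dots> = (\<integral>\<^sup>+ w. ennreal ((LINT x|w s. \<phi> x) / D) * 1 \<partial>\<P> \<mu>)"
  proof -
    have "(\<lambda>_. 1 :: ennreal) \<in> borel_measurable (path_sigma {0..s})" by simp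
    then show ?thesis using R s unfolding D_def by blast
  qed
  also have "\<dots> = (\<integral>\<^sup>+ w. ennreal (1 / D) * ennreal (LINT x|w s. \<phi> x) \<partial>\<P> \<mu>)"
    using D by (intro nn_integral_cong) (simp add: path_\<phi>_nonneg flip: ennreal_mult)
  also have "\<dots> = ennreal (1 / D) * (\<integral>\<^sup>+ w. ennreal (LINT x|w s. \<phi> x) \<partial>\<P> \<mu>)"
    using path_\<phi>_measurable[OF s]
    by (intro nn_integral_cmult) (simp add: measurable_cong_sets[OF path_law_sets[OF m] refl])
  finally have one: "1 = ennreal (1 / D) * (\<integral>\<^sup>+ w. ennreal (LINT x|w s. \<phi> x) \<partial>\<P> \<mu>)" .
  have "ennreal D * 1 = (ennreal D * ennreal (1 / D)) * (\<integral>\<^sup>+ w. ennreal (LINT x|w s. \<phi> x) \<partial>\<P> \<mu>)"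
    using one by (simp add: mult.assoc)
  also have "ennreal D * ennreal (1 / D) = 1" using D by (simp flip: ennreal_mult)
  finally show ?thesis by (simp add: D_def)
qed

lemma \<phi>_moment:
  assumes \<mu>: "\<mu> \<in> finite_borel_measures - {null_measure borel}" and s: "0 \<le> s"
  shows "(\<integral>\<^sup>+ \<eta>. ennreal (LINT x|\<eta>. \<phi> x) \<partial>Q s \<mu>) = ennreal (exp (lam * s) * (LINT x|\<mu>. \<phi> x))"
  using \<phi>_moment_paths[OF assms] transition_law[of \<mu> s "\<lambda>\<eta>. ennreal (LINT x|\<eta>. \<phi> x)"] \<mu> s
    weak_bounded_integral_measurable[OF \<phi>(1) \<phi>_nonneg]
  by simp

lemma survival_positive:
  assumes \<mu>: "\<mu> \<in> finite_borel_measures - {null_measure borel}" and s: "0 \<le> s"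
  shows "measure (Q s \<mu>) {null_measure borel} < 1"
proof -
  have m: "\<mu> \<in> finite_borel_measures" using \<mu> by simp
  interpret prob_space "Q s \<mu>" by (rule Q_prob[OF m s])
  have ev: "{null_measure borel} \<in> sets (Q s \<mu>)" using null_measure_event by (simp add: Q_sets[OF m s])
  have "prob {null_measure borel} \<noteq> 1"
  proof
    assume "prob {null_measure borel} = 1"
    then have "AE \<eta> in Q s \<mu>. \<eta> \<in> {null_measure borel}" using prob_eq_1[OF ev] by simp
    then have "AE \<eta> in Q s \<mu>. ennreal (LINT x|\<eta>. \<phi> x) = 0" by eventually_elim simp
    then have "(\<integral>\<^sup>+ \<eta>. ennreal (LINT x|\<eta>. \<phi> x) \<partial>Q s \<mu>) = (\<integral>\<^sup>+ \<eta>. 0 \<partial>Q s \<mu>)" by (rule nn_integral_cong_AE)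
    then show False using \<phi>_moment[OF assms] \<phi>_mass_pos[OF \<mu>] by simp
  qed
  then show ?thesis using prob_le_1[of "{null_measure borel}"] by linarith
qed

text \<open>An upper bound for the first moment, obtained by differentiating the Laplace functional at \<open>0\<close> and
  using \<open>V_le_mean\<close>. For functions below a multiple of \<open>\<phi>\<close> equality follows, because it holds for \<open>\<phi>\<close>.\<close>

lemma first_moment_le:
  assumes f: "bounded_borel f" "\<And>x. 0 \<le> f x" and r: "0 \<le> r"
  shows "(\<integral>\<^sup>+ \<eta>. ennreal (LINT y|\<eta>. f y) \<partial>Q r (return borel x)) \<le> ennreal (mean_integral \<beta> r f x)"
proof -
  have \<delta>: "return borel x \<in> finite_borel_measures" by (rule return_finite_borel)
  interpret prob_space "Q r (return borel x)" by (rule Q_prob[OF \<delta> r])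
  define g where "g n y = f y / real (Suc n)" for n y
  have g: "bounded_borel (g n)" "\<And>x. 0 \<le> g n x" for n
  proof -
    obtain C where C: "\<And>x. \<bar>f x\<bar> \<le> C" using f unfolding bounded_borel_def bounded_iff by auto
    have "\<bar>g n y\<bar> \<le> C" for y
    proof -
      have "\<bar>f y\<bar> / real (Suc n) \<le> \<bar>f y\<bar> / 1" by (intro divide_left_mono) auto
      then show ?thesis using C[of y] by (simp add: g_def abs_divide)
    qed
    then show "bounded_borel (g n)"
      using f(1) unfolding bounded_borel_def bounded_iff by (auto simp: g_def[abs_def])
    show "0 \<le> g n x" for x using f(2)[of x] by (simp add: g_def)
  qed
  have gi: "(LINT y|\<eta>. g n y) = (LINT y|\<eta>. f y) / real (Suc n)" for \<eta> n
    by (simp add: g_def[abs_def])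
  define s where "s n \<eta> = ennreal (real (Suc n) * (1 - exp (- (LINT y|\<eta>. g n y))))" for n \<eta>
  have lim: "(\<lambda>n. s n \<eta>) \<longlonglongrightarrow> ennreal (LINT y|\<eta>. f y)" for \<eta>
  proof -
    define z where "z = (LINT y|\<eta>. f y)"
    have z: "0 \<le> z" unfolding z_def by (intro Bochner_Integration.integral_nonneg f)
    have low: "z - z\<^sup>2 / real (Suc n) \<le> real (Suc n) * (1 - exp (- (z / real (Suc n))))" for n
    proof -
      have "1 - exp (- (z / real (Suc n))) \<ge> z / real (Suc n) - (z / real (Suc n))\<^sup>2"
        using exp_remainder_bounds(3)[of "z / real (Suc n)"] z by simp
      then have "real (Suc n) * (z / real (Suc n) - (z / real (Suc n))\<^sup>2) \<le> real (Suc n) * (1 - exp (- (z / real (Suc n))))"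
        by (intro mult_left_mono) auto
      then show ?thesis by (simp add: right_diff_distrib power2_eq_square del: of_nat_Suc)
    qed
    have up: "real (Suc n) * (1 - exp (- (z / real (Suc n)))) \<le> z" for n
    proof -
      have "1 - exp (- (z / real (Suc n))) \<le> z / real (Suc n)"
        using exp_ge_add_one_self[of "- (z / real (Suc n))"] by linarith
      then have "real (Suc n) * (1 - exp (- (z / real (Suc n)))) \<le> real (Suc n) * (z / real (Suc n))"
        by (intro mult_left_mono) auto
      then show ?thesis by simp
    qed
    have "(\<lambda>n. z - z\<^sup>2 / real (Suc n)) \<longlonglongrightarrow> z - 0"
      by (intro tendsto_intros LIMSEQ_Suc[OF lim_const_over_n])
    then have lower: "(\<lambda>n. z - z\<^sup>2 / real (Suc n)) \<longlonglongrightarrow> z" by simp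
    have "(\<lambda>n. real (Suc n) * (1 - exp (- (z / real (Suc n))))) \<longlonglongrightarrow> z"
      by (rule tendsto_sandwich[OF _ _ lower tendsto_const]) (intro always_eventually allI low up)+
    then show ?thesis unfolding s_def gi z_def by (rule tendsto_ennrealI)
  qed
  have sm: "s n \<in> borel_measurable (Q r (return borel x))" for n
    unfolding Q_measurable_iff[OF \<delta> r] s_def[abs_def]
    using laplace_measurable[OF g, of n] by measurable
  have "(\<integral>\<^sup>+ \<eta>. s n \<eta> \<partial>Q r (return borel x)) \<le> ennreal (mean_integral \<beta> r f x)" for n
  proof -
    have "(LINT \<eta>|Q r (return borel x). real (Suc n) * (1 - exp (- (LINT y|\<eta>. g n y)))) =
        real (Suc n) * (1 - exp (- V r (g n) x))"
      using laplace_integrable[OF \<delta> r g] V_via_laplace[OF r g] by (simp add: prob_space del: of_nat_Suc)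
    also have "\<dots> \<le> real (Suc n) * V r (g n) x"
      using exp_ge_add_one_self[of "- V r (g n) x"] by (intro mult_left_mono) auto
    also have "\<dots> \<le> real (Suc n) * mean_integral \<beta> r (g n) x"
      by (intro mult_left_mono V_le_mean[OF g r]) simp
    also have "\<dots> = mean_integral \<beta> r f x"
      unfolding mean_integral_cmult[symmetric] by (simp add: g_def del: of_nat_Suc)
    finally have le: "(LINT \<eta>|Q r (return borel x). real (Suc n) * (1 - exp (- (LINT y|\<eta>. g n y)))) \<le> mean_integral \<beta> r f x" .
    have "(\<integral>\<^sup>+ \<eta>. s n \<eta> \<partial>Q r (return borel x)) =
        ennreal (LINT \<eta>|Q r (return borel x). real (Suc n) * (1 - exp (- (LINT y|\<eta>. g n y))))"
      unfolding s_def
    proof (rule nn_integral_eq_integral)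
      show "integrable (Q r (return borel x)) (\<lambda>\<eta>. real (Suc n) * (1 - exp (- (LINT y|\<eta>. g n y))))"
        using laplace_integrable[OF \<delta> r g] by (simp del: of_nat_Suc)
      have "0 \<le> (LINT y|\<eta>. g n y)" for \<eta> by (intro Bochner_Integration.integral_nonneg g)
      then show "AE \<eta> in Q r (return borel x). 0 \<le> real (Suc n) * (1 - exp (- (LINT y|\<eta>. g n y)))"
        by (intro AE_I2 mult_nonneg_nonneg) auto
    qed
    then show ?thesis using le by (simp add: ennreal_leI)
  qed
  then have "liminf (\<lambda>n. \<integral>\<^sup>+ \<eta>. s n \<eta> \<partial>Q r (return borel x)) \<le> ennreal (mean_integral \<beta> r f x)"
    by (intro order_trans[OF Liminf_mono Liminf_const[THEN eq_refl]]) auto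
  moreover have "(\<integral>\<^sup>+ \<eta>. liminf (\<lambda>n. s n \<eta>) \<partial>Q r (return borel x)) \<le> liminf (\<lambda>n. \<integral>\<^sup>+ \<eta>. s n \<eta> \<partial>Q r (return borel x))"
    by (rule nn_integral_liminf) (rule sm)
  moreover have "liminf (\<lambda>n. s n \<eta>) = ennreal (LINT y|\<eta>. f y)" for \<eta>
    using lim by (rule lim_imp_Liminf[rotated]) simp
  ultimately show ?thesis by simp
qed

lemma \<phi>_integrable:
  assumes r: "0 \<le> r"
  shows "integrable (Q r (return borel x)) (\<lambda>\<eta>. LINT y|\<eta>. \<phi> y)"
    and "(LINT \<eta>|Q r (return borel x). (LINT y|\<eta>. \<phi> y)) = exp (lam * r) * \<phi> x"
proof -
  have \<delta>: "return borel x \<in> finite_borel_measures" by (rule return_finite_borel)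
  have m: "(\<lambda>\<eta>. LINT y|\<eta>. \<phi> y) \<in> borel_measurable (Q r (return borel x))"
    using weak_bounded_integral_measurable[OF \<phi>(1) \<phi>_nonneg] by (simp only: Q_measurable_iff[OF \<delta> r])
  have nn: "(\<integral>\<^sup>+ \<eta>. ennreal (LINT y|\<eta>. \<phi> y) \<partial>Q r (return borel x)) = ennreal (exp (lam * r) * \<phi> x)"
  proof -
    have "return borel x \<in> finite_borel_measures - {null_measure borel}" using \<delta> return_not_null by blast
    from \<phi>_moment[OF this r] show ?thesis using integral_return_bounded[OF \<phi>(1)] by simp
  qed
  show "integrable (Q r (return borel x)) (\<lambda>\<eta>. LINT y|\<eta>. \<phi> y)"
    using m nn by (intro integrableI_nonneg) (auto simp: path_\<phi>_nonneg)
  show "(LINT \<eta>|Q r (return borel x). (LINT y|\<eta>. \<phi> y)) = exp (lam * r) * \<phi> x"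
    using integral_eq_nn_integral[OF m] nn \<phi>_nonneg[of x] by (simp add: path_\<phi>_nonneg)
qed

text \<open>The defect between mean and cumulant. With \<open>f \<le> c \<phi>\<close>, the bound of the first moment of
  \<open>c \<phi> - f\<close> is a lower bound of the first moment of \<open>f\<close>, while \<open>V\<^sub>r f \<ge> 1 - exp(- V\<^sub>r f)\<close>.\<close>

lemma defect_le:
  assumes f: "bounded_borel f" "\<And>x. 0 \<le> f x" and le: "\<And>x. f x \<le> c * \<phi> x" and c: "0 \<le> c" and r: "0 \<le> r"
  shows "mean_integral \<beta> r f x - V r f x \<le>
    (LINT \<eta>|Q r (return borel x). exp (- (c * (LINT y|\<eta>. \<phi> y))) - 1 + c * (LINT y|\<eta>. \<phi> y))"
proof -
  have \<delta>: "return borel x \<in> finite_borel_measures" by (rule return_finite_borel)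
  define M where "M = Q r (return borel x)"
  interpret prob_space M unfolding M_def by (rule Q_prob[OF \<delta> r])
  define L where "L \<eta> = (LINT y|\<eta>. f y)" for \<eta>
  define \<Phi> where "\<Phi> \<eta> = (LINT y|\<eta>. \<phi> y)" for \<eta>
  have mst: "measurable M N = measurable states N" for N :: "real measure"
    unfolding M_def by (rule Q_measurable_iff[OF \<delta> r])
  have Lm: "L \<in> borel_measurable M" and \<Phi>m: "\<Phi> \<in> borel_measurable M"
    using weak_bounded_integral_measurable[OF f] weak_bounded_integral_measurable[OF \<phi>(1) \<phi>_nonneg]
    by (simp_all add: mst L_def[abs_def] \<Phi>_def[abs_def])
  have L0: "0 \<le> L \<eta>" for \<eta> unfolding L_def by (intro Bochner_Integration.integral_nonneg f)
  have \<Phi>0: "0 \<le> \<Phi> \<eta>" for \<eta> unfolding \<Phi>_def by (rule path_\<phi>_nonneg)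
  have fin: "\<eta> \<in> finite_borel_measures" if "\<eta> \<in> space M" for \<eta> using that by (simp add: M_def Q_space[OF \<delta> r])
  have L_le: "L \<eta> \<le> c * \<Phi> \<eta>" if "\<eta> \<in> space M" for \<eta>
  proof -
    have "L \<eta> \<le> (LINT y|\<eta>. c * \<phi> y)"
      unfolding L_def using finite_borel_measure_integrable[OF fin[OF that]] f \<phi> le
      by (intro integral_mono) auto
    then show ?thesis by (simp add: \<Phi>_def)
  qed
  have \<Phi>i: "integrable M \<Phi>" "(LINT \<eta>|M. \<Phi> \<eta>) = exp (lam * r) * \<phi> x"
    using \<phi>_integrable[OF r] by (simp_all add: M_def \<Phi>_def[abs_def])
  have Li: "integrable M L"
    by (rule Bochner_Integration.integrable_bound[OF integrable_mult_right[OF \<Phi>i(1), of c] Lm])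
       (auto simp: L0 L_le c \<Phi>0 intro!: AE_I2)
  define g where "g y = c * \<phi> y - f y" for y
  obtain F where F: "\<And>y. \<bar>\<phi> y\<bar> \<le> F" using \<phi>(1) unfolding bounded_borel_def bounded_iff by auto
  have \<phi>cb: "\<bar>c * \<phi> y\<bar> \<le> c * F" for y using c F by (intro abs_mult_le) auto
  obtain G where G: "\<And>y. \<bar>f y\<bar> \<le> G" using f unfolding bounded_borel_def bounded_iff by auto
  have fm: "f \<in> borel_measurable borel" using f by (simp add: bounded_borel_def)
  have g: "bounded_borel g" "\<And>y. 0 \<le> g y"
  proof -
    have "\<bar>g y\<bar> \<le> c * F" for y using \<phi>cb[of y] le[of y] f(2)[of y] by (simp add: g_def)
    then show "bounded_borel g" using fm unfolding bounded_borel_def bounded_iff by (auto simp: g_def[abs_def])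
    show "0 \<le> g y" for y using le[of y] by (simp add: g_def)
  qed
  have "(LINT \<eta>|M. c * \<Phi> \<eta> - L \<eta>) \<le> mean_integral \<beta> r g x"
  proof -
    have "ennreal (LINT \<eta>|M. c * \<Phi> \<eta> - L \<eta>) = (\<integral>\<^sup>+ \<eta>. ennreal (c * \<Phi> \<eta> - L \<eta>) \<partial>M)"
      using \<Phi>i(1) Li L_le by (intro nn_integral_eq_integral[symmetric]) auto
    also have "\<dots> = (\<integral>\<^sup>+ \<eta>. ennreal (LINT y|\<eta>. g y) \<partial>M)"
    proof (rule nn_integral_cong)
      fix \<eta> assume "\<eta> \<in> space M"
      then have "(LINT y|\<eta>. g y) = c * \<Phi> \<eta> - L \<eta>"
        unfolding g_def L_def \<Phi>_def
        using finite_borel_measure_integrable[OF fin] f(1) \<phi>(1) by simp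
      then show "ennreal (c * \<Phi> \<eta> - L \<eta>) = ennreal (LINT y|\<eta>. g y)" by simp
    qed
    also have "\<dots> \<le> ennreal (mean_integral \<beta> r g x)" unfolding M_def by (rule first_moment_le[OF g r])
    finally show ?thesis using mean_integral_nonneg[of g r x] g(2) by simp
  qed
  also have "mean_integral \<beta> r g x = c * (exp (lam * r) * \<phi> x) - mean_integral \<beta> r f x"
  proof -
    obtain b where b: "\<And>y. \<bar>\<beta> y\<bar> \<le> b" using \<beta>_bound by blast
    have "mean_integral \<beta> r g x = mean_integral \<beta> r (\<lambda>y. c * \<phi> y) x - mean_integral \<beta> r f x"
      unfolding g_def using fm by (intro mean_integral_diff[OF r \<beta>_borel b _ _ \<phi>cb G]) auto
    then show ?thesis by (simp add: mean_integral_cmult mean_\<phi>[OF r])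
  qed
  finally have mean_le: "mean_integral \<beta> r f x \<le> (LINT \<eta>|M. L \<eta>)"
    using \<Phi>i Li by simp
  have Ei: "integrable M (\<lambda>\<eta>. exp (- L \<eta>))" and E: "(LINT \<eta>|M. exp (- L \<eta>)) = exp (- V r f x)"
    using laplace_integrable[OF \<delta> r f] V_via_laplace[OF r f] by (simp_all add: M_def L_def)
  have Ei': "integrable M (\<lambda>\<eta>. exp (- (c * \<Phi> \<eta>)))"
    by (rule integrable_const_bound[of _ 1]) (use \<Phi>m c \<Phi>0 in \<open>auto intro!: mult_nonneg_nonneg\<close>)
  have "mean_integral \<beta> r f x - V r f x \<le> (LINT \<eta>|M. L \<eta>) - (1 - exp (- V r f x))"
    using mean_le exp_ge_add_one_self[of "- V r f x"] by linarith
  also have "\<dots> = (LINT \<eta>|M. exp (- L \<eta>) - 1 + L \<eta>)"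
    using Ei Li E by (simp add: prob_space)
  also have "\<dots> \<le> (LINT \<eta>|M. exp (- (c * \<Phi> \<eta>)) - 1 + c * \<Phi> \<eta>)"
    using Ei Li Ei' \<Phi>i(1) L0 L_le by (intro integral_mono exp_remainder_mono) auto
  finally show ?thesis by (simp add: M_def \<Phi>_def)
qed

end

section \<open>Asymptotics of the extinction exponents\<close>

context subcritical_setting
begin

lemma null_event: "{null_measure borel :: 'e measure} \<in> sets states"
  by (rule null_measure_event)

text \<open>\<open>ext_rate t x = - log P(X\<^sub>t = 0)\<close> for the superprocess started from the Dirac mass at \<open>x\<close>; it is
  the increasing limit of \<open>V\<^sub>t n(x)\<close>. The supremum is finite for \<open>t > 0\<close>, the only times at which it is
  used.\<close>

definition ext_rate :: "real \<Rightarrow> 'e \<Rightarrow> real" where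
  "ext_rate t x = (SUP n. V t (\<lambda>_. real n) x)"

lemma path_filt_measurable:
  fixes f :: "(real \<Rightarrow> 'e measure) \<Rightarrow> 'c"
  assumes "f \<in> measurable (path_sigma {0..s}) N"
  shows "f \<in> measurable (path_sigma {0..}) N"
  using assms unfolding filt_paths[symmetric] by (rule X.measurable_from_filt)

lemma V_const: "0 \<le> t \<Longrightarrow> bounded_borel (V t (\<lambda>_. real n))" "0 \<le> t \<Longrightarrow> 0 \<le> V t (\<lambda>_. real n) x"
  by (auto intro!: V_bounded_borel V_nonneg const_bounded_borel)

lemma V_const_incseq: "0 \<le> t \<Longrightarrow> incseq (\<lambda>n. V t (\<lambda>_. real n) x)"
  by (auto simp: incseq_def intro!: V_mono const_bounded_borel)

text \<open>The bound is \<open>- ln P(X\<^sub>t = 0)\<close> for the start in \<open>\<nu>\<close>, finite because extinction has positive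
  probability.\<close>

lemma \<nu>_V_bounded:
  assumes t: "0 < t"
  shows "\<exists>C. \<forall>n. (LINT x|\<nu>. V t (\<lambda>_. real n) x) \<le> C"
proof -
  have t0: "0 \<le> t" using t by simp
  define p where "p = measure (Q t \<nu>) {null_measure borel}"
  have "{null_measure borel} \<in> sets states" by (rule null_event)
  then have "(\<integral>\<^sup>+ w. indicator {null_measure borel} (w t) \<partial>\<P> \<nu>) = emeasure (Q t \<nu>) {null_measure borel}"
    using transition_law[OF \<nu>_finite_borel t0, of "indicator {null_measure borel}"] Q_sets[OF \<nu>_finite_borel t0] by simp
  moreover have "(\<integral>\<^sup>+ w. indicator {null_measure borel} (w t) \<partial>\<P> \<nu>) =
      (\<integral>\<^sup>+ w. indicator {w \<in> right_continuous_paths. w t = null_measure borel} w \<partial>\<P> \<nu>)"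
    by (intro nn_integral_cong) (auto simp: indicator_def path_law_space[OF \<nu>_finite_borel])
  moreover have "{w \<in> right_continuous_paths. w t = null_measure borel} \<in> sets (\<P> \<nu>)"
    using measurable_sets[OF evaluation_measurable_all[OF t0] null_event]
    by (simp add: path_law_sets[OF \<nu>_finite_borel] space_paths vimage_def Int_def conj_commute)
  ultimately have "emeasure (Q t \<nu>) {null_measure borel} = emeasure (\<P> \<nu>) {w \<in> right_continuous_paths. w t = null_measure borel}"
    by simp
  then have p: "0 < p" using extinction[OF t] by (simp add: p_def measure_def)
  have "(LINT x|\<nu>. V t (\<lambda>_. real n) x) \<le> - ln p" for n
  proof -
    have "decseq (\<lambda>n. exp (- (LINT x|\<nu>. V t (\<lambda>_. real n) x)))"
      unfolding decseq_def
      by (auto intro!: integral_mono finite_borel_measure_integrable[OF \<nu>_finite_borel] V_const[OF t0] V_mono[OF t0] const_bounded_borel)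
    from decseq_ge[OF this extinction_limit[OF \<nu>_finite_borel t0]]
    have "p \<le> exp (- (LINT x|\<nu>. V t (\<lambda>_. real n) x))" by (simp add: p_def)
    then have "ln p \<le> - (LINT x|\<nu>. V t (\<lambda>_. real n) x)" using ln_mono[OF _ p] by fastforce
    then show ?thesis by simp
  qed
  then show ?thesis by blast
qed

text \<open>Half of the time is spent on the bound under \<open>\<nu>\<close>, the other half on making it uniform in \<open>x\<close>.\<close>

lemma V_const_bounded:
  assumes t: "0 < t"
  shows "\<exists>C. \<forall>n x. V t (\<lambda>_. real n) x \<le> C"
proof -
  define r where "r = t / 2"
  have r: "0 < r" "0 \<le> r" "r + r = t" using t by (auto simp: r_def)
  obtain C where C: "\<And>n. (LINT x|\<nu>. V r (\<lambda>_. real n) x) \<le> C" using \<nu>_V_bounded[OF r(1)] by blast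
  obtain F where F: "\<And>y. \<bar>\<phi> y\<bar> \<le> F" using \<phi>(1) unfolding bounded_borel_def bounded_iff by auto
  have nn: "0 \<le> (LINT x|\<nu>. V r (\<lambda>_. real n) x)" for n
    by (intro Bochner_Integration.integral_nonneg V_const r)
  have "V t (\<lambda>_. real n) x \<le> exp (lam * r) * F * C * (1 + h r)" for n x
  proof -
    have "V t (\<lambda>_. real n) x = V r (V r (\<lambda>_. real n)) x"
      using V_semigroup[OF r(2) r(2) const_bounded_borel, of "real n" x] r by simp
    also have "\<dots> \<le> mean_integral \<beta> r (V r (\<lambda>_. real n)) x"
      by (intro V_le_mean V_const r)
    also have "\<dots> \<le> exp (lam * r) * \<phi> x * (LINT y|\<nu>. V r (\<lambda>_. real n) y) * (1 + h r)"
      by (intro mean_bounds V_const r)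
    also have "\<dots> \<le> exp (lam * r) * F * C * (1 + h r)"
      using F[of x] C[of n] nn[of n] h_nonneg[of r] \<phi>_nonneg[of x]
      by (intro mult_mono mult_nonneg_nonneg order_trans[OF nn C]) auto
    finally show ?thesis .
  qed
  then show ?thesis by blast
qed

lemma ext_rate_limit:
  assumes t: "0 < t"
  shows "(\<lambda>n. V t (\<lambda>_. real n) x) \<longlonglongrightarrow> ext_rate t x"
proof -
  obtain C where "\<And>n x. V t (\<lambda>_. real n) x \<le> C" using V_const_bounded[OF t] by blast
  then have "bdd_above (range (\<lambda>n. V t (\<lambda>_. real n) x))" by (intro bdd_aboveI[where M=C]) auto
  then show ?thesis unfolding ext_rate_def using t by (intro LIMSEQ_incseq_SUP V_const_incseq) auto
qed

lemma ext_rate_nonneg: "0 < t \<Longrightarrow> 0 \<le> ext_rate t x"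
  by (rule LIMSEQ_le_const[OF ext_rate_limit]) (auto intro!: V_const)

lemma ext_rate_bounded_borel:
  assumes t: "0 < t"
  shows "bounded_borel (ext_rate t)"
proof -
  obtain C where C: "\<And>n x. V t (\<lambda>_. real n) x \<le> C" using V_const_bounded[OF t] by blast
  have "ext_rate t x \<le> C" for x by (rule LIMSEQ_le_const2[OF ext_rate_limit[OF t]]) (auto intro: C)
  then have "\<bar>ext_rate t x\<bar> \<le> C" for x using ext_rate_nonneg[OF t, of x] by simp
  moreover have "ext_rate t \<in> borel_measurable borel"
    by (rule borel_measurable_LIMSEQ_real[OF ext_rate_limit[OF t]])
       (use V_const(1)[of t] t in \<open>simp add: bounded_borel_def\<close>)
  ultimately show ?thesis unfolding bounded_borel_def bounded_iff by auto
qed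

lemma extinction_probability:
  assumes t: "0 < t" and \<eta>: "\<eta> \<in> finite_borel_measures"
  shows "measure (Q t \<eta>) {null_measure borel} = exp (- (LINT x|\<eta>. ext_rate t x))"
proof -
  have t0: "0 \<le> t" using t by simp
  obtain C where C: "\<And>n x. V t (\<lambda>_. real n) x \<le> C" using V_const_bounded[OF t] by blast
  interpret finite_measure \<eta> by (rule finite_borel_measure_finite[OF \<eta>])
  have m: "f \<in> borel_measurable \<eta>" if "bounded_borel f" for f :: "'e \<Rightarrow> real"
    using that by (simp add: bounded_borel_def measurable_cong_sets[OF finite_borel_measure_sets[OF \<eta>] refl])
  have "(\<lambda>n. LINT x|\<eta>. V t (\<lambda>_. real n) x) \<longlonglongrightarrow> (LINT x|\<eta>. ext_rate t x)"
    by (rule integral_dominated_convergence[where w="\<lambda>_. C"])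
       (use V_const[OF t0] C ext_rate_limit[OF t] ext_rate_bounded_borel[OF t] in \<open>auto intro!: m\<close>)
  then have "(\<lambda>n. exp (- (LINT x|\<eta>. V t (\<lambda>_. real n) x))) \<longlonglongrightarrow> exp (- (LINT x|\<eta>. ext_rate t x))"
    by (intro tendsto_intros)
  from LIMSEQ_unique[OF extinction_limit[OF \<eta> t0] this] show ?thesis .
qed

lemma ext_rate_semigroup:
  assumes r: "0 \<le> r" and t: "0 < t"
  shows "ext_rate (r + t) x = V r (ext_rate t) x"
proof -
  have t0: "0 \<le> t" and rt: "0 < r + t" "0 \<le> r + t" using r t by auto
  have \<delta>: "return borel x \<in> finite_borel_measures" by (rule return_finite_borel)
  have em: "emeasure (Q q \<eta>) {null_measure borel} = ennreal (exp (- (LINT x|\<eta>. ext_rate q x)))"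
    if "0 < q" "\<eta> \<in> finite_borel_measures" for q \<eta>
    using extinction_probability[OF that] prob_space.finite_measure[OF Q_prob[OF that(2), of q]] that
    by (simp add: finite_measure.emeasure_eq_measure)
  have ind: "(\<integral>\<^sup>+ \<zeta>. indicator {null_measure borel} \<zeta> \<partial>Q q \<eta>) = emeasure (Q q \<eta>) {null_measure borel}"
    if "0 \<le> q" "\<eta> \<in> finite_borel_measures" for q \<eta>
    using null_event Q_sets[OF that(2,1)] by simp
  have "ennreal (exp (- ext_rate (r + t) x)) = emeasure (Q (r + t) (return borel x)) {null_measure borel}"
    using em[OF rt(1) \<delta>] integral_return_bounded[OF ext_rate_bounded_borel[OF rt(1)]] by simp
  also have "\<dots> = (\<integral>\<^sup>+ \<zeta>. (\<integral>\<^sup>+ \<eta>. indicator {null_measure borel} \<eta> \<partial>Q t \<zeta>) \<partial>Q r (return borel x))"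
    unfolding ind[OF rt(2) \<delta>, symmetric]
    by (rule chapman_nn[OF \<delta> r t0 borel_measurable_indicator[OF null_event]])
  also have "\<dots> = (\<integral>\<^sup>+ \<zeta>. ennreal (exp (- (LINT y|\<zeta>. ext_rate t y))) \<partial>Q r (return borel x))"
    by (intro nn_integral_cong) (simp add: ind[OF t0] em[OF t] Q_space[OF \<delta> r])
  also have "\<dots> = ennreal (exp (- V r (ext_rate t) x))"
    using laplace_nn[OF \<delta> r ext_rate_bounded_borel[OF t] ext_rate_nonneg[OF t]]
      integral_return_bounded[OF V_bounded_borel[OF ext_rate_bounded_borel[OF t] ext_rate_nonneg[OF t] r]] by simp
  finally show ?thesis by (simp add: ennreal_inj)
qed

text \<open>The exponent for the superprocess started from \<open>\<nu>\<close>.\<close>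

definition ext_mean :: "real \<Rightarrow> real" where
  "ext_mean t = (LINT x|\<nu>. ext_rate t x)"

lemma ext_rate_pos:
  assumes t: "0 < t"
  shows "0 < ext_rate t x"
proof -
  have "return borel x \<in> finite_borel_measures - {null_measure borel}"
    using return_finite_borel[of x] return_not_null[of x] by blast
  from survival_positive[OF this, of t] t
  have "exp (- ext_rate t x) < 1"
    using extinction_probability[OF t return_finite_borel[of x]] integral_return_bounded[OF ext_rate_bounded_borel[OF t]]
    by simp
  then show ?thesis by simp
qed

lemma ext_mean_pos:
  assumes t: "0 < t"
  shows "0 < ext_mean t"
proof -
  interpret prob_space \<nu> by (rule \<nu>)
  have int: "integrable \<nu> (ext_rate t)"
    by (rule finite_borel_measure_integrable[OF \<nu>_finite_borel ext_rate_bounded_borel[OF t]])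
  have "ext_mean t \<noteq> 0"
  proof
    assume "ext_mean t = 0"
    then have "AE x in \<nu>. ext_rate t x = 0"
      using integral_nonneg_eq_0_iff_AE[OF int] ext_rate_nonneg[OF t] by (simp add: ext_mean_def)
    then have "AE x in \<nu>. False" by eventually_elim (use ext_rate_pos[OF t] in \<open>auto simp: less_le\<close>)
    then show False by simp
  qed
  moreover have "0 \<le> ext_mean t"
    unfolding ext_mean_def by (intro Bochner_Integration.integral_nonneg ext_rate_nonneg t)
  ultimately show ?thesis by simp
qed

lemma ext_rate_upper:
  assumes r: "0 < r" and t: "0 < t"
  shows "ext_rate (r + t) x \<le> exp (lam * r) * \<phi> x * ext_mean t * (1 + h r)"
proof -
  note e = ext_rate_bounded_borel[OF t] ext_rate_nonneg[OF t]
  have "ext_rate (r + t) x \<le> mean_integral \<beta> r (ext_rate t) x"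
    using V_le_mean[OF e, of r x] ext_rate_semigroup[of r t x] r t by simp
  also have "\<dots> \<le> exp (lam * r) * \<phi> x * ext_mean t * (1 + h r)"
    unfolding ext_mean_def by (rule mean_bounds(1)[OF e r])
  finally show ?thesis .
qed

lemma h_small: "0 < e \<Longrightarrow> \<exists>r\<ge>r0. 0 < r \<and> h r \<le> e"
proof -
  assume e: "0 < e"
  have "\<forall>\<^sub>F r in at_top. h r < e" using h_tendsto e by (rule order_tendstoD(2))
  then have "\<forall>\<^sub>F r in at_top. h r < e \<and> max r0 1 \<le> r"
    using eventually_ge_at_top by (rule eventually_conj)
  then obtain r where "h r < e" "max r0 1 \<le> r" using eventually_happens by force
  then show ?thesis by (intro exI[of _ r]) auto
qed

text \<open>Uniform decay: this is where subcriticality enters.\<close>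

lemma ext_rate_small:
  assumes e: "0 < e"
  shows "\<exists>t0>0. \<forall>t\<ge>t0. \<forall>x. ext_rate t x \<le> e"
proof -
  obtain F where F: "\<And>y. \<bar>\<phi> y\<bar> \<le> F" using \<phi>(1) unfolding bounded_borel_def bounded_iff by auto
  have "LIM r at_top. lam * r :> at_bot"
    by (rule filterlim_tendsto_neg_mult_at_bot[OF tendsto_const subcritical filterlim_ident])
  then have "((\<lambda>r. exp (lam * r)) \<longlongrightarrow> 0) at_top" by (rule filterlim_compose[OF exp_at_bot])
  then have "((\<lambda>r. exp (lam * r) * F * ext_mean 1 * (1 + h r)) \<longlongrightarrow> 0 * F * ext_mean 1 * (1 + 0)) at_top"
    by (intro tendsto_intros h_tendsto)
  then have "\<forall>\<^sub>F r in at_top. exp (lam * r) * F * ext_mean 1 * (1 + h r) < e"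
    using e by (intro order_tendstoD(2)) auto
  then obtain r0 where r0: "\<And>r. r0 \<le> r \<Longrightarrow> exp (lam * r) * F * ext_mean 1 * (1 + h r) < e"
    by (auto simp: eventually_at_top_linorder)
  have "ext_rate t x \<le> e" if t: "max r0 1 + 1 \<le> t" for t x
  proof -
    have "ext_rate ((t - 1) + 1) x \<le> exp (lam * (t - 1)) * \<phi> x * ext_mean 1 * (1 + h (t - 1))"
      using t by (intro ext_rate_upper) auto
    also have "\<dots> \<le> exp (lam * (t - 1)) * F * ext_mean 1 * (1 + h (t - 1))"
      using F[of x] ext_mean_pos[of 1] h_nonneg[of "t - 1"] by (intro mult_right_mono mult_left_mono) auto
    also have "\<dots> \<le> e"
    proof -
      have "r0 \<le> t - 1" using t max.cobounded1[of r0 1] by linarith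
      then show ?thesis by (rule less_imp_le[OF r0])
    qed
    finally show ?thesis by simp
  qed
  then show ?thesis by (intro exI[of _ "max r0 1 + 1"]) auto
qed

lemma ext_mean_tendsto: "(ext_mean \<longlongrightarrow> 0) at_top"
proof (rule tendstoI)
  fix e :: real assume "0 < e"
  then obtain t0 where t0: "0 < t0" "\<And>t x. t0 \<le> t \<Longrightarrow> ext_rate t x \<le> e / 2"
    using ext_rate_small[of "e / 2"] by auto
  interpret prob_space \<nu> by (rule \<nu>)
  have "dist (ext_mean t) 0 < e" if "t0 \<le> t" for t
  proof -
    have t: "0 < t" using t0 that by simp
    have "ext_mean t \<le> e / 2"
      unfolding ext_mean_def
      by (rule integral_le_const[OF finite_borel_measure_integrable[OF \<nu>_finite_borel ext_rate_bounded_borel[OF t]]])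
         (use t0 that in simp)
    then show ?thesis using ext_mean_pos[OF t] \<open>0 < e\<close> by simp
  qed
  then show "\<forall>\<^sub>F t in at_top. dist (ext_mean t) 0 < e"
    using eventually_ge_at_top[of t0] by (rule eventually_mono[rotated]) simp
qed

text \<open>For \<open>R\<close> with \<open>h R \<le> 1/2\<close> both comparisons of \<open>V\<^sub>R\<close> with the mean operator are of the order
  \<open>\<phi> ext_mean t\<close>.\<close>

lemma ext_rate_two_sided:
  "\<exists>R>0. \<exists>t0>0. \<exists>c>0. \<exists>C>0. \<forall>t\<ge>t0. \<forall>x.
     c * \<phi> x * ext_mean t \<le> ext_rate (R + t) x \<and> ext_rate (R + t) x \<le> C * \<phi> x * ext_mean t"
proof -
  obtain R where R: "0 < R" "h R \<le> 1 / 2" using h_small[of "1 / 2" 0] by auto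
  obtain t0 where t0: "0 < t0" "\<And>t x. t0 \<le> t \<Longrightarrow> ext_rate t x \<le> 1" using ext_rate_small[of 1] by auto
  obtain k where k: "0 < k" "\<And>f x. bounded_borel f \<Longrightarrow> (\<And>y. 0 \<le> f y \<and> f y \<le> 1) \<Longrightarrow> k * mean_integral \<beta> R f x \<le> V R f x"
    using V_ge_mean[of R] R by auto
  define c where "c = k * (exp (lam * R) * (1 / 2))"
  define C where "C = exp (lam * R) * (1 + h R)"
  have "0 < c" "0 < C" using k h_nonneg[of R] by (auto simp: c_def C_def)
  moreover have "c * \<phi> x * ext_mean t \<le> ext_rate (R + t) x \<and> ext_rate (R + t) x \<le> C * \<phi> x * ext_mean t"
    if t: "t0 \<le> t" for t x
  proof
    have tp: "0 < t" using t t0 by simp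
    note e = ext_rate_bounded_borel[OF tp] ext_rate_nonneg[OF tp]
    have "exp (lam * R) * \<phi> x * ext_mean t * (1 / 2) \<le> exp (lam * R) * \<phi> x * ext_mean t * (1 - h R)"
      using R ext_mean_pos[OF tp] \<phi>_nonneg[of x] by (intro mult_left_mono) auto
    also have "\<dots> \<le> mean_integral \<beta> R (ext_rate t) x"
      unfolding ext_mean_def by (rule mean_bounds(2)[OF e R(1)])
    finally have "k * (exp (lam * R) * \<phi> x * ext_mean t * (1 / 2)) \<le> k * mean_integral \<beta> R (ext_rate t) x"
      using k by (intro mult_left_mono) auto
    also have "\<dots> \<le> V R (ext_rate t) x"
      using k(2)[OF e(1)] e(2) t0(2)[OF t] by simp
    also have "\<dots> = ext_rate (R + t) x" using ext_rate_semigroup[of R t x] R tp by simp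
    finally show "c * \<phi> x * ext_mean t \<le> ext_rate (R + t) x" by (simp add: c_def ac_simps)
    show "ext_rate (R + t) x \<le> C * \<phi> x * ext_mean t"
      using ext_rate_upper[OF R(1) tp, of x] by (simp add: C_def ac_simps)
  qed
  ultimately show ?thesis using R(1) t0(1) by blast
qed

text \<open>The two-sided bound at time \<open>t - R\<close>, integrated against \<open>\<nu>\<close> or evaluated at \<open>x0\<close>, dominates
  \<open>ext_rate t\<close> by quantities at the same time \<open>t\<close>.\<close>

lemma ext_rate_dominated:
  "\<exists>K>0. \<exists>t1>0. \<forall>t\<ge>t1. \<forall>x. ext_rate t x \<le> K * \<phi> x * ext_mean t \<and> ext_rate t x \<le> K * \<phi> x * ext_rate t x0"
proof -
  obtain R t0 c C where *: "0 < R" "0 < t0" "0 < c" "0 < C"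
    and two: "\<And>t x. t0 \<le> t \<Longrightarrow> c * \<phi> x * ext_mean t \<le> ext_rate (R + t) x"
      "\<And>t x. t0 \<le> t \<Longrightarrow> ext_rate (R + t) x \<le> C * \<phi> x * ext_mean t"
    using ext_rate_two_sided by blast
  define K where "K = max (C / c) (C / (c * \<phi> x0))"
  have K: "0 < K" using * by (simp add: K_def less_max_iff_disj)
  have "ext_rate t x \<le> K * \<phi> x * ext_mean t \<and> ext_rate t x \<le> K * \<phi> x * ext_rate t x0" if t: "R + t0 \<le> t" for t x
  proof
    define s where "s = t - R"
    have s: "t0 \<le> s" "R + s = t" "0 < t" "0 < s" using t * by (auto simp: s_def)
    have up: "ext_rate t x \<le> C * \<phi> x * ext_mean s" using two(2)[OF s(1), of x] s by simp
    have "c * ext_mean s = (LINT y|\<nu>. c * \<phi> y * ext_mean s)" using normalized by (simp add: mult.commute mult.left_commute)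
    also have "\<dots> \<le> ext_mean t"
      unfolding ext_mean_def[of t]
      using two(1)[OF s(1)] s(2) finite_borel_measure_integrable[OF \<nu>_finite_borel \<phi>(1)]
        finite_borel_measure_integrable[OF \<nu>_finite_borel ext_rate_bounded_borel[OF s(3)]]
      by (intro integral_mono) auto
    finally have "ext_mean s \<le> ext_mean t / c" using * by (simp add: pos_le_divide_eq mult.commute)
    then have "C * \<phi> x * ext_mean s \<le> C * \<phi> x * (ext_mean t / c)"
      using * \<phi>_nonneg[of x] by (intro mult_left_mono) auto
    also have "\<dots> = (C / c) * (\<phi> x * ext_mean t)" by simp
    also have "\<dots> \<le> K * (\<phi> x * ext_mean t)"
      using ext_mean_pos[OF s(3)] \<phi>_nonneg[of x] by (intro mult_right_mono) (auto simp: K_def)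
    finally show "ext_rate t x \<le> K * \<phi> x * ext_mean t" using up by (simp add: mult.assoc)
    have "ext_mean s \<le> ext_rate t x0 / (c * \<phi> x0)"
      using two(1)[OF s(1), of x0] s(2) * \<phi>(2)[of x0] by (simp add: pos_le_divide_eq mult.commute mult.left_commute)
    then have "C * \<phi> x * ext_mean s \<le> C * \<phi> x * (ext_rate t x0 / (c * \<phi> x0))"
      using * \<phi>_nonneg[of x] by (intro mult_left_mono) auto
    also have "\<dots> = (C / (c * \<phi> x0)) * (\<phi> x * ext_rate t x0)" by simp
    also have "\<dots> \<le> K * (\<phi> x * ext_rate t x0)"
      using ext_rate_nonneg[OF s(3), of x0] \<phi>_nonneg[of x] by (intro mult_right_mono) (auto simp: K_def)
    finally show "ext_rate t x \<le> K * \<phi> x * ext_rate t x0" using up by (simp add: mult.assoc)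
  qed
  then show ?thesis using K * by (intro exI[of _ K] conjI exI[of _ "R + t0"]) auto
qed

text \<open>For fixed \<open>r\<close>, the cumulant operator \<open>V\<^sub>r\<close> acts on \<open>ext_rate t\<close> like the mean operator up to
  \<open>o(ext_mean t)\<close>.\<close>

lemma linearization:
  assumes r: "0 < r" and e: "0 < e"
  shows "\<forall>\<^sub>F t in at_top. mean_integral \<beta> r (ext_rate t) x - ext_rate (r + t) x \<le> e * ext_mean t"
proof -
  have r0: "0 \<le> r" using r by simp
  obtain K t1 where K: "0 < K" "0 < t1" "\<And>t x. t1 \<le> t \<Longrightarrow> ext_rate t x \<le> K * \<phi> x * ext_mean t"
    using ext_rate_dominated[of x] by blast
  have \<delta>: "return borel x \<in> finite_borel_measures" by (rule return_finite_borel)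
  define M where "M = Q r (return borel x)"
  define \<Phi> where "\<Phi> \<eta> = (LINT y|\<eta>. \<phi> y)" for \<eta>
  have [measurable]: "\<Phi> \<in> borel_measurable M" and int: "integrable M \<Phi>"
    using \<phi>_integrable(1)[OF r0, of x] by (auto simp: M_def \<Phi>_def[abs_def])
  have \<Phi>0: "0 \<le> \<Phi> \<eta>" for \<eta> unfolding \<Phi>_def by (rule path_\<phi>_nonneg)
  define s where "s t \<eta> = (exp (- (K * ext_mean t * \<Phi> \<eta>)) - 1 + K * ext_mean t * \<Phi> \<eta>) / ext_mean t" for t \<eta>
  have s_bounds: "0 \<le> s t \<eta>" "s t \<eta> \<le> K * \<Phi> \<eta>" "s t \<eta> \<le> K\<^sup>2 * (\<Phi> \<eta>)\<^sup>2 * ext_mean t" if "0 < t" for t \<eta>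
  proof -
    define a where "a = ext_mean t"
    have a: "0 < a" using ext_mean_pos[OF that] by (simp add: a_def)
    have v: "0 \<le> K * a * \<Phi> \<eta>" using K a \<Phi>0[of \<eta>] by simp
    note b = exp_remainder_bounds[OF v]
    show "0 \<le> s t \<eta>" using b(1) a by (simp add: s_def flip: a_def)
    have "s t \<eta> \<le> (K * a * \<Phi> \<eta>) / a" unfolding s_def a_def[symmetric] using b(2) a by (intro divide_right_mono) auto
    then show "s t \<eta> \<le> K * \<Phi> \<eta>" using a by simp
    have "s t \<eta> \<le> (K * a * \<Phi> \<eta>)\<^sup>2 / a" unfolding s_def a_def[symmetric] using b(3) a by (intro divide_right_mono) auto
    then show "s t \<eta> \<le> K\<^sup>2 * (\<Phi> \<eta>)\<^sup>2 * ext_mean t" using a by (simp add: power2_eq_square field_simps flip: a_def)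
  qed
  have "((\<lambda>t. LINT \<eta>|M. s t \<eta>) \<longlongrightarrow> (LINT \<eta>|M. 0)) at_top"
  proof (rule integral_dominated_convergence_at_top[where w="\<lambda>\<eta>. K * \<Phi> \<eta>"])
    show "s t \<in> borel_measurable M" for t unfolding s_def[abs_def] by measurable
    show "integrable M (\<lambda>\<eta>. K * \<Phi> \<eta>)" using int by simp
    show "AE \<eta> in M. ((\<lambda>t. s t \<eta>) \<longlongrightarrow> 0) at_top"
    proof (rule AE_I2)
      fix \<eta>
      have "((\<lambda>t. K\<^sup>2 * (\<Phi> \<eta>)\<^sup>2 * ext_mean t) \<longlongrightarrow> K\<^sup>2 * (\<Phi> \<eta>)\<^sup>2 * 0) at_top"
        by (intro tendsto_intros ext_mean_tendsto)
      then have lim0: "((\<lambda>t. K\<^sup>2 * (\<Phi> \<eta>)\<^sup>2 * ext_mean t) \<longlongrightarrow> 0) at_top" by simp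
      show "((\<lambda>t. s t \<eta>) \<longlongrightarrow> 0) at_top"
      proof (rule tendsto_sandwich[OF _ _ tendsto_const lim0])
        show "\<forall>\<^sub>F t in at_top. 0 \<le> s t \<eta>"
          using eventually_gt_at_top[of "0 :: real"] by eventually_elim (rule s_bounds(1))
        show "\<forall>\<^sub>F t in at_top. s t \<eta> \<le> K\<^sup>2 * (\<Phi> \<eta>)\<^sup>2 * ext_mean t"
          using eventually_gt_at_top[of "0 :: real"] by eventually_elim (rule s_bounds(3))
      qed
    qed
    show "\<forall>\<^sub>F t in at_top. AE \<eta> in M. norm (s t \<eta>) \<le> K * \<Phi> \<eta>"
      using eventually_gt_at_top[of "0 :: real"] by eventually_elim (use s_bounds in simp)
  qed simp
  then have "((\<lambda>t. LINT \<eta>|M. s t \<eta>) \<longlongrightarrow> 0) at_top" by simp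
  then have "\<forall>\<^sub>F t in at_top. (LINT \<eta>|M. s t \<eta>) < e" using e by (rule order_tendstoD(2))
  then show ?thesis using eventually_ge_at_top[of t1]
  proof eventually_elim
    case (elim t)
    have t: "0 < t" using elim K by simp
    have a: "0 < ext_mean t" by (rule ext_mean_pos[OF t])
    have "mean_integral \<beta> r (ext_rate t) x - ext_rate (r + t) x \<le>
        (LINT \<eta>|M. exp (- (K * ext_mean t * \<Phi> \<eta>)) - 1 + K * ext_mean t * \<Phi> \<eta>)"
      unfolding ext_rate_semigroup[OF r0 t] M_def \<Phi>_def
      using K elim a by (intro defect_le ext_rate_bounded_borel[OF t] ext_rate_nonneg[OF t] r0) (auto simp: ac_simps)
    also have "\<dots> = (LINT \<eta>|M. ext_mean t * s t \<eta>)" using a by (simp add: s_def)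
    also have "\<dots> = ext_mean t * (LINT \<eta>|M. s t \<eta>)" by simp
    also have "\<dots> \<le> ext_mean t * e" using elim a by (intro mult_left_mono) auto
    finally show ?case by (simp add: mult.commute)
  qed
qed

lemma ext_rate_asymp:
  assumes e: "0 < e" and r: "0 < r" and h: "h r \<le> e"
  shows "\<forall>\<^sub>F t in at_top. exp (lam * r) * ext_mean (t - r) * \<phi> x * (1 - 2 * e) \<le> ext_rate t x \<and>
    ext_rate t x \<le> exp (lam * r) * ext_mean (t - r) * \<phi> x * (1 + 2 * e) \<and> 0 < ext_mean (t - r)"
proof -
  define B where "B = exp (lam * r) * \<phi> x"
  have B: "0 < B" using \<phi>(2)[of x] by (simp add: B_def)
  have "\<forall>\<^sub>F t in at_top. 0 < t \<and> mean_integral \<beta> r (ext_rate t) x - ext_rate (r + t) x \<le> (e * B) * ext_mean t"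
    using e B by (intro eventually_conj eventually_gt_at_top linearization r) simp
  then have "\<forall>\<^sub>F t in at_top. B * ext_mean t * (1 - 2 * e) \<le> ext_rate (r + t) x \<and>
      ext_rate (r + t) x \<le> B * ext_mean t * (1 + 2 * e) \<and> 0 < ext_mean t"
  proof eventually_elim
    case (elim t)
    then have t: "0 < t" by simp
    note a = ext_mean_pos[OF t]
    have "B * ext_mean t * (1 - e) \<le> B * ext_mean t * (1 - h r)"
      using B a h by (intro mult_left_mono) auto
    also have "\<dots> \<le> mean_integral \<beta> r (ext_rate t) x"
      unfolding B_def ext_mean_def
      by (rule mean_bounds(2)[OF ext_rate_bounded_borel[OF t] ext_rate_nonneg[OF t] r])
    finally have low: "B * ext_mean t * (1 - 2 * e) \<le> ext_rate (r + t) x"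
      using elim by (simp add: algebra_simps)
    have "ext_rate (r + t) x \<le> B * ext_mean t * (1 + h r)"
      using ext_rate_upper[OF r t, of x] by (simp add: B_def)
    also have "\<dots> \<le> B * ext_mean t * (1 + 2 * e)"
      using B a h e by (intro mult_left_mono) auto
    finally show ?case using low a by simp
  qed
  then obtain t0 where t0: "\<And>t. t0 \<le> t \<Longrightarrow> B * ext_mean t * (1 - 2 * e) \<le> ext_rate (r + t) x \<and>
      ext_rate (r + t) x \<le> B * ext_mean t * (1 + 2 * e) \<and> 0 < ext_mean t"
    by (auto simp: eventually_at_top_linorder)
  show ?thesis
    unfolding eventually_at_top_linorder
  proof (intro exI[of _ "t0 + r"] allI impI)
    fix t assume "t0 + r \<le> t"
    then have "t0 \<le> t - r" by simp
    from t0[OF this] show "exp (lam * r) * ext_mean (t - r) * \<phi> x * (1 - 2 * e) \<le> ext_rate t x \<and>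
      ext_rate t x \<le> exp (lam * r) * ext_mean (t - r) * \<phi> x * (1 + 2 * e) \<and> 0 < ext_mean (t - r)"
      by (simp add: B_def ac_simps)
  qed
qed

theorem ext_rate_ratio: "((\<lambda>t. ext_rate t x / ext_rate t x0) \<longlongrightarrow> \<phi> x / \<phi> x0) at_top"
proof (rule tendstoI)
  fix d :: real assume d: "0 < d"
  define q where "q = \<phi> x / \<phi> x0"
  have q: "0 < q" using \<phi>(2) by (simp add: q_def)
  \<comment> \<open>An error \<open>2e\<close> in numerator and denominator costs at most \<open>8 e q\<close> in the ratio.\<close>
  define e where "e = min (1 / 4) (d / (16 * q))"
  have e: "0 < e" "e \<le> 1 / 4" using d q by (auto simp: e_def)
  have "8 * e * q \<le> 8 * (d / (16 * q)) * q" using q by (intro mult_right_mono mult_left_mono) (auto simp: e_def)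
  also have "\<dots> < d" using q d by simp
  finally have small: "8 * e * q < d" .
  obtain r where r: "0 < r" "h r \<le> e" using h_small[OF e(1), of 0] by auto
  show "\<forall>\<^sub>F t in at_top. dist (ext_rate t x / ext_rate t x0) (\<phi> x / \<phi> x0) < d"
    using ext_rate_asymp[OF e(1) r, of x] ext_rate_asymp[OF e(1) r, of x0]
  proof eventually_elim
    case (elim t)
    have "\<bar>ext_rate t x / ext_rate t x0 - \<phi> x / \<phi> x0\<bar> \<le> 8 * e * (\<phi> x / \<phi> x0)"
      using elim e \<phi>(2) by (intro ratio_bound[of "exp (lam * r) * ext_mean (t - r)"]) auto
    then show ?case using small by (simp add: dist_real_def q_def)
  qed
qed

section \<open>Conditioning on survival\<close>

text \<open>The Markov property at time \<open>s\<close> and \<open>extinction_probability\<close> for the remaining time.\<close>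

lemma survival_formula:
  assumes \<mu>: "\<mu> \<in> finite_borel_measures" and s: "0 \<le> s" "s < t"
    and Hm: "Hf \<in> borel_measurable (path_sigma {0..s})" and Hb: "\<And>w. w \<in> right_continuous_paths \<Longrightarrow> 0 \<le> Hf w \<and> Hf w \<le> C"
  shows "(LINT w|\<P> \<mu>. indicator (survival t) w * Hf w) =
    (LINT w|\<P> \<mu>. Hf w * (1 - exp (- (LINT x|w s. ext_rate (t - s) x))))"
proof -
  interpret prob_space "\<P> \<mu>" by (rule path_law_prob[OF \<mu>])
  have ts: "0 < t - s" "0 \<le> t - s" "s + (t - s) = t" "0 \<le> t" using s by auto
  have msr: "measurable (\<P> \<mu>) N = measurable (path_sigma {0..}) N" for N :: "real measure"
    by (rule measurable_cong_sets) (simp_all add: path_law_sets[OF \<mu>])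
  have Hm': "Hf \<in> borel_measurable (path_sigma {0..})"
    using Hm by (rule path_filt_measurable)
  define E where "E w = exp (- (LINT x|w s. ext_rate (t - s) x))" for w :: "real \<Rightarrow> 'e measure"
  define I :: "(real \<Rightarrow> 'e measure) \<Rightarrow> real" where "I w = indicator {null_measure borel} (w t)" for w
  have Em: "E \<in> borel_measurable (path_sigma {0..})"
    unfolding E_def[abs_def]
    using measurable_compose[OF evaluation_measurable_all[OF s(1)]
      laplace_measurable[OF ext_rate_bounded_borel[OF ts(1)] ext_rate_nonneg[OF ts(1)]]] .
  have Im: "I \<in> borel_measurable (path_sigma {0..})"
    unfolding I_def[abs_def]
    using measurable_compose[OF evaluation_measurable_all[OF ts(4)] borel_measurable_indicator[OF null_event]] .
  have E01: "0 \<le> E w" "E w \<le> 1" for w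
    using Bochner_Integration.integral_nonneg[of "w s" "ext_rate (t - s)"] ext_rate_nonneg[OF ts(1)] by (auto simp: E_def)
  have I01: "0 \<le> I w" "I w \<le> 1" for w by (auto simp: I_def indicator_def)
  note sp = path_law_space[OF \<mu>]
  have intg: "integrable (\<P> \<mu>) (\<lambda>w. Hf w * g w)"
    if "g \<in> borel_measurable (path_sigma {0..})" "\<And>w. 0 \<le> g w" "\<And>w. g w \<le> 1" for g
  proof (rule integrable_const_bound[of _ C])
    show "(\<lambda>w. Hf w * g w) \<in> borel_measurable (\<P> \<mu>)" using Hm' that unfolding msr by measurable
    show "AE w in \<P> \<mu>. norm (Hf w * g w) \<le> C"
    proof (rule AE_I2)
      fix w assume "w \<in> space (\<P> \<mu>)"
      then have "0 \<le> Hf w" "Hf w \<le> C" using Hb sp by auto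
      then have "Hf w * g w \<le> C * 1" using that by (intro mult_mono) auto
      then show "norm (Hf w * g w) \<le> C" using that \<open>0 \<le> Hf w\<close> by simp
    qed
  qed
  have "(LINT w|\<P> \<mu>. Hf w * I w) = (LINT w|\<P> \<mu>. Hf w * E w)"
  proof -
    have "(\<integral>\<^sup>+ w. ennreal (Hf w) * indicator {null_measure borel} (w (s + (t - s))) \<partial>\<P> \<mu>) =
        (\<integral>\<^sup>+ w. ennreal (Hf w) * (\<integral>\<^sup>+ \<eta>. indicator {null_measure borel} \<eta> \<partial>Q (t - s) (w s)) \<partial>\<P> \<mu>)"
      using Hm by (intro markov_paths[OF \<mu> s(1) ts(2)] borel_measurable_indicator null_event) measurable
    also have "\<dots> = (\<integral>\<^sup>+ w. ennreal (Hf w) * ennreal (E w) \<partial>\<P> \<mu>)"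
    proof (rule nn_integral_cong)
      fix w assume "w \<in> space (\<P> \<mu>)"
      then have w: "w s \<in> finite_borel_measures" using path_value[of w s] s sp by simp
      have "(\<integral>\<^sup>+ \<eta>. indicator {null_measure borel} \<eta> \<partial>Q (t - s) (w s)) = emeasure (Q (t - s) (w s)) {null_measure borel}"
        using null_event Q_sets[OF w ts(2)] by simp
      also have "\<dots> = ennreal (E w)"
        using extinction_probability[OF ts(1) w] prob_space.finite_measure[OF Q_prob[OF w ts(2)]]
        by (simp add: finite_measure.emeasure_eq_measure E_def)
      finally show "ennreal (Hf w) * (\<integral>\<^sup>+ \<eta>. indicator {null_measure borel} \<eta> \<partial>Q (t - s) (w s)) = ennreal (Hf w) * ennreal (E w)"
        by simp
    qed
    finally have nn: "(\<integral>\<^sup>+ w. ennreal (Hf w) * indicator {null_measure borel} (w t) \<partial>\<P> \<mu>) =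
       (\<integral>\<^sup>+ w. ennreal (Hf w) * ennreal (E w) \<partial>\<P> \<mu>)" by (simp add: ts)
    have "(LINT w|\<P> \<mu>. Hf w * I w) = enn2real (\<integral>\<^sup>+ w. ennreal (Hf w * I w) \<partial>\<P> \<mu>)"
      by (rule integral_eq_nn_integral)
         (use intg[OF Im I01] Hb sp I01 in \<open>auto intro!: AE_I2 mult_nonneg_nonneg\<close>)
    also have "(\<integral>\<^sup>+ w. ennreal (Hf w * I w) \<partial>\<P> \<mu>) = (\<integral>\<^sup>+ w. ennreal (Hf w * E w) \<partial>\<P> \<mu>)"
      using nn Hb sp E01 I01
      by (simp add: ennreal_mult I_def cong: nn_integral_cong_simp) (auto simp: ennreal_indicator)
    also have "enn2real \<dots> = (LINT w|\<P> \<mu>. Hf w * E w)"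
      by (rule integral_eq_nn_integral[symmetric])
         (use intg[OF Em E01] Hb sp E01 in \<open>auto intro!: AE_I2 mult_nonneg_nonneg\<close>)
    finally show ?thesis .
  qed
  moreover have "(LINT w|\<P> \<mu>. indicator (survival t) w * Hf w) = (LINT w|\<P> \<mu>. Hf w * 1 - Hf w * I w)"
    by (intro Bochner_Integration.integral_cong) (auto simp: survival_def sp I_def indicator_def)
  moreover have "(LINT w|\<P> \<mu>. Hf w * (1 - E w)) = (LINT w|\<P> \<mu>. Hf w * 1 - Hf w * E w)"
    by (simp add: algebra_simps)
  ultimately show ?thesis
    using intg[OF Im I01] intg[OF Em E01] intg[of "\<lambda>_. 1"] by (simp add: E_def)
qed

lemma survival_event:
  assumes \<mu>: "\<mu> \<in> finite_borel_measures" and t: "0 \<le> t"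
  shows "survival t \<in> sets (\<P> \<mu>)"
proof -
  have "(\<lambda>w. w t) -` (space states - {null_measure borel}) \<inter> space (path_sigma {0..}) \<in> sets (path_sigma {0..})"
    by (intro measurable_sets[OF evaluation_measurable_all[OF t]] sets.compl_sets null_event)
  moreover have "(\<lambda>w. w t) -` (space states - {null_measure borel}) \<inter> space (path_sigma {0..}) = survival t"
    using path_value[OF _ t] by (auto simp: survival_def space_paths topspace_weak_topology)
  ultimately show ?thesis by (simp add: path_law_sets[OF \<mu>])
qed

lemma survival_measure_pos:
  assumes \<mu>: "\<mu> \<in> finite_borel_measures - {null_measure borel}" and t: "0 \<le> t"
  shows "0 < measure (\<P> \<mu>) (survival t)"
proof -
  have m: "\<mu> \<in> finite_borel_measures" using \<mu> by simp
  interpret prob_space "\<P> \<mu>" by (rule path_law_prob[OF m])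
  have "prob (survival t) \<noteq> 0"
  proof
    assume "prob (survival t) = 0"
    then have "AE w in \<P> \<mu>. w \<notin> survival t"
      using survival_event[OF m t] by (simp add: prob_eq_0)
    then have "AE w in \<P> \<mu>. ennreal (LINT x|w t. \<phi> x) = 0"
      using AE_space by eventually_elim (auto simp: survival_def path_law_space[OF m])
    then have "(\<integral>\<^sup>+ w. ennreal (LINT x|w t. \<phi> x) \<partial>\<P> \<mu>) = (\<integral>\<^sup>+ w. 0 \<partial>\<P> \<mu>)" by (rule nn_integral_cong_AE)
    then show False using \<phi>_moment_paths[OF \<mu> t] \<phi>_mass_pos[OF \<mu>] by simp
  qed
  then show ?thesis by (simp add: less_le)
qed

lemma conditioned_integral:
  assumes \<mu>: "\<mu> \<in> finite_borel_measures - {null_measure borel}" and t: "0 \<le> t"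
    and Hm: "Hf \<in> borel_measurable (path_sigma {0..})"
  shows "(LINT w|conditioned_law \<P> t \<mu>. Hf w) =
    (LINT w|\<P> \<mu>. indicator (survival t) w * Hf w) / measure (\<P> \<mu>) (survival t)"
proof -
  have m: "\<mu> \<in> finite_borel_measures" using \<mu> by simp
  interpret prob_space "\<P> \<mu>" by (rule path_law_prob[OF m])
  define p where "p = prob (survival t)"
  have p: "0 < p" using survival_measure_pos[OF \<mu> t] by (simp add: p_def)
  note [measurable_cong] = path_law_sets[OF m]
  have [measurable]: "survival t \<in> sets (\<P> \<mu>)" "Hf \<in> borel_measurable (\<P> \<mu>)"
    using survival_event[OF m t] Hm by (simp_all add: measurable_cong_sets[OF path_law_sets[OF m] refl])
  have "conditioned_law \<P> t \<mu> = density (\<P> \<mu>) (\<lambda>w. ennreal (indicator (survival t) w / p))"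
    unfolding conditioned_law_def uniform_measure_def
    using p by (intro density_cong) (auto simp: emeasure_eq_measure p_def indicator_def divide_ennreal simp flip: ennreal_1 intro!: AE_I2)
  then have "(LINT w|conditioned_law \<P> t \<mu>. Hf w) = (LINT w|\<P> \<mu>. (indicator (survival t) w / p) * Hf w)"
    using p by (simp add: integral_density)
  also have "\<dots> = (LINT w|\<P> \<mu>. (indicator (survival t) w * Hf w) / p)" by simp
  also have "\<dots> = (LINT w|\<P> \<mu>. indicator (survival t) w * Hf w) / p" by (rule integral_divide_zero)
  finally show ?thesis by (simp add: p_def)
qed

lemma path_law_conditioned:
  assumes \<mu>: "\<mu> \<in> finite_borel_measures - {null_measure borel}" and t: "0 \<le> t"
  shows "path_law (conditioned_law \<P> t \<mu>)"
proof -
  have m: "\<mu> \<in> finite_borel_measures" using \<mu> by simp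
  interpret prob_space "\<P> \<mu>" by (rule path_law_prob[OF m])
  have "prob_space (conditioned_law \<P> t \<mu>)"
    unfolding conditioned_law_def using survival_measure_pos[OF \<mu> t]
    by (intro prob_space_uniform_measure) (auto simp: emeasure_eq_measure)
  then show ?thesis
    by (simp add: path_law_def conditioned_law_def path_law_sets[OF m])
qed

text \<open>The numerator of the conditional expectation, normalised by \<open>ext_rate\<close> at a reference point.\<close>

lemma normalised_survival_limit:
  assumes \<mu>: "\<mu> \<in> finite_borel_measures - {null_measure borel}" and s: "0 \<le> s"
    and Hm: "Hf \<in> borel_measurable (path_sigma {0..s})" and Hb: "\<And>w. w \<in> right_continuous_paths \<Longrightarrow> 0 \<le> Hf w \<and> Hf w \<le> C"
  shows "((\<lambda>t. (LINT w|\<P> \<mu>. indicator (survival t) w * Hf w) / ext_rate (t - s) x0) \<longlongrightarrow>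
    (LINT w|\<P> \<mu>. Hf w * (LINT x|w s. \<phi> x)) / \<phi> x0) at_top"
proof -
  have m: "\<mu> \<in> finite_borel_measures" using \<mu> by simp
  interpret prob_space "\<P> \<mu>" by (rule path_law_prob[OF m])
  note sp = path_law_space[OF m]
  have msr: "measurable (\<P> \<mu>) N = measurable (path_sigma {0..}) N" for N :: "real measure"
    by (rule measurable_cong_sets) (simp_all add: path_law_sets[OF m])
  have Hm': "Hf \<in> borel_measurable (\<P> \<mu>)"
    unfolding msr using Hm by (rule path_filt_measurable)
  obtain K t1 where K: "0 < K" "0 < t1" "\<And>t x. t1 \<le> t \<Longrightarrow> ext_rate t x \<le> K * \<phi> x * ext_rate t x0"
    using ext_rate_dominated[of x0] by blast
  define \<Phi> where "\<Phi> w = (LINT x|w s. \<phi> x)" for w :: "real \<Rightarrow> 'e measure"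
  have \<Phi>m[measurable]: "\<Phi> \<in> borel_measurable (\<P> \<mu>)"
    using path_\<phi>_measurable[OF s] by (simp add: \<Phi>_def[abs_def] msr)
  have \<Phi>0: "0 \<le> \<Phi> w" for w unfolding \<Phi>_def by (rule path_\<phi>_nonneg)
  have \<Phi>i: "integrable (\<P> \<mu>) \<Phi>"
    using \<phi>_moment_paths[OF \<mu> s] by (intro integrableI_nonneg) (auto simp: \<Phi>_def \<Phi>m path_\<phi>_nonneg)
  \<comment> \<open>The maximum keeps the time argument positive, so that \<open>S t\<close> is measurable for every \<open>t\<close>; it has no
    effect once \<open>t \<ge> s + 1\<close>.\<close>
  define S where "S t w = Hf w * ((1 - exp (- (LINT x|w s. ext_rate (max 1 (t - s)) x))) / ext_rate (max 1 (t - s)) x0)" for t w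
  have pos1: "0 < max 1 (t - s)" for t by simp
  have Sm: "S t \<in> borel_measurable (\<P> \<mu>)" for t
  proof -
    have "(\<lambda>w. exp (- (LINT x|w s. ext_rate (max 1 (t - s)) x))) \<in> borel_measurable (\<P> \<mu>)"
      unfolding msr
      using measurable_compose[OF evaluation_measurable_all[OF s]
        laplace_measurable[OF ext_rate_bounded_borel[OF pos1] ext_rate_nonneg[OF pos1]]] .
    then show ?thesis unfolding S_def[abs_def] using Hm' by measurable
  qed
  have rate: "(LINT x|w s. ext_rate t x) / ext_rate t x0 \<le> K * \<Phi> w" "0 \<le> (LINT x|w s. ext_rate t x)"
    if t: "t1 \<le> t" and w: "w \<in> right_continuous_paths" for t w
  proof -
    have tp: "0 < t" using t K by simp
    have ws: "w s \<in> finite_borel_measures" by (rule path_value[OF w s])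
    have "(LINT x|w s. ext_rate t x) \<le> (LINT x|w s. K * \<phi> x * ext_rate t x0)"
      using K(3)[OF t] finite_borel_measure_integrable[OF ws ext_rate_bounded_borel[OF tp]]
        finite_borel_measure_integrable[OF ws \<phi>(1)]
      by (intro integral_mono) auto
    then show "(LINT x|w s. ext_rate t x) / ext_rate t x0 \<le> K * \<Phi> w"
      using ext_rate_pos[OF tp, of x0] by (simp add: \<Phi>_def pos_divide_le_eq)
    show "0 \<le> (LINT x|w s. ext_rate t x)" by (intro Bochner_Integration.integral_nonneg ext_rate_nonneg tp)
  qed
  have lim: "((\<lambda>t. S t w) \<longlongrightarrow> Hf w * (\<Phi> w / \<phi> x0)) at_top" if w: "w \<in> right_continuous_paths" for w
  proof -
    have ws: "w s \<in> finite_borel_measures" by (rule path_value[OF w s])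
    note wm = measurable_cong_sets[OF finite_borel_measure_sets[OF ws] refl]
    define L where "L t = (LINT x|w s. ext_rate (max 1 t) x)" for t
    define y where "y t = ext_rate (max 1 t) x0" for t
    have yp: "0 < y t" for t by (simp add: y_def ext_rate_pos)
    have L0: "0 \<le> L t" for t unfolding L_def by (intro Bochner_Integration.integral_nonneg ext_rate_nonneg) simp
    have ratio: "((\<lambda>t. L t / y t) \<longlongrightarrow> \<Phi> w / \<phi> x0) at_top"
    proof -
      have "((\<lambda>t. LINT x|w s. ext_rate (max 1 t) x / y t) \<longlongrightarrow> (LINT x|w s. \<phi> x / \<phi> x0)) at_top"
      proof (rule integral_dominated_convergence_at_top[where w="\<lambda>x. K * \<phi> x"])
        show "(\<lambda>x. \<phi> x / \<phi> x0) \<in> borel_measurable (w s)" by (simp add: wm)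
        show "(\<lambda>x. ext_rate (max 1 t) x / y t) \<in> borel_measurable (w s)" for t
        proof -
          have "0 < max 1 t" by simp
          from ext_rate_bounded_borel[OF this] have "ext_rate (max 1 t) \<in> borel_measurable (w s)"
            by (simp add: wm bounded_borel_def)
          then show ?thesis by measurable
        qed
        show "integrable (w s) (\<lambda>x. K * \<phi> x)"
          using finite_borel_measure_integrable[OF ws \<phi>(1)] by simp
        have ev: "\<forall>\<^sub>F t in at_top. max 1 t = (t :: real)"
          using eventually_ge_at_top[of "1 :: real"] by eventually_elim simp
        show "AE x in w s. ((\<lambda>t. ext_rate (max 1 t) x / y t) \<longlongrightarrow> \<phi> x / \<phi> x0) at_top"
        proof (rule AE_I2)
          fix x
          have "\<forall>\<^sub>F t in at_top. ext_rate (max 1 t) x / y t = ext_rate t x / ext_rate t x0"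
            using ev by eventually_elim (simp add: y_def)
          then show "((\<lambda>t. ext_rate (max 1 t) x / y t) \<longlongrightarrow> \<phi> x / \<phi> x0) at_top"
            using ext_rate_ratio[of x x0] by (simp add: tendsto_cong)
        qed
        show "\<forall>\<^sub>F t in at_top. AE x in w s. norm (ext_rate (max 1 t) x / y t) \<le> K * \<phi> x"
          using eventually_ge_at_top[of "max 1 t1"]
        proof eventually_elim
          case (elim t)
          then have "max 1 t = t" "t1 \<le> t" "0 < t" by auto
          then show ?case
            using K(3)[of t] ext_rate_pos[of t x0] ext_rate_nonneg[of t]
            by (auto simp: y_def pos_divide_le_eq abs_divide)
        qed
      qed
      then show ?thesis by (simp add: L_def \<Phi>_def)
    qed
    have y0: "(y \<longlongrightarrow> 0) at_top"
    proof (rule tendstoI)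
      fix e :: real assume "0 < e"
      then obtain t0 where t0: "0 < t0" "\<And>t x. t0 \<le> t \<Longrightarrow> ext_rate t x \<le> e / 2" using ext_rate_small[of "e / 2"] by auto
      show "\<forall>\<^sub>F t in at_top. dist (y t) 0 < e"
        using eventually_ge_at_top[of t0]
      proof eventually_elim
        case (elim t)
        have "y t \<le> e / 2" unfolding y_def using elim by (intro t0) simp
        then show ?case using yp[of t] \<open>0 < e\<close> by simp
      qed
    qed
    have bounds: "L t / y t - (L t / y t) * (L t / y t) * y t \<le> (1 - exp (- L t)) / y t"
      "(1 - exp (- L t)) / y t \<le> L t / y t" for t
    proof -
      have "L t - (L t)\<^sup>2 \<le> 1 - exp (- L t)" "1 - exp (- L t) \<le> L t"
        using exp_remainder_bounds[OF L0[of t]] by auto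
      then show "(1 - exp (- L t)) / y t \<le> L t / y t" using yp[of t] by (intro divide_right_mono) auto
      have "L t / y t - (L t / y t) * (L t / y t) * y t = (L t - (L t)\<^sup>2) / y t"
        using yp[of t] by (simp add: power2_eq_square diff_divide_distrib)
      also have "\<dots> \<le> (1 - exp (- L t)) / y t"
        using \<open>L t - (L t)\<^sup>2 \<le> 1 - exp (- L t)\<close> yp[of t] by (intro divide_right_mono) auto
      finally show "L t / y t - (L t / y t) * (L t / y t) * y t \<le> (1 - exp (- L t)) / y t" .
    qed
    have "((\<lambda>t. L t / y t - (L t / y t) * (L t / y t) * y t) \<longlongrightarrow>
        \<Phi> w / \<phi> x0 - (\<Phi> w / \<phi> x0) * (\<Phi> w / \<phi> x0) * 0) at_top"
      by (intro tendsto_diff tendsto_mult ratio y0)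
    then have low: "((\<lambda>t. L t / y t - (L t / y t) * (L t / y t) * y t) \<longlongrightarrow> \<Phi> w / \<phi> x0) at_top" by simp
    have "((\<lambda>t. (1 - exp (- L t)) / y t) \<longlongrightarrow> \<Phi> w / \<phi> x0) at_top"
      by (rule tendsto_sandwich[OF _ _ low ratio]) (intro always_eventually allI bounds)+
    moreover have "LIM t at_top. t - s :> at_top"
      using filterlim_tendsto_add_at_top[OF tendsto_const[of "- s"] filterlim_ident] by simp
    ultimately have "((\<lambda>t. (1 - exp (- L (t - s))) / y (t - s)) \<longlongrightarrow> \<Phi> w / \<phi> x0) at_top"
      by (rule filterlim_compose)
    then show ?thesis unfolding S_def L_def y_def by (intro tendsto_mult tendsto_const)
  qed
  have "((\<lambda>t. LINT w|\<P> \<mu>. S t w) \<longlongrightarrow> (LINT w|\<P> \<mu>. Hf w * (\<Phi> w / \<phi> x0))) at_top"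
  proof (rule integral_dominated_convergence_at_top[where w="\<lambda>w. C * (K * \<Phi> w)"])
    show "(\<lambda>w. Hf w * (\<Phi> w / \<phi> x0)) \<in> borel_measurable (\<P> \<mu>)" using Hm' by measurable
    show "S t \<in> borel_measurable (\<P> \<mu>)" for t by (rule Sm)
    show "integrable (\<P> \<mu>) (\<lambda>w. C * (K * \<Phi> w))" using \<Phi>i by simp
    show "AE w in \<P> \<mu>. ((\<lambda>t. S t w) \<longlongrightarrow> Hf w * (\<Phi> w / \<phi> x0)) at_top"
      by (rule AE_I2, rule lim) (simp add: sp)
    show "\<forall>\<^sub>F t in at_top. AE w in \<P> \<mu>. norm (S t w) \<le> C * (K * \<Phi> w)"
      using eventually_ge_at_top[of "s + max 1 t1"]
    proof eventually_elim
      case (elim t)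
      show ?case
      proof (rule AE_I2)
        fix w assume "w \<in> space (\<P> \<mu>)"
        then have w: "w \<in> right_continuous_paths" by (simp add: sp)
        have t: "max 1 (t - s) = t - s" "t1 \<le> t - s" "0 < t - s" using elim by auto
        define L where "L = (LINT x|w s. ext_rate (t - s) x)"
        define y where "y = ext_rate (t - s) x0"
        have y: "0 < y" using ext_rate_pos[OF t(3)] by (simp add: y_def)
        have L: "0 \<le> L" "L / y \<le> K * \<Phi> w" using rate[OF t(2) w] by (auto simp: L_def y_def)
        have "(1 - exp (- L)) / y \<le> L / y"
          using exp_ge_add_one_self[of "- L"] y by (intro divide_right_mono) auto
        then have "(1 - exp (- L)) / y \<le> K * \<Phi> w" using L by simp
        moreover have "0 \<le> (1 - exp (- L)) / y" using L y by simp
        ultimately have "Hf w * ((1 - exp (- L)) / y) \<le> C * (K * \<Phi> w)"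
          using Hb[OF w] by (intro mult_mono) auto
        moreover have "S t w = Hf w * ((1 - exp (- L)) / y)" by (simp add: S_def t L_def y_def)
        moreover have "0 \<le> Hf w * ((1 - exp (- L)) / y)"
          using Hb[OF w] \<open>0 \<le> (1 - exp (- L)) / y\<close> by (intro mult_nonneg_nonneg) auto
        ultimately show "norm (S t w) \<le> C * (K * \<Phi> w)" by simp
      qed
    qed
  qed
  moreover have "\<forall>\<^sub>F t in at_top. (LINT w|\<P> \<mu>. S t w) =
      (LINT w|\<P> \<mu>. indicator (survival t) w * Hf w) / ext_rate (t - s) x0"
    using eventually_ge_at_top[of "s + 1"]
  proof eventually_elim
    case (elim t)
    then have t: "max 1 (t - s) = t - s" "s < t" by auto
    have "(LINT w|\<P> \<mu>. S t w) = (LINT w|\<P> \<mu>. (Hf w * (1 - exp (- (LINT x|w s. ext_rate (t - s) x)))) / ext_rate (t - s) x0)"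
      by (simp add: S_def t)
    also have "\<dots> = (LINT w|\<P> \<mu>. Hf w * (1 - exp (- (LINT x|w s. ext_rate (t - s) x)))) / ext_rate (t - s) x0"
      by (rule integral_divide_zero)
    also have "(LINT w|\<P> \<mu>. Hf w * (1 - exp (- (LINT x|w s. ext_rate (t - s) x)))) =
        (LINT w|\<P> \<mu>. indicator (survival t) w * Hf w)"
      by (rule survival_formula[OF m s t(2) Hm Hb, symmetric])
    finally show ?case .
  qed
  ultimately show ?thesis
    by (simp add: tendsto_cong \<Phi>_def)
qed

theorem conditioned_laws_converge:
  assumes \<mu>: "\<mu> \<in> finite_borel_measures - {null_measure borel}"
  shows "converges_locally_strongly (\<lambda>t. conditioned_law \<P> t \<mu>) (\<P>inf \<mu>)"
  unfolding converges_locally_strongly_def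
proof (intro conjI allI impI)
  show "path_law (conditioned_law \<P> t \<mu>)" if "0 \<le> t" for t by (rule path_law_conditioned[OF \<mu> that])
  show "path_law (\<P>inf \<mu>)" using limit_law[OF \<mu>] by (simp add: is_phi_transform_def)
next
  fix s :: real and Hf :: "(real \<Rightarrow> 'e measure) \<Rightarrow> real"
  assume s: "0 \<le> s" and Hf: "Hf \<in> borel_measurable (path_sigma {0..s}) \<and> (\<exists>C. \<forall>w\<in>right_continuous_paths. 0 \<le> Hf w \<and> Hf w \<le> C)"
  then obtain C where Hm: "Hf \<in> borel_measurable (path_sigma {0..s})"
    and Hb: "\<And>w. w \<in> right_continuous_paths \<Longrightarrow> 0 \<le> Hf w \<and> Hf w \<le> C" by blast
  have m: "\<mu> \<in> finite_borel_measures" using \<mu> by simp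
  interpret prob_space "\<P> \<mu>" by (rule path_law_prob[OF m])
  have Hm': "Hf \<in> borel_measurable (path_sigma {0..})"
    using Hm by (rule path_filt_measurable)
  have Hm'': "Hf \<in> borel_measurable (\<P> \<mu>)"
    using Hm' by (simp add: measurable_cong_sets[OF path_law_sets[OF m] refl])
  define x0 :: 'e where "x0 = undefined"
  define D where "D = exp (lam * s) * (LINT x|\<mu>. \<phi> x)"
  have D: "0 < D" using \<phi>_mass_pos[OF \<mu>] by (simp add: D_def)
  define N where "N t = (LINT w|\<P> \<mu>. indicator (survival t) w * Hf w)" for t
  define p where "p t = measure (\<P> \<mu>) (survival t)" for t
  define G where "G = (LINT w|\<P> \<mu>. Hf w * (LINT x|w s. \<phi> x))"
  have \<Phi>m: "(\<lambda>w. LINT x|w s. \<phi> x) \<in> borel_measurable (\<P> \<mu>)"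
    using path_\<phi>_measurable[OF s] by (simp add: measurable_cong_sets[OF path_law_sets[OF m] refl])
  have mean: "(LINT w|\<P> \<mu>. (LINT x|w s. \<phi> x)) = D"
    using integral_eq_nn_integral[OF \<Phi>m] \<phi>_moment_paths[OF \<mu> s] D by (simp add: path_\<phi>_nonneg D_def)
  have num: "((\<lambda>t. N t / ext_rate (t - s) x0) \<longlongrightarrow> G / \<phi> x0) at_top"
    unfolding N_def G_def by (rule normalised_survival_limit[OF \<mu> s Hm Hb])
  have "((\<lambda>t. (LINT w|\<P> \<mu>. indicator (survival t) w * 1) / ext_rate (t - s) x0) \<longlongrightarrow>
      (LINT w|\<P> \<mu>. 1 * (LINT x|w s. \<phi> x)) / \<phi> x0) at_top"
    by (rule normalised_survival_limit[OF \<mu> s, where C=1]) auto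
  moreover have "\<forall>\<^sub>F t in at_top. (LINT w|\<P> \<mu>. indicator (survival t) w * 1) / ext_rate (t - s) x0 = p t / ext_rate (t - s) x0"
    using eventually_ge_at_top[of "0 :: real"]
    by eventually_elim (use sets.Int_space_eq2[OF survival_event[OF m]] in \<open>simp add: p_def\<close>)
  ultimately have "((\<lambda>t. p t / ext_rate (t - s) x0) \<longlongrightarrow> (LINT w|\<P> \<mu>. 1 * (LINT x|w s. \<phi> x)) / \<phi> x0) at_top"
    by (rule Lim_transform_eventually)
  then have den: "((\<lambda>t. p t / ext_rate (t - s) x0) \<longlongrightarrow> D / \<phi> x0) at_top"
    by (simp add: mean)
  have quotient: "((\<lambda>t. (N t / ext_rate (t - s) x0) / (p t / ext_rate (t - s) x0)) \<longlongrightarrow> (G / \<phi> x0) / (D / \<phi> x0)) at_top"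
    by (rule tendsto_divide[OF num den]) (use D \<phi>(2)[of x0] in simp)
  have cancel: "(G / \<phi> x0) / (D / \<phi> x0) = G / D" using \<phi>(2)[of x0] by simp
  have "\<forall>\<^sub>F t in at_top. (N t / ext_rate (t - s) x0) / (p t / ext_rate (t - s) x0) = (LINT w|conditioned_law \<P> t \<mu>. Hf w)"
    using eventually_ge_at_top[of "s + 1"]
  proof eventually_elim
    case (elim t)
    then have "0 < t - s" "0 \<le> t" using s by auto
    then show ?case
      using ext_rate_pos[of "t - s" x0] conditioned_integral[OF \<mu> _ Hm', of t] by (simp add: N_def p_def)
  qed
  from Lim_transform_eventually[OF quotient this]
  have lim: "((\<lambda>t. LINT w|conditioned_law \<P> t \<mu>. Hf w) \<longlongrightarrow> G / D) at_top"
    by (simp only: cancel)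
  have "(LINT w|\<P>inf \<mu>. Hf w) = G / D"
  proof -
    note R = limit_law[OF \<mu>, unfolded is_phi_transform_def path_law_def]
    have Rs: "sets (\<P>inf \<mu>) = sets (path_sigma {0..})" using R by simp
    have Rsp: "space (\<P>inf \<mu>) = right_continuous_paths"
      using sets_eq_imp_space_eq[OF Rs] by (simp add: space_paths)
    have HR: "Hf \<in> borel_measurable (\<P>inf \<mu>)" using Hm' by (simp add: measurable_cong_sets[OF Rs refl])
    have "(LINT w|\<P>inf \<mu>. Hf w) = enn2real (\<integral>\<^sup>+ w. ennreal (Hf w) \<partial>\<P>inf \<mu>)"
      by (rule integral_eq_nn_integral[OF HR]) (use Hb Rsp in auto)
    also have "(\<integral>\<^sup>+ w. ennreal (Hf w) \<partial>\<P>inf \<mu>) = (\<integral>\<^sup>+ w. ennreal ((LINT x|w s. \<phi> x) / D) * ennreal (Hf w) \<partial>\<P> \<mu>)"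
    proof -
      have "(\<lambda>w. ennreal (Hf w)) \<in> borel_measurable (path_sigma {0..s})" using Hm by measurable
      then show ?thesis using R s unfolding D_def by blast
    qed
    also have "\<dots> = (\<integral>\<^sup>+ w. ennreal ((Hf w * (LINT x|w s. \<phi> x)) / D) \<partial>\<P> \<mu>)"
    proof (rule nn_integral_cong)
      fix w assume "w \<in> space (\<P> \<mu>)"
      then have "0 \<le> Hf w" using Hb path_law_space[OF m] by auto
      then show "ennreal ((LINT x|w s. \<phi> x) / D) * ennreal (Hf w) = ennreal ((Hf w * (LINT x|w s. \<phi> x)) / D)"
        using D path_\<phi>_nonneg by (simp add: mult.commute flip: ennreal_mult)
    qed
    also have "enn2real \<dots> = (LINT w|\<P> \<mu>. (Hf w * (LINT x|w s. \<phi> x)) / D)"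
      by (rule integral_eq_nn_integral[symmetric])
         (use Hm'' \<Phi>m D Hb path_law_space[OF m] path_\<phi>_nonneg in \<open>auto intro!: AE_I2 mult_nonneg_nonneg divide_nonneg_pos\<close>)
    also have "\<dots> = G / D" unfolding G_def by (rule integral_divide_zero)
    finally show ?thesis .
  qed
  then show "((\<lambda>t. LINT w|conditioned_law \<P> t \<mu>. Hf w) \<longlongrightarrow> (LINT w|\<P>inf \<mu>. Hf w)) at_top"
    using lim by simp
qed

end

section \<open>Convergence of the conditioned laws\<close>

theorem proposition3p2:
  fixes P :: "real \<Rightarrow> 'e::polish_space \<Rightarrow> 'e measure"
    and W :: "'w measure"
    and \<xi> :: "real \<Rightarrow> 'w \<Rightarrow> 'e option"
    and Pr :: "'e \<Rightarrow> 'w measure"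
    and \<beta> \<sigma> :: "'e \<Rightarrow> real"
    and \<pi> :: "'e \<Rightarrow> real measure"
    and V :: "real \<Rightarrow> ('e \<Rightarrow> real) \<Rightarrow> 'e \<Rightarrow> real"
    and Q :: "real \<Rightarrow> 'e measure \<Rightarrow> 'e measure measure"
    and \<P> :: "'e measure \<Rightarrow> (real \<Rightarrow> 'e measure) measure"
    and \<P>inf :: "'e measure \<Rightarrow> (real \<Rightarrow> 'e measure) measure"
    and lam :: real
    and \<phi> :: "'e \<Rightarrow> real"
    and \<nu> :: "'e measure"
    and H :: "real \<Rightarrow> ('e \<Rightarrow> real) \<Rightarrow> 'e \<Rightarrow> real"
  defines "T \<equiv> mean_semigroup \<beta> \<xi> Pr"
  assumes spatial_motion: "borel_right_process euclidean P W \<xi> Pr"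
    and branching: "bounded_borel \<beta>" "bounded_borel \<sigma>" "levy_kernel \<pi>"
    and cumulant: "\<And>f. bounded_borel f \<Longrightarrow> (\<And>x. 0 \<le> f x) \<Longrightarrow>
          cumulant_solution (branching_mechanism \<beta> \<sigma> \<pi>) P f (\<lambda>t. V t f)"
    and superprocess: "superprocess V Q \<P>"
    and \<phi>: "bounded_borel \<phi>" "\<And>x. 0 < \<phi> x"
    and \<nu>: "prob_space \<nu>" "sets \<nu> = sets borel"
          "\<And>U. open U \<Longrightarrow> U \<noteq> {} \<Longrightarrow> 0 < emeasure \<nu> U"
    and normalized: "(LINT x|\<nu>. \<phi> x) = 1"
    and eigenfunction: "\<And>t x. 0 \<le> t \<Longrightarrow> T t (\<lambda>y. ennreal (\<phi> y)) x = ennreal (exp (lam * t) * \<phi> x)"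
    and eigenmeasure: "\<And>t B. 0 \<le> t \<Longrightarrow> B \<in> sets borel \<Longrightarrow>
          (\<integral>\<^sup>+ x. T t (indicator B) x \<partial>\<nu>) = ennreal (exp (lam * t)) * emeasure \<nu> B"
    and mean_expansion: "\<And>t x f. 0 < t \<Longrightarrow> f \<in> L1_plus \<nu> \<Longrightarrow>
          T t (\<lambda>y. ennreal (f y)) x < \<infinity> \<and>
          enn2real (T t (\<lambda>y. ennreal (f y)) x) = exp (lam * t) * \<phi> x * (LINT y|\<nu>. f y) * (1 + H t f x)"
    and H_bounded: "\<And>t. 0 < t \<Longrightarrow> (SUP x. SUP f\<in>L1_plus \<nu>. ennreal \<bar>H t f x\<bar>) < \<infinity>"
    and H_limit: "((\<lambda>t. SUP x. SUP f\<in>L1_plus \<nu>. ennreal \<bar>H t f x\<bar>) \<longlongrightarrow> 0) at_top"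
    and subcritical: "lam < 0"
    and extinction: "\<And>t. 0 < t \<Longrightarrow> 0 < measure (\<P> \<nu>) {w \<in> right_continuous_paths. w t = null_measure borel}"
    and limit_law: "\<And>\<mu>. \<mu> \<in> finite_borel_measures - {null_measure borel} \<Longrightarrow>
          is_phi_transform \<P> lam \<phi> \<mu> (\<P>inf \<mu>)"
  shows "\<forall>\<mu> \<in> finite_borel_measures - {null_measure borel}.
           converges_locally_strongly (\<lambda>t. conditioned_law \<P> t \<mu>) (\<P>inf \<mu>)"
proof -
  interpret subcritical_setting P W \<xi> Pr \<beta> \<sigma> \<pi> V Q \<P> \<P>inf lam \<phi> \<nu> H
  proof (intro subcritical_setting.intro superprocess_setting.intro cumulant_setting.intro
      spatial_motion.intro right_process.intro branching.intro subcritical_setting_axioms.intro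
      superprocess_setting_axioms.intro cumulant_setting_axioms.intro)
    show "borel_right_process euclidean P W \<xi> Pr" by (rule spatial_motion)
    show "bounded_borel \<beta>" "bounded_borel \<sigma>" "levy_kernel \<pi>" by (rule branching)+
    show "cumulant_solution (branching_mechanism \<beta> \<sigma> \<pi>) P f (\<lambda>t. V t f)"
      if "bounded_borel f" "\<And>x. 0 \<le> f x" for f by (rule cumulant[OF that])
    show "superprocess V Q \<P>" by (rule superprocess)
    show "enn2real (mean_semigroup \<beta> \<xi> Pr t (\<lambda>y. ennreal (f y)) x) =
        exp (lam * t) * \<phi> x * (LINT y|\<nu>. f y) * (1 + H t f x)"
      if "0 < t" "f \<in> L1_plus \<nu>" for t x f
      using mean_expansion[OF that] unfolding T_def by blast
  qed (fact \<phi> \<nu> normalized eigenfunction[unfolded T_def] H_bounded H_limit subcritical extinction limit_law)+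
  show ?thesis by (intro ballI conditioned_laws_converge)
qed

end
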